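(* Let $\epsilon_*\in(0,1)$, let $k_*$ be sufficiently large (depending on $\epsilon_*$), and let $\varphi:[-1,1]\to[-1,1]$ be non-decreasing, odd, and such that $$0\le\liminf_{z\to0^-}\frac{\varphi(z)}{z}=\limsup_{z\to0^+}\frac{\varphi(z)}{z}<\infty .$$ Let $\alpha>0$ be arbitrary, let $h_k=\beta_{k-1}^{-\alpha}$, and let $g$ be the $g$-function on the alphabet $\{+,-\}\times\{0,1\}$ built from $\epsilon_*,k_*,\varphi,(h_k)$ as described in the context. Then the stationary process specified by $g$ is unique (in law).
   Context: **Processes specified by $g$.** For a finite alphabet $A$ and measurable $g:A\times A^{\mathbb N}\to[0,1]$, a process $(Z_t)_{t\in\mathbb Z}$ with values in $A$ is specified by $g$ if for all $t$ and all $z_t\in A$, $P(Z_t=z_t\mid Z_{t-1}=z_{t-1},Z_{t-2}=z_{t-2},\dots)=g(z_t\mid z_{t-1},z_{t-2},\dots)$ almost surely. **Environment.** $Q$ is the law on $\{0,1\}^{\mathbb Z}$ under which the $\omega_t$ are i.i.d. with $Q(\omega_t=1)=\frac12$. Let $\ell_k=\lceil(1+\epsilon_* )^k\rceil$, $\beta_k=2^{\ell_k}$, $\nu_k=\beta_k/\beta_{k-1}$, and let $I_k$ be the word made of $\ell_k-1$ symbols $1$ followed by one symbol $0$. Intervals are subsets of $\mathbb Z$, $[a,b]=\{a,\dots,b\}$. $I_k$ is seen on $[a,b]$ (with $b-a+1=\ell_k$) if $(\omega_a,\dots,\omega_b)=I_k$. If $I_k$ is seen on two disjoint intervals $[a,b]$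 and $[a',b']$, $b<a'$, but on no other interval contained in $[a,b']$, then $[b,b'-1]$ is called a $k$-block. $Q$-almost surely, for each $k\ge k_*$ the $k$-blocks partition $\mathbb Z$; $B^k(t)=[a^k(t),b^k(t)]$ is the $k$-block containing $t$. For $k>k_*$ each $k$-block $B$ is a disjoint union $b_1\cup\dots\cup b_{N(B)}$ of $(k-1)$-blocks, ordered from left to right, and its beginning is $\mathcal C(B)=\bigcup_{i=1}^{N(B)\wedge\lfloor\nu_k^{1-\epsilon_*}\rfloor}b_i$. For a $k_*$-block $B=[a,b]$, $\mathcal C(B)=\{s\in B:|s-a|\le\beta_{k_*}^{1+\epsilon_*}\}$. **Active points.** For $k\ge k_*$, $t$ is $k$-active if for all $j\in\{k_*,\dots,k\}$: $t\in\mathcal C(B^j(t))$ and $|t-a^j(t)|<\beta_{j+1}$. $\mathcal A_k$ is the set of $k$-active points; for a $k$-block $B$, $\mathcal A(B)=\mathcal A_k\cap B$. Let $k_t=\inf\{k\ge k_*:t\notin\mathcal A_k\}$ ($\inf\varnothing=\infty$), and $S_t=\mathcal A(B^{k_t}(t))$ if $k_*<k_t<\infty$, $S_t=\varnothing$ otherwise. All these depend on $\omega$; $S_t$ and $k_t$ depend only on $(\omega_s)_{s\le t}$. **The $g$-function.** $(h_k)$ is a decreasing sequence of positive numbers with $h_k\searrow0$. For $x=(x_{t-1},x_{t-2},\dots)\in\{\pm1\}^{\mathbb N}$ set $\psi_t^\omega(x)=h_{k_t}\varphi\bigl(\frac1{|S_t|}\sum_{s\in S_t}x_s\bigr)$ if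 $S_t\ne\varnothing$ and $|t-a^{k_t}(t)|<\beta_{k_t+1}$, and $\psi_t^\omega(x)=0$ otherwise. With $Z_t=(X_t,\omega_t)\in\{+,-\}\times\{0,1\}$, $g\bigl((\pm,\omega_t)\mid(x_{t-1},\omega_{t-1}),(x_{t-2},\omega_{t-2}),\dots\bigr)=\frac14\{1\pm\psi_t^\omega(x_{-\infty}^{t-1})\}$, where $x_{-\infty}^{t-1}=(x_{t-1},x_{t-2},\dots)$. *)

theory Defs
  imports "HOL-Probability.Probability"
begin

text \<open>The past \<open>(z\<^sub>t\<^sub>-\<^sub>1, z\<^sub>t\<^sub>-\<^sub>2, \<dots>)\<close> is a function on \<^typ>\<open>nat\<close>: entry \<open>i\<close> is
  the value at time \<open>t - 1 - i\<close>.\<close>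

definition past :: "(int \<Rightarrow> 'a) \<Rightarrow> int \<Rightarrow> nat \<Rightarrow> 'a" where
  "past z t i = z (t - 1 - int i)"

definition specified_by ::
    "('a::finite \<Rightarrow> (nat \<Rightarrow> 'a) \<Rightarrow> real) \<Rightarrow> 'w measure \<Rightarrow> (int \<Rightarrow> 'w \<Rightarrow> 'a) \<Rightarrow> bool" where
  "specified_by g M Z \<longleftrightarrow>
     (\<forall>t. Z t \<in> measurable M (count_space UNIV)) \<and>
     (\<forall>t a. AE w in M.
        real_cond_exp M
          (vimage_algebra (space M) (\<lambda>w. past (\<lambda>s. Z s w) t) (\<Pi>\<^sub>M i\<in>UNIV. count_space UNIV))
          (indicator {w \<in> space M. Z t w = a}) w
        = g a (past (\<lambda>s. Z s w) t))"

abbreviation path_space :: "(int \<Rightarrow> 'a) measure" where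
  "path_space \<equiv> (\<Pi>\<^sub>M t\<in>UNIV. count_space UNIV)"

definition stationary :: "'w measure \<Rightarrow> (int \<Rightarrow> 'w \<Rightarrow> 'a) \<Rightarrow> bool" where
  "stationary M Z \<longleftrightarrow>
     (\<forall>r. distr M path_space (\<lambda>w t. Z (t + r) w) = distr M path_space (\<lambda>w t. Z t w))"

definition stationary_law_specified_by ::
    "('a::finite \<Rightarrow> (nat \<Rightarrow> 'a) \<Rightarrow> real) \<Rightarrow> (int \<Rightarrow> 'a) measure \<Rightarrow> bool" where
  "stationary_law_specified_by g P \<longleftrightarrow>
     prob_space P \<and> sets P = sets path_space \<and>
     stationary P (\<lambda>t z. z t) \<and> specified_by g P (\<lambda>t z. z t)"

text \<open>Environments are functions \<open>\<omega> :: int \<Rightarrow> bool\<close>, where \<^const>\<open>True\<close> is the symbol 1 and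
  \<^const>\<open>False\<close> the symbol 0. The parameters \<open>\<epsilon>\<close> and \<open>ks\<close> stand for \<open>\<epsilon>\<^sub>*\<close> and \<open>k\<^sub>*\<close>.\<close>

definition ell :: "real \<Rightarrow> nat \<Rightarrow> nat" where
  "ell \<epsilon> k = nat \<lceil>(1 + \<epsilon>) ^ k\<rceil>"

definition beta :: "real \<Rightarrow> nat \<Rightarrow> real" where
  "beta \<epsilon> k = 2 ^ ell \<epsilon> k"

definition nu :: "real \<Rightarrow> nat \<Rightarrow> real" where
  "nu \<epsilon> k = beta \<epsilon> k / beta \<epsilon> (k - 1)"

definition marker :: "real \<Rightarrow> nat \<Rightarrow> bool list" where
  "marker \<epsilon> k = replicate (ell \<epsilon> k - 1) True @ [False]"

definition seen :: "real \<Rightarrow> (int \<Rightarrow> bool) \<Rightarrow> nat \<Rightarrow> int \<Rightarrow> int \<Rightarrow> bool" where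
  "seen \<epsilon> \<omega> k a b \<longleftrightarrow> map \<omega> [a..b] = marker \<epsilon> k"

definition is_block :: "real \<Rightarrow> (int \<Rightarrow> bool) \<Rightarrow> nat \<Rightarrow> int set \<Rightarrow> bool" where
  "is_block \<epsilon> \<omega> k B \<longleftrightarrow>
     (\<exists>a b a' b'. seen \<epsilon> \<omega> k a b \<and> seen \<epsilon> \<omega> k a' b' \<and> b < a' \<and>
        (\<forall>c d. seen \<epsilon> \<omega> k c d \<and> {c..d} \<subseteq> {a..b'} \<longrightarrow> (c, d) = (a, b) \<or> (c, d) = (a', b')) \<and>
        B = {b..b' - 1})"

text \<open>The block containing \<open>t\<close>, and its left end. They are unspecified if there is no such block,
  which for i.i.d. fair bits happens with probability 0.\<close>

definition block :: "real \<Rightarrow> (int \<Rightarrow> bool) \<Rightarrow> nat \<Rightarrow> int \<Rightarrow> int set" where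
  "block \<epsilon> \<omega> k t = (THE B. is_block \<epsilon> \<omega> k B \<and> t \<in> B)"

definition block_start :: "real \<Rightarrow> (int \<Rightarrow> bool) \<Rightarrow> nat \<Rightarrow> int \<Rightarrow> int" where
  "block_start \<epsilon> \<omega> k t = Min (block \<epsilon> \<omega> k t)"

definition subblocks :: "real \<Rightarrow> (int \<Rightarrow> bool) \<Rightarrow> nat \<Rightarrow> int set \<Rightarrow> int set set" where
  "subblocks \<epsilon> \<omega> k B = {b. is_block \<epsilon> \<omega> (k - 1) b \<and> b \<subseteq> B}"

text \<open>The subblock \<open>b\<^sub>i\<close> is the one with exactly \<open>i - 1\<close> subblocks to its left, so the subblocks
  with fewer than \<open>m\<close> subblocks to their left are \<open>b\<^sub>1, \<dots>, b\<^sub>n\<close> with \<open>n = min N(B) m\<close>.\<close>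

definition beginning :: "real \<Rightarrow> nat \<Rightarrow> (int \<Rightarrow> bool) \<Rightarrow> nat \<Rightarrow> int set \<Rightarrow> int set" where
  "beginning \<epsilon> ks \<omega> k B =
     (if k = ks then {s \<in> B. real_of_int \<bar>s - Min B\<bar> \<le> beta \<epsilon> ks powr (1 + \<epsilon>)}
      else \<Union> {b \<in> subblocks \<epsilon> \<omega> k B.
              int (card {b' \<in> subblocks \<epsilon> \<omega> k B. Min b' < Min b}) < \<lfloor>nu \<epsilon> k powr (1 - \<epsilon>)\<rfloor>})"

definition active :: "real \<Rightarrow> nat \<Rightarrow> (int \<Rightarrow> bool) \<Rightarrow> nat \<Rightarrow> int set" where
  "active \<epsilon> ks \<omega> k =
     {t. \<forall>j\<in>{ks..k}. t \<in> beginning \<epsilon> ks \<omega> j (block \<epsilon> \<omega> j t) \<and>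
           real_of_int \<bar>t - block_start \<epsilon> \<omega> j t\<bar> < beta \<epsilon> (j + 1)}"

definition level :: "real \<Rightarrow> nat \<Rightarrow> (int \<Rightarrow> bool) \<Rightarrow> int \<Rightarrow> enat" where
  "level \<epsilon> ks \<omega> t = Inf {enat k | k. k \<ge> ks \<and> t \<notin> active \<epsilon> ks \<omega> k}"

definition infl_set :: "real \<Rightarrow> nat \<Rightarrow> (int \<Rightarrow> bool) \<Rightarrow> int \<Rightarrow> int set" where
  "infl_set \<epsilon> ks \<omega> t =
     (case level \<epsilon> ks \<omega> t of
        enat k \<Rightarrow> if ks < k then active \<epsilon> ks \<omega> k \<inter> block \<epsilon> \<omega> k t else {}
      | \<infinity> \<Rightarrow> {})"

text \<open>In \<open>psi\<close>, \<open>x i\<close> is the spin at time \<open>t - 1 - i\<close>; the points of \<open>infl_set \<epsilon> ks \<omega> t\<close> lie strictly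
  before \<open>t\<close>.\<close>

definition psi :: "real \<Rightarrow> nat \<Rightarrow> (real \<Rightarrow> real) \<Rightarrow> (nat \<Rightarrow> real) \<Rightarrow>
    (int \<Rightarrow> bool) \<Rightarrow> int \<Rightarrow> (nat \<Rightarrow> real) \<Rightarrow> real" where
  "psi \<epsilon> ks \<phi> h \<omega> t x =
     (let S = infl_set \<epsilon> ks \<omega> t in
      case level \<epsilon> ks \<omega> t of
        enat k \<Rightarrow>
          if S \<noteq> {} \<and> real_of_int \<bar>t - block_start \<epsilon> \<omega> k t\<bar> < beta \<epsilon> (k + 1)
          then h k * \<phi> ((\<Sum>s\<in>S. x (nat (t - 1 - s))) / real (card S))
          else 0
      | \<infinity> \<Rightarrow> 0)"

definition spin :: "bool \<Rightarrow> real" where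
  "spin x = (if x then 1 else - 1)"

text \<open>The alphabet is \<^typ>\<open>bool \<times> bool\<close>: spin (\<^const>\<open>True\<close> is plus), then environment bit.
  The g-function does not depend on \<open>t\<close>, so it is evaluated at \<open>t = 0\<close>. There \<open>psi\<close> depends on the
  environment at times \<open>s \<le> 0\<close> only, provided that the blocks containing 0 exist. The environment is
  therefore continued to \<open>s > 0\<close> by a fixed sequence, with symbol 0 exactly at the squares, in which
  every word made of 1s followed by a 0 occurs.\<close>

definition env :: "bool \<Rightarrow> (nat \<Rightarrow> bool) \<Rightarrow> int \<Rightarrow> bool" where
  "env w p s = (if s = 0 then w else if s < 0 then p (nat (- 1 - s)) else \<not> (\<exists>n. s = n\<^sup>2))"

definition g_fun :: "real \<Rightarrow> nat \<Rightarrow> (real \<Rightarrow> real) \<Rightarrow> (nat \<Rightarrow> real) \<Rightarrow>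
    bool \<times> bool \<Rightarrow> (nat \<Rightarrow> bool \<times> bool) \<Rightarrow> real" where
  "g_fun \<epsilon> ks \<phi> h a z =
     (1 + spin (fst a) *
        psi \<epsilon> ks \<phi> h (env (snd a) (\<lambda>i. snd (z i))) 0 (\<lambda>i. spin (fst (z i)))) / 4"

end

theory Submission
  imports Defs
begin

text \<open>
  Oddness and the condition on \<open>\<phi> z / z\<close> give \<open>\<bar>\<phi> z\<bar> \<le> C * \<bar>z\<bar>\<close>; no regularity away from 0 is available.
  Under \<open>g\<close> the bits are i.i.d. and fair. Given the bits, the influence of the distant past on a window
  is transmitted through a chain of averages over active sets of levels \<open>K\<^sub>1 < K\<^sub>2 < \<dots>\<close>: given the past, the spins in
  one such set are independent with means 0 or \<open>p = h K' * \<phi> m\<close>, where \<open>m\<close> is the average over the next set.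
  If \<open>\<bar>f m - f 0\<bar> \<le> L * \<bar>m\<bar>\<close>, then the expectation of \<open>f\<close> of the average of \<open>N\<close> such spins changes by at most
  \<open>3 * L * \<bar>p\<bar>\<close> when \<open>p\<close> is replaced by 0, uniformly in \<open>N\<close>. So each step multiplies the constant \<open>L\<close> by
  \<open>3 * C * h K'\<close>, which tends to 0, and the dependence on the distant past vanishes. This gives uniqueness
  among all laws specified by \<open>g\<close>, and then stationarity of the law, because its shifts are specified by \<open>g\<close> too.
  Existence follows from monotonicity: the process is the limit of the iteration started from all plus spins,
  driven by independent uniform variables.
\<close>

subsection \<open>Product laws of spins\<close>

text \<open>The obstacle is that the active sets have unbounded size and \<phi> may jump away from
  0. Coupling spin by spin costs a factor equal to the size of the set, and a Lipschitz bound does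
  not survive composition with \<phi>. The class of functions \<open>f\<close> with
  \<open>\<bar>f m - f 0\<bar> \<le> L * \<bar>m\<bar>\<close> survives both operations: \<phi>
  fixes 0 and is linearly bounded there, and the average of N independent spins fluctuates at the
  scale 1 / sqrt N, which hides any smaller bias. So two pasts are never compared with each other
  directly; each is compared with a past of average 0. The bound for the first set does come from
  spin-by-spin coupling and grows with the length of the initial block. This is harmless, since that
  block stays fixed while the chain of levels is continued. If the chain ends, nothing is
  transmitted at all. The bits can be frozen in this argument because each bit is independent of all
  earlier spins, so that knowing later bits leaves the law of a spin unchanged.\<close>

definition spin_mean :: "int set \<Rightarrow> (int \<Rightarrow> real) \<Rightarrow> (int set \<Rightarrow> real) \<Rightarrow> real" where
  "spin_mean A r F = (\<Sum>Y\<in>Pow A. (\<Prod>t\<in>A. (1 + r t * spin (t \<in> Y)) / 2) * F Y)"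

lemma spin_simps [simp]: "spin True = 1" "spin False = -1"
  by (auto simp: spin_def)

lemma abs_spin [simp]: "\<bar>spin b\<bar> = 1" and spin_sq [simp]: "spin b * spin b = 1"
  by (auto simp: spin_def)

lemma spin_mean_empty [simp]: "spin_mean {} r F = F {}"
  by (simp add: spin_mean_def)

text \<open>This conditions on the spin at \<open>t\<close>: \<open>Y\<close> is the set of plus
  sites and \<open>r t\<close> the mean of the spin at \<open>t\<close>. The moment computations
  below are inductions through it.\<close>

lemma spin_mean_insert:
  assumes "finite A" "t \<notin> A"
  shows "spin_mean (insert t A) r F =
    (1 + r t) / 2 * spin_mean A r (\<lambda>Y. F (insert t Y)) + (1 - r t) / 2 * spin_mean A r F"
proof -
  let ?w = "\<lambda>B Y. \<Prod>s\<in>B. (1 + r s * spin (s \<in> Y)) / 2"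
  have split: "Pow (insert t A) = Pow A \<union> insert t ` Pow A"
    by (rule Pow_insert)
  have disj: "Pow A \<inter> insert t ` Pow A = {}"
    using assms by auto
  have inj: "inj_on (insert t) (Pow A)"
    using assms by (auto simp: inj_on_def)
  have w1: "?w (insert t A) Y = (1 - r t) / 2 * ?w A Y" if "Y \<in> Pow A" for Y
  proof -
    have "t \<notin> Y" using assms that by auto
    then show ?thesis using assms by simp
  qed
  have w2: "?w (insert t A) (insert t Y) = (1 + r t) / 2 * ?w A Y" if "Y \<in> Pow A" for Y
  proof -
    have "s \<in> insert t Y \<longleftrightarrow> s \<in> Y" if "s \<in> A" for s
      using assms that by auto
    then have "?w A (insert t Y) = ?w A Y"
      by (intro prod.cong) simp_all
    then show ?thesis using assms by (subst prod.insert) auto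
  qed
  have "spin_mean (insert t A) r F = (\<Sum>Y\<in>Pow A. ?w (insert t A) Y * F Y)
      + (\<Sum>Y\<in>Pow A. ?w (insert t A) (insert t Y) * F (insert t Y))"
    unfolding spin_mean_def split using assms disj inj
    by (subst sum.union_disjoint) (auto simp: sum.reindex)
  also have "\<dots> = (\<Sum>Y\<in>Pow A. (1 - r t) / 2 * (?w A Y * F Y))
      + (\<Sum>Y\<in>Pow A. (1 + r t) / 2 * (?w A Y * F (insert t Y)))"
    by (intro arg_cong2[where f = "(+)"] sum.cong refl) (simp_all only: w1 w2 mult.assoc)
  finally show ?thesis
    unfolding spin_mean_def sum_distrib_left by simp
qed

lemma spin_mean_cong:
  assumes "\<And>Y. Y \<subseteq> A \<Longrightarrow> F Y = G Y" "\<And>t. t \<in> A \<Longrightarrow> r t = r' t"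
  shows "spin_mean A r F = spin_mean A r' G"
  unfolding spin_mean_def using assms by (intro sum.cong arg_cong2[where f = "(*)"] prod.cong) auto

lemma spin_mean_add: "spin_mean A r (\<lambda>Y. F Y + G Y) = spin_mean A r F + spin_mean A r G"
  by (simp add: spin_mean_def distrib_left sum.distrib)

lemma spin_mean_cmult: "spin_mean A r (\<lambda>Y. c * F Y) = c * spin_mean A r F"
  by (simp add: spin_mean_def sum_distrib_left mult_ac)

lemma spin_mean_const: "finite A \<Longrightarrow> spin_mean A r (\<lambda>_. c) = c"
  by (induction A rule: finite_induct) (auto simp: spin_mean_insert field_simps)

lemma spin_mean_mono:
  assumes "\<And>t. t \<in> A \<Longrightarrow> \<bar>r t\<bar> \<le> 1" "\<And>Y. Y \<subseteq> A \<Longrightarrow> F Y \<le> G Y"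
  shows "spin_mean A r F \<le> spin_mean A r G"
  unfolding spin_mean_def
proof (intro sum_mono mult_left_mono prod_nonneg ballI)
  fix Y t assume "t \<in> A"
  then show "0 \<le> (1 + r t * spin (t \<in> Y)) / 2"
    using assms(1)[of t] by (auto simp: spin_def)
qed (use assms in auto)

text \<open>Change of measure: the product is the density of the law with means \<open>r\<close>
  with respect to fair spins.\<close>

lemma spin_mean_likelihood:
  "spin_mean A r F = spin_mean A (\<lambda>_. 0) (\<lambda>Y. (\<Prod>t\<in>A. 1 + r t * spin (t \<in> Y)) * F Y)"
  unfolding spin_mean_def by (intro sum.cong refl) (simp add: prod_dividef power_one_over)

text \<open>Second moment of the density: under a fair spin the square of
  \<open>1 + r t * spin\<close> has mean \<open>1 + (r t)\<^sup>2\<close>, and the factors are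
  independent.\<close>

lemma spin_mean_likelihood_sq:
  assumes "finite A"
  shows "spin_mean A (\<lambda>_. 0) (\<lambda>Y. (\<Prod>t\<in>A. 1 + r t * spin (t \<in> Y))\<^sup>2) = (\<Prod>t\<in>A. 1 + (r t)\<^sup>2)"
  using assms
proof (induction A rule: finite_induct)
  case (insert t A)
  let ?R = "\<lambda>B Y. \<Prod>s\<in>B. 1 + r s * spin (s \<in> Y)"
  have "?R (insert t A) (insert t Y) = (1 + r t) * ?R A Y" if "Y \<subseteq> A" for Y
  proof -
    have "s \<in> insert t Y \<longleftrightarrow> s \<in> Y" if "s \<in> A" for s
      using insert.hyps that by auto
    then have "?R A (insert t Y) = ?R A Y" by (intro prod.cong) simp_all
    then show ?thesis using insert.hyps by simp
  qed
  then have e1: "spin_mean A (\<lambda>_. 0) (\<lambda>Y. (?R (insert t A) (insert t Y))\<^sup>2)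
      = spin_mean A (\<lambda>_. 0) (\<lambda>Y. (1 + r t)\<^sup>2 * (?R A Y)\<^sup>2)"
    by (intro spin_mean_cong) (simp_all add: power_mult_distrib)
  have "?R (insert t A) Y = (1 - r t) * ?R A Y" if "Y \<subseteq> A" for Y
  proof -
    have "t \<notin> Y" using insert.hyps that by auto
    then show ?thesis using insert.hyps by simp
  qed
  then have e2: "spin_mean A (\<lambda>_. 0) (\<lambda>Y. (?R (insert t A) Y)\<^sup>2)
      = spin_mean A (\<lambda>_. 0) (\<lambda>Y. (1 - r t)\<^sup>2 * (?R A Y)\<^sup>2)"
    by (intro spin_mean_cong) (simp_all add: power_mult_distrib)
  have "(1 + 0) / 2 * ((1 + r t)\<^sup>2 * c) + (1 - 0) / 2 * ((1 - r t)\<^sup>2 * c) = (1 + (r t)\<^sup>2) * c" for c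
    by (simp add: power2_eq_square field_simps)
  then show ?case
    unfolding spin_mean_insert[OF insert.hyps] e1 e2 spin_mean_cmult insert.IH
    unfolding prod.insert[OF insert.hyps] .
qed simp

lemma spin_mean_sum:
  assumes "finite A"
  shows "spin_mean A r (\<lambda>Y. \<Sum>t\<in>A. spin (t \<in> Y)) = (\<Sum>t\<in>A. r t)"
    and "spin_mean A r (\<lambda>Y. (\<Sum>t\<in>A. spin (t \<in> Y))\<^sup>2) = (\<Sum>t\<in>A. 1 - (r t)\<^sup>2) + (\<Sum>t\<in>A. r t)\<^sup>2"
proof -
  \<comment> \<open>Both moments go through one induction, since expanding the square after adding a
    spin produces the first moment.\<close>
  have "spin_mean A r (\<lambda>Y. \<Sum>t\<in>A. spin (t \<in> Y)) = (\<Sum>t\<in>A. r t) \<and>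
    spin_mean A r (\<lambda>Y. (\<Sum>t\<in>A. spin (t \<in> Y))\<^sup>2) = (\<Sum>t\<in>A. 1 - (r t)\<^sup>2) + (\<Sum>t\<in>A. r t)\<^sup>2"
    using assms
  proof (induction A rule: finite_induct)
    case (insert t A)
    let ?S = "\<lambda>B Y. \<Sum>s\<in>B. spin (s \<in> Y)"
    have s1: "?S (insert t A) (insert t Y) = ?S A Y + 1" for Y
    proof -
      have "s \<in> insert t Y \<longleftrightarrow> s \<in> Y" if "s \<in> A" for s
        using insert.hyps that by auto
      then have "?S A (insert t Y) = ?S A Y" by (intro sum.cong) simp_all
      then show ?thesis using insert.hyps by simp
    qed
    have s2: "?S (insert t A) Y = ?S A Y - 1" if "Y \<subseteq> A" for Y
    proof -
      have "t \<notin> Y" using insert.hyps that by auto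
      then show ?thesis using insert.hyps by simp
    qed
    have sq1: "(?S A Y + 1)\<^sup>2 = (?S A Y)\<^sup>2 + (2 * ?S A Y + 1)" for Y
      by (simp add: power2_eq_square algebra_simps)
    have sq2: "(?S A Y - 1)\<^sup>2 = (?S A Y)\<^sup>2 + ((-2) * ?S A Y + 1)" for Y
      by (simp add: power2_eq_square algebra_simps)
    have e1: "spin_mean A r (\<lambda>Y. ?S (insert t A) (insert t Y)) = spin_mean A r (?S A) + 1"
      by (simp only: s1 spin_mean_add spin_mean_const[OF insert.hyps(1)])
    have e2: "spin_mean A r (?S (insert t A)) = spin_mean A r (?S A) - 1"
    proof -
      have "spin_mean A r (?S (insert t A)) = spin_mean A r (\<lambda>Y. ?S A Y + (-1))"
        by (intro spin_mean_cong) (simp_all add: s2)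
      then show ?thesis by (simp only: spin_mean_add spin_mean_const[OF insert.hyps(1)])
    qed
    have f1: "spin_mean A r (\<lambda>Y. (?S (insert t A) (insert t Y))\<^sup>2)
        = spin_mean A r (\<lambda>Y. (?S A Y)\<^sup>2) + (2 * spin_mean A r (?S A) + 1)"
      by (simp only: s1 sq1 spin_mean_add spin_mean_cmult spin_mean_const[OF insert.hyps(1)])
    have f2: "spin_mean A r (\<lambda>Y. (?S (insert t A) Y)\<^sup>2)
        = spin_mean A r (\<lambda>Y. (?S A Y)\<^sup>2) + ((-2) * spin_mean A r (?S A) + 1)"
    proof -
      have "spin_mean A r (\<lambda>Y. (?S (insert t A) Y)\<^sup>2)
          = spin_mean A r (\<lambda>Y. (?S A Y)\<^sup>2 + ((-2) * ?S A Y + 1))"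
        by (intro spin_mean_cong) (simp_all only: s2 sq2)
      then show ?thesis
        by (simp only: spin_mean_add spin_mean_cmult spin_mean_const[OF insert.hyps(1)])
    qed
    show ?case
      unfolding spin_mean_insert[OF insert.hyps] e1 e2 f1 f2 insert.IH[THEN conjunct1]
        insert.IH[THEN conjunct2]
      using insert.hyps by (simp add: power2_eq_square field_simps)
  qed simp
  then show "spin_mean A r (\<lambda>Y. \<Sum>t\<in>A. spin (t \<in> Y)) = (\<Sum>t\<in>A. r t)"
    and "spin_mean A r (\<lambda>Y. (\<Sum>t\<in>A. spin (t \<in> Y))\<^sup>2) = (\<Sum>t\<in>A. 1 - (r t)\<^sup>2) + (\<Sum>t\<in>A. r t)\<^sup>2"
    by auto
qed

text \<open>The variance of the average contributes at most 1 / N and its squared mean at most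
  \<open>p\<^sup>2\<close>.\<close>

lemma spin_mean_average_sq_le:
  assumes "finite A" "A \<noteq> {}" "\<And>t. t \<in> A \<Longrightarrow> \<bar>r t\<bar> \<le> p"
  shows "spin_mean A r (\<lambda>Y. ((\<Sum>t\<in>A. spin (t \<in> Y)) / card A)\<^sup>2) \<le> 1 / card A + p\<^sup>2"
proof -
  let ?N = "real (card A)"
  have N: "?N > 0" using assms by (simp add: card_gt_0_iff)
  have "\<bar>\<Sum>t\<in>A. r t\<bar> \<le> (\<Sum>t\<in>A. p)"
    using assms by (intro order.trans[OF sum_abs] sum_mono)
  then have "\<bar>\<Sum>t\<in>A. r t\<bar> \<le> \<bar>?N * p\<bar>" by simp
  then have "(\<Sum>t\<in>A. r t)\<^sup>2 \<le> (?N * p)\<^sup>2"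
    by (rule abs_le_square_iff[THEN iffD1])
  moreover have "(\<Sum>t\<in>A. 1 - (r t)\<^sup>2) \<le> (\<Sum>t\<in>A. 1)"
    by (intro sum_mono) auto
  ultimately have "spin_mean A r (\<lambda>Y. (\<Sum>t\<in>A. spin (t \<in> Y))\<^sup>2) \<le> ?N + ?N\<^sup>2 * p\<^sup>2"
    using spin_mean_sum(2)[OF assms(1), of r] by (simp add: power_mult_distrib)
  moreover have "spin_mean A r (\<lambda>Y. ((\<Sum>t\<in>A. spin (t \<in> Y)) / card A)\<^sup>2)
      = 1 / ?N\<^sup>2 * spin_mean A r (\<lambda>Y. (\<Sum>t\<in>A. spin (t \<in> Y))\<^sup>2)"
    by (subst spin_mean_cmult[symmetric]) (simp add: power_divide)
  moreover have "1 / ?N\<^sup>2 * (?N + ?N\<^sup>2 * p\<^sup>2) = 1 / ?N + p\<^sup>2"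
    using N by (simp add: power2_eq_square field_simps)
  ultimately show ?thesis
    using N by (metis mult_left_mono zero_le_divide_1_iff zero_le_power2)
qed

lemma exp_minus_one_le: "exp x - 1 \<le> 2 * x" if "0 \<le> x" "x \<le> 1" for x :: real
proof -
  have "exp x \<le> 1 + x + x\<^sup>2" using that by (intro exp_bound) auto
  moreover have "x\<^sup>2 \<le> x" using that by (simp add: power2_eq_square mult_left_le)
  ultimately show ?thesis by linarith
qed

text \<open>Young's inequality with a free weight: it reduces mixed moments to second moments and
  spares a Cauchy-Schwarz inequality for \<open>spin_mean\<close>.\<close>

lemma mult_le_weighted_squares: "a * b \<le> (c * a\<^sup>2 + b\<^sup>2 / c) / 2" if "c > 0" for a b c :: real
proof -
  have "0 \<le> (c * a - b)\<^sup>2 / c" using that by simp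
  also have "\<dots> = c * a\<^sup>2 + b\<^sup>2 / c - 2 * (a * b)"
    using that by (simp add: power2_eq_square field_simps)
  finally show ?thesis by simp
qed

text \<open>In this regime 1 / N is at most \<open>q\<^sup>2\<close>, so the second moment is at
  most \<open>2 * q\<^sup>2\<close>. Young's inequality with weight \<open>1 / q\<close> turns this
  into \<open>q + q / 2\<close>.\<close>

lemma spin_mean_abs_average_le:
  fixes q :: real
  assumes "finite A" "A \<noteq> {}" "\<And>t. t \<in> A \<Longrightarrow> \<bar>r t\<bar> \<le> q" "0 < q" "q \<le> 1" "1 \<le> card A * q\<^sup>2"
  shows "spin_mean A r (\<lambda>Y. \<bar>(\<Sum>t\<in>A. spin (t \<in> Y)) / card A\<bar>) \<le> 3 / 2 * q"
proof -
  let ?m = "\<lambda>Y. (\<Sum>t\<in>A. spin (t \<in> Y)) / card A"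
  note q = \<open>0 < q\<close>
  have "spin_mean A r (\<lambda>Y. \<bar>?m Y\<bar>) \<le> spin_mean A r (\<lambda>Y. 1 / (2 * q) * (?m Y)\<^sup>2 + q / 2)"
  proof (rule spin_mean_mono)
    fix Y
    show "\<bar>?m Y\<bar> \<le> 1 / (2 * q) * (?m Y)\<^sup>2 + q / 2"
      using mult_le_weighted_squares[of "1 / q" "\<bar>?m Y\<bar>" 1] q by (simp add: field_simps)
  qed (use assms in force)
  also have "\<dots> = 1 / (2 * q) * spin_mean A r (\<lambda>Y. (?m Y)\<^sup>2) + q / 2"
    by (simp only: spin_mean_add spin_mean_cmult spin_mean_const[OF assms(1)])
  also have "\<dots> \<le> 1 / (2 * q) * (2 * q\<^sup>2) + q / 2"
  proof (intro add_right_mono mult_left_mono)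
    have "1 / card A \<le> q\<^sup>2"
      using assms(1,2,6) by (simp add: field_simps card_gt_0_iff)
    then show "spin_mean A r (\<lambda>Y. (?m Y)\<^sup>2) \<le> 2 * q\<^sup>2"
      using spin_mean_average_sq_le[OF assms(1,2), of r q] assms(3) by fastforce
  qed (use q in simp)
  also have "1 / (2 * q) * (2 * q\<^sup>2) + q / 2 = 3 / 2 * q"
    using q by (simp add: power2_eq_square field_simps)
  finally show ?thesis .
qed

text \<open>For small \<open>p\<close> the likelihood ratio \<open>\<Prod>t. 1 + r t * spin\<close> is compared with 1 in mean square,
  which costs \<open>p * sqrt N\<close> against a fluctuation \<open>1 / sqrt N\<close> of the average; for \<open>p\<close> larger than
  \<open>1 / sqrt N\<close> the average itself is of order \<open>p\<close>. No regularity of \<open>f\<close> away from 0 is needed.\<close>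

lemma spin_mean_of_average_bound:
  fixes f :: "real \<Rightarrow> real"
  assumes A: "finite A" and r: "\<And>t. t \<in> A \<Longrightarrow> \<bar>r t\<bar> \<le> p" and p: "0 \<le> p" "p \<le> 1"
    and f: "\<And>m. \<bar>m\<bar> \<le> 1 \<Longrightarrow> \<bar>f m - f 0\<bar> \<le> L * \<bar>m\<bar>"
  defines "m \<equiv> \<lambda>Y. (\<Sum>t\<in>A. spin (t \<in> Y)) / card A"
  shows "\<bar>spin_mean A r (\<lambda>Y. f (m Y)) - spin_mean A (\<lambda>_. 0) (\<lambda>Y. f (m Y))\<bar> \<le> 3 * L * p"
proof -
  have L: "0 \<le> L" using f[of 1] by simp
  consider "A = {}" | "p = 0" | "A \<noteq> {}" "p > 0" using p by fastforce
  then show ?thesis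
  proof cases
    case 1
    then show ?thesis using L p by simp
  next
    case 2
    then have "spin_mean A r (\<lambda>Y. f (m Y)) = spin_mean A (\<lambda>_. 0) (\<lambda>Y. f (m Y))"
      using r by (intro spin_mean_cong) auto
    then show ?thesis using 2 by simp
  next
    case 3
    let ?N = "real (card A)"
    have N: "?N > 0" using 3 A by (simp add: card_gt_0_iff)
    have m1: "\<bar>m Y\<bar> \<le> 1" for Y
    proof -
      have "\<bar>\<Sum>t\<in>A. spin (t \<in> Y)\<bar> \<le> (\<Sum>t\<in>A. 1)"
        by (intro order.trans[OF sum_abs] sum_mono) simp
      then show ?thesis using N by (simp add: m_def field_simps)
    qed
    define g where "g Y = f (m Y) - f 0" for Y
    have g: "\<bar>g Y\<bar> \<le> L * \<bar>m Y\<bar>" for Y using f m1 by (simp add: g_def)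
    have shift: "spin_mean A r (\<lambda>Y. f (m Y)) = spin_mean A r g + f 0" for r
    proof -
      have "spin_mean A r (\<lambda>Y. f (m Y)) = spin_mean A r (\<lambda>Y. g Y + f 0)"
        by (simp add: g_def)
      then show ?thesis by (simp only: spin_mean_add spin_mean_const[OF A])
    qed
    show ?thesis
    proof (cases "1 \<le> ?N * p\<^sup>2")
      case True
      \<comment> \<open>Here \<open>p\<close> dominates the fluctuation of the average: each of the
        two expectations is of order \<open>L * p\<close> by itself, and no cancellation between
        them is used.\<close>
      have *: "\<bar>spin_mean A r' g\<bar> \<le> 3 / 2 * L * p" if r': "\<And>t. t \<in> A \<Longrightarrow> \<bar>r' t\<bar> \<le> p" for r'
      proof -
        have r1: "\<And>t. t \<in> A \<Longrightarrow> \<bar>r' t\<bar> \<le> 1" using r' p by force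
        have "spin_mean A r' g \<le> spin_mean A r' (\<lambda>Y. L * \<bar>m Y\<bar>)"
          using g r1 by (intro spin_mean_mono) (auto intro: order.trans[OF abs_ge_self])
        moreover have "spin_mean A r' (\<lambda>Y. (- L) * \<bar>m Y\<bar>) \<le> spin_mean A r' g"
        proof (rule spin_mean_mono)
          show "- L * \<bar>m Y\<bar> \<le> g Y" for Y using g[of Y] by linarith
        qed (use r1 in auto)
        moreover have "spin_mean A r' (\<lambda>Y. \<bar>m Y\<bar>) \<le> 3 / 2 * p"
          unfolding m_def using A 3 r' p True by (intro spin_mean_abs_average_le) auto
        then have "L * spin_mean A r' (\<lambda>Y. \<bar>m Y\<bar>) \<le> L * (3 / 2 * p)"
          using L by (rule mult_left_mono)
        ultimately show ?thesis unfolding spin_mean_cmult by (simp add: abs_le_iff algebra_simps)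
      qed
      have "\<bar>spin_mean A r g\<bar> \<le> 3 / 2 * L * p" by (rule *) (use r in auto)
      moreover have "\<bar>spin_mean A (\<lambda>_. 0) g\<bar> \<le> 3 / 2 * L * p" by (rule *) (use p in auto)
      ultimately show ?thesis unfolding shift by linarith
    next
      case False
      \<comment> \<open>Here the density is close to 1 in mean square: its variance is at most
        \<open>2 * N * p\<^sup>2\<close>, where \<open>N * p\<^sup>2 < 1\<close> makes the
        exponential bound linear.\<close>
      define R where "R Y = (\<Prod>t\<in>A. 1 + r t * spin (t \<in> Y))" for Y
      let ?E = "spin_mean A (\<lambda>_. 0)"
      have ER: "?E R = 1"
        using spin_mean_likelihood[of A r "\<lambda>_. 1"] spin_mean_const[OF A, of r 1]
        by (simp add: R_def[abs_def])
      have "?E (\<lambda>Y. (R Y - 1)\<^sup>2) = ?E (\<lambda>Y. (R Y)\<^sup>2 + ((-2) * R Y + 1))"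
        by (intro spin_mean_cong) (simp_all add: power2_eq_square algebra_simps)
      also have "\<dots> = (\<Prod>t\<in>A. 1 + (r t)\<^sup>2) - 1"
        unfolding spin_mean_add spin_mean_cmult ER spin_mean_const[OF A]
        using spin_mean_likelihood_sq[OF A, of r] by (simp add: R_def[abs_def])
      also have "(\<Prod>t\<in>A. 1 + (r t)\<^sup>2) \<le> (\<Prod>t\<in>A. exp (p\<^sup>2))"
      proof (rule prod_mono)
        fix t assume "t \<in> A"
        then have "(r t)\<^sup>2 \<le> p\<^sup>2" using r p by (metis abs_le_square_iff abs_of_nonneg)
        then show "0 \<le> 1 + (r t)\<^sup>2 \<and> 1 + (r t)\<^sup>2 \<le> exp (p\<^sup>2)"
          using exp_ge_add_one_self[of "p\<^sup>2"] by (smt (verit) zero_le_power2)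
      qed
      also have "(\<Prod>t\<in>A. exp (p\<^sup>2)) - 1 = exp (?N * p\<^sup>2) - 1"
        by (simp add: exp_of_nat_mult)
      also have "\<dots> \<le> 2 * (?N * p\<^sup>2)"
        using False by (intro exp_minus_one_le) auto
      finally have varR: "?E (\<lambda>Y. (R Y - 1)\<^sup>2) \<le> 2 * (?N * p\<^sup>2)" by simp
      have "?E (\<lambda>Y. (g Y)\<^sup>2) \<le> ?E (\<lambda>Y. L\<^sup>2 * (m Y)\<^sup>2)"
      proof (rule spin_mean_mono)
        show "(g Y)\<^sup>2 \<le> L\<^sup>2 * (m Y)\<^sup>2" for Y
          using power_mono[OF g[of Y], of 2] by (simp add: power_mult_distrib)
      qed simp
      also have "\<dots> \<le> L\<^sup>2 * (1 / ?N)"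
        unfolding spin_mean_cmult m_def
        using spin_mean_average_sq_le[OF A \<open>A \<noteq> {}\<close>, of "\<lambda>_. 0" 0] by (intro mult_left_mono) auto
      finally have varg: "?E (\<lambda>Y. (g Y)\<^sup>2) \<le> L\<^sup>2 / ?N" by simp
      have diff: "spin_mean A r g - ?E g = ?E (\<lambda>Y. (R Y - 1) * g Y)"
      proof -
        have "?E (\<lambda>Y. (R Y - 1) * g Y) = ?E (\<lambda>Y. R Y * g Y + (-1) * g Y)"
          by (simp add: algebra_simps)
        then show ?thesis
          unfolding spin_mean_add spin_mean_cmult spin_mean_likelihood[of A r g] R_def by simp
      qed
      \<comment> \<open>The sign \<open>s\<close> is 1 or -1, which gives both halves of the
        absolute value.\<close>
      have bound: "s * ?E (\<lambda>Y. (R Y - 1) * g Y) \<le> 3 / 2 * L * p" if s: "s\<^sup>2 = 1" for s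
      proof (cases "L = 0")
        case True
        then have "g Y = 0" for Y using g[of Y] by simp
        then show ?thesis using True spin_mean_const[OF A, of "\<lambda>_. 0" 0] by simp
      next
        case False
        \<comment> \<open>Up to a constant this weight balances the second moments
          \<open>2 * N * p\<^sup>2\<close> and \<open>L\<^sup>2 / N\<close>: the two terms become
          \<open>L * p\<close> and \<open>L * p / 2\<close>. It must be positive, hence the separate
          case \<open>L = 0\<close>.\<close>
        define c where "c = L / (?N * p)"
        have c: "c > 0" using False L N 3 by (simp add: c_def)
        have "s * ?E (\<lambda>Y. (R Y - 1) * g Y) = ?E (\<lambda>Y. (R Y - 1) * (s * g Y))"
          by (subst spin_mean_cmult[symmetric]) (simp add: mult_ac)
        also have "\<dots> \<le> ?E (\<lambda>Y. c / 2 * (R Y - 1)\<^sup>2 + 1 / (2 * c) * (g Y)\<^sup>2)"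
        proof (rule spin_mean_mono)
          fix Y
          show "(R Y - 1) * (s * g Y) \<le> c / 2 * (R Y - 1)\<^sup>2 + 1 / (2 * c) * (g Y)\<^sup>2"
            using mult_le_weighted_squares[OF c, of "R Y - 1" "s * g Y"] s
            by (simp add: power_mult_distrib add_divide_distrib)
        qed simp
        also have "\<dots> = c / 2 * ?E (\<lambda>Y. (R Y - 1)\<^sup>2) + 1 / (2 * c) * ?E (\<lambda>Y. (g Y)\<^sup>2)"
          by (simp only: spin_mean_add spin_mean_cmult)
        also have "\<dots> \<le> c / 2 * (2 * (?N * p\<^sup>2)) + 1 / (2 * c) * (L\<^sup>2 / ?N)"
          using varR varg c by (intro add_mono mult_left_mono) auto
        also have "\<dots> = 3 / 2 * L * p"
          using False N 3 unfolding c_def by (simp add: power2_eq_square field_simps)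
        finally show ?thesis .
      qed
      have "\<bar>spin_mean A r g - ?E g\<bar> \<le> 3 / 2 * L * p"
        unfolding diff using bound[of 1] bound[of "-1"] by (simp add: abs_le_iff)
      also have "\<dots> \<le> 3 * L * p" using L p by simp
      finally show ?thesis unfolding shift by simp
    qed
  qed
qed

section \<open>Redrawing the spins of a window from left to right\<close>

definition resample :: "real \<Rightarrow> int \<Rightarrow> ((int \<Rightarrow> bool) \<Rightarrow> real) \<Rightarrow> (int \<Rightarrow> bool) \<Rightarrow> real" where
  "resample q t F x = (1 + q) / 2 * F (x(t := True)) + (1 - q) / 2 * F (x(t := False))"

text \<open>Conditional expectation of \<open>F\<close> given the initial configuration
  \<open>x\<close> when the sites \<open>u, ..., u + n - 1\<close> are redrawn in this order, each
  with the mean that \<Psi> assigns to the current configuration.\<close>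

primrec evolve :: "(int \<Rightarrow> (int \<Rightarrow> bool) \<Rightarrow> real) \<Rightarrow> int \<Rightarrow> nat \<Rightarrow> ((int \<Rightarrow> bool) \<Rightarrow> real) \<Rightarrow>
    (int \<Rightarrow> bool) \<Rightarrow> real" where
  "evolve \<Psi> u 0 F x = F x"
| "evolve \<Psi> u (Suc n) F x = resample (\<Psi> u x) u (evolve \<Psi> (u + 1) n F) x"

lemma evolve_add: "evolve \<Psi> u (m + n) F x = evolve \<Psi> u m (evolve \<Psi> (u + int m) n F) x"
proof (induction m arbitrary: u x)
  case (Suc m)
  have "evolve \<Psi> (u + 1) (m + n) F = evolve \<Psi> (u + 1) m (evolve \<Psi> (u + int (Suc m)) n F)"
    by (rule ext) (simp add: Suc.IH add_ac)
  then show ?case by simp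
qed simp

lemma resample_bounds:
  assumes "\<bar>q\<bar> \<le> 1" "lo \<le> F (x(t := True))" "F (x(t := True)) \<le> hi"
    "lo \<le> F (x(t := False))" "F (x(t := False)) \<le> hi"
  shows "lo \<le> resample q t F x" "resample q t F x \<le> hi"
proof -
  have w: "0 \<le> (1 + q) / 2" "0 \<le> (1 - q) / 2" using assms(1) by auto
  have "(1 + q) / 2 * lo + (1 - q) / 2 * lo \<le> resample q t F x"
    unfolding resample_def using assms w by (intro add_mono mult_left_mono)
  then show "lo \<le> resample q t F x" by (simp add: field_simps)
  have "resample q t F x \<le> (1 + q) / 2 * hi + (1 - q) / 2 * hi"
    unfolding resample_def using assms w by (intro add_mono mult_left_mono)
  then show "resample q t F x \<le> hi" by (simp add: field_simps)
qed

lemma evolve_bounds: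
  assumes "\<And>t x. \<bar>\<Psi> t x\<bar> \<le> 1" "\<And>x. lo \<le> F x" "\<And>x. F x \<le> hi"
  shows "lo \<le> evolve \<Psi> u n F x \<and> evolve \<Psi> u n F x \<le> hi"
proof (induction n arbitrary: u x)
  case (Suc n)
  then show ?case
    unfolding evolve.simps
    using resample_bounds[OF assms(1), of lo "evolve \<Psi> (u + 1) n F" x u hi] by blast
qed (use assms in auto)

lemma evolve_abs_le:
  assumes "\<And>t x. \<bar>\<Psi> t x\<bar> \<le> 1" "\<And>x. \<bar>F x\<bar> \<le> B"
  shows "\<bar>evolve \<Psi> u n F x\<bar> \<le> B"
  using evolve_bounds[of \<Psi> "-B" F B u n x] assms by (simp add: abs_le_iff minus_le_iff)

text \<open>\<open>R t\<close> couples two evolutions in which the sites before \<open>t\<close> have received the same new spins.\<close>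

lemma evolve_coupling:
  assumes R: "R u x x'"
    and upd: "\<And>y y' t b. R t y y' \<Longrightarrow> u \<le> t \<Longrightarrow> t < u + int n \<Longrightarrow> R (t + 1) (y(t := b)) (y'(t := b))"
    and D: "\<And>y y' t. R t y y' \<Longrightarrow> u \<le> t \<Longrightarrow> t < u + int n \<Longrightarrow> \<bar>\<Psi> t y - \<Psi>' t y'\<bar> \<le> D"
    and F: "\<And>y y'. R (u + int n) y y' \<Longrightarrow> F y = F' y'"
    and bd: "\<And>t x. \<bar>\<Psi> t x\<bar> \<le> 1" "\<And>t x. \<bar>\<Psi>' t x\<bar> \<le> 1" "\<And>x. \<bar>F x\<bar> \<le> B"
  shows "\<bar>evolve \<Psi> u n F x - evolve \<Psi>' u n F' x'\<bar> \<le> real n * (D * B)"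
  using R upd D F
proof (induction n arbitrary: u x x')
  case 0
  then show ?case by simp
next
  case (Suc n)
  let ?G = "evolve \<Psi> (u + 1) n F" and ?G' = "evolve \<Psi>' (u + 1) n F'"
  let ?q = "\<Psi> u x" and ?q' = "\<Psi>' u x'"
  have q: "\<bar>?q - ?q'\<bar> \<le> D" using Suc.prems by simp
  have step: "\<bar>?G (x(u := b)) - ?G' (x'(u := b))\<bar> \<le> real n * (D * B)" for b
  proof (rule Suc.IH)
    show "R (u + 1) (x(u := b)) (x'(u := b))" by (rule Suc.prems(2)[OF Suc.prems(1)]) simp_all
    show "R (t + 1) (y(t := c)) (y'(t := c))" if "R t y y'" "u + 1 \<le> t" "t < u + 1 + int n" for y y' t c
      by (rule Suc.prems(2)) (use that in simp_all)
    show "\<bar>\<Psi> t y - \<Psi>' t y'\<bar> \<le> D" if "R t y y'" "u + 1 \<le> t" "t < u + 1 + int n" for y y' t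
      by (rule Suc.prems(3)) (use that in simp_all)
    show "F y = F' y'" if "R (u + 1 + int n) y y'" for y y'
      by (rule Suc.prems(4)) (use that in \<open>simp add: add.assoc\<close>)
  qed
  have GB: "\<bar>?G y\<bar> \<le> B" for y using bd by (intro evolve_abs_le)
  \<comment> \<open>The difference splits into the average, under the common mean
    \<open>?q'\<close>, of the two inductive differences, and the change of mean from
    \<open>?q'\<close> to \<open>?q\<close> paired with half the effect of the spin at
    \<open>u\<close> on \<open>?G\<close>. The leading \<open>resample\<close> term is 0.\<close>
  have "evolve \<Psi> u (Suc n) F x - evolve \<Psi>' u (Suc n) F' x' =
      resample ?q' u (\<lambda>_. 0) x
      + ((1 + ?q') / 2 * (?G (x(u := True)) - ?G' (x'(u := True)))
      + (1 - ?q') / 2 * (?G (x(u := False)) - ?G' (x'(u := False))))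
      + (?q - ?q') * ((?G (x(u := True)) - ?G (x(u := False))) / 2)"
    by (simp add: resample_def field_simps)
  also have "\<bar>\<dots>\<bar> \<le> real n * (D * B) + D * B"
  proof -
    have w: "0 \<le> (1 + ?q') / 2" "0 \<le> (1 - ?q') / 2" using bd(2)[of u x'] by auto
    have "\<bar>(1 + ?q') / 2 * (?G (x(u := True)) - ?G' (x'(u := True)))
      + (1 - ?q') / 2 * (?G (x(u := False)) - ?G' (x'(u := False)))\<bar>
      \<le> (1 + ?q') / 2 * (real n * (D * B)) + (1 - ?q') / 2 * (real n * (D * B))"
      using w step
      by (intro order.trans[OF abs_triangle_ineq] add_mono) (simp_all only: abs_mult abs_of_nonneg mult_left_mono)
    moreover have "(1 + ?q') / 2 * (real n * (D * B)) + (1 - ?q') / 2 * (real n * (D * B)) = real n * (D * B)"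
      by (simp add: field_simps)
    moreover have "\<bar>(?q - ?q') * ((?G (x(u := True)) - ?G (x(u := False))) / 2)\<bar> \<le> D * B"
      unfolding abs_mult
    proof (rule mult_mono)
      show "\<bar>(?G (x(u := True)) - ?G (x(u := False))) / 2\<bar> \<le> B"
        using GB[of "x(u := True)"] GB[of "x(u := False)"] by (simp add: abs_le_iff)
    qed (use q in auto)
    ultimately show ?thesis by (simp add: resample_def abs_le_iff)
  qed
  finally show ?case by (simp add: algebra_simps)
qed

lemma evolve_eq:
  assumes R: "R u x x'"
    and upd: "\<And>y y' t b. R t y y' \<Longrightarrow> u \<le> t \<Longrightarrow> t < u + int n \<Longrightarrow> R (t + 1) (y(t := b)) (y'(t := b))"
    and eq: "\<And>y y' t. R t y y' \<Longrightarrow> u \<le> t \<Longrightarrow> t < u + int n \<Longrightarrow> \<Psi> t y = \<Psi>' t y'"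
    and F: "\<And>y y'. R (u + int n) y y' \<Longrightarrow> F y = F' y'"
  shows "evolve \<Psi> u n F x = evolve \<Psi>' u n F' x'"
  using R upd eq F
proof (induction n arbitrary: u x x')
  case (Suc n)
  have "evolve \<Psi> (u + 1) n F (x(u := b)) = evolve \<Psi>' (u + 1) n F' (x'(u := b))" for b
  proof (rule Suc.IH)
    show "R (u + 1) (x(u := b)) (x'(u := b))" by (rule Suc.prems(2)[OF Suc.prems(1)]) simp_all
    show "R (t + 1) (y(t := c)) (y'(t := c))" if "R t y y'" "u + 1 \<le> t" "t < u + 1 + int n" for y y' t c
      by (rule Suc.prems(2)) (use that in simp_all)
    show "\<Psi> t y = \<Psi>' t y'" if "R t y y'" "u + 1 \<le> t" "t < u + 1 + int n" for y y' t
      by (rule Suc.prems(3)) (use that in simp_all)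
    show "F y = F' y'" if "R (u + 1 + int n) y y'" for y y'
      by (rule Suc.prems(4)) (use that in \<open>simp add: add.assoc\<close>)
  qed
  then show ?case using Suc.prems by (simp add: resample_def)
qed simp

text \<open>Sites outside \<open>A\<close> are redrawn too, but neither \<open>G\<close> nor the
  means on \<open>A\<close> react to them, so each of these steps averages two equal
  numbers.\<close>

lemma evolve_product_law:
  assumes r: "\<And>t x. t \<in> A \<Longrightarrow> \<Psi> t x = r t"
    and G: "\<And>x y. (\<And>t. t \<in> A \<Longrightarrow> x t = y t) \<Longrightarrow> G x = G y"
  shows "evolve \<Psi> u n G x = spin_mean (A \<inter> {u..<u + int n}) r
    (\<lambda>Y. G (\<lambda>s. if s \<in> A \<inter> {u..<u + int n} then s \<in> Y else x s))"
proof (induction n arbitrary: u x)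
  case (Suc n)
  define A' where "A' = A \<inter> {u + 1..<u + 1 + int n}"
  have A': "finite A'" "u \<notin> A'" by (auto simp: A'_def)
  have IH: "evolve \<Psi> (u + 1) n G y = spin_mean A' r (\<lambda>Y. G (\<lambda>s. if s \<in> A' then s \<in> Y else y s))" for y
    unfolding A'_def by (rule Suc.IH)
  show ?case
  proof (cases "u \<in> A")
    case True
    then have A: "A \<inter> {u..<u + int (Suc n)} = insert u A'" by (auto simp: A'_def)
    have t: "spin_mean A' r (\<lambda>Y. G (\<lambda>s. if s \<in> A' then s \<in> Y else (x(u := True)) s))
      = spin_mean A' r (\<lambda>Y. G (\<lambda>s. if s \<in> insert u A' then s \<in> insert u Y else x s))"
      using A' by (intro spin_mean_cong arg_cong[where f = G]) (auto simp: fun_eq_iff)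
    have f: "spin_mean A' r (\<lambda>Y. G (\<lambda>s. if s \<in> A' then s \<in> Y else (x(u := False)) s))
      = spin_mean A' r (\<lambda>Y. G (\<lambda>s. if s \<in> insert u A' then s \<in> Y else x s))"
      using A' by (intro spin_mean_cong arg_cong[where f = G]) (auto simp: fun_eq_iff)
    show ?thesis
      unfolding A spin_mean_insert[OF A'] evolve.simps resample_def IH t f r[OF True] ..
  next
    case False
    then have A: "A \<inter> {u..<u + int (Suc n)} = A'" by (auto simp: A'_def) (metis linorder_not_le order_le_less zless_imp_add1_zle)
    have *: "spin_mean A' r (\<lambda>Y. G (\<lambda>s. if s \<in> A' then s \<in> Y else (x(u := b)) s))
      = spin_mean A' r (\<lambda>Y. G (\<lambda>s. if s \<in> A' then s \<in> Y else x s))" for b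
      using False by (intro spin_mean_cong G) auto
    show ?thesis
      unfolding A evolve.simps resample_def IH * by (simp add: field_simps)
  qed
qed simp

subsection \<open>Markers, blocks and active points\<close>

text \<open>The word is indexed by the position of its final 0, so that the predicate looks only to
  the left. Lengths 0 and 1 both mean a single 0.\<close>

definition mark :: "nat \<Rightarrow> (int \<Rightarrow> bool) \<Rightarrow> int \<Rightarrow> bool" where
  "mark l \<omega> b \<longleftrightarrow> (\<forall>s\<in>{b - int l<..<b}. \<omega> s) \<and> \<not> \<omega> b"

text \<open>The left end of a block is the position of the final 0 of a marker, so \<open>last_mark\<close> finds the
  start of the block of \<open>t\<close> without looking beyond \<open>t\<close>. If there is no marker, it is an unspecified
  value that is still at most \<open>t\<close>; hence \<open>drift\<close> below is a measurable and bounded version of \<^const>\<open>psi\<close>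
  that is defined for all environments.\<close>

definition last_mark :: "nat \<Rightarrow> (int \<Rightarrow> bool) \<Rightarrow> int \<Rightarrow> int" where
  "last_mark l \<omega> t = t - int (LEAST n. mark l \<omega> (t - int n))"

text \<open>The only almost sure property required of the bits. Marks to the right, on which the
  existence of blocks depends as well, are supplied by the fixed continuation in
  \<open>env\<close>.\<close>

definition left_marked :: "(int \<Rightarrow> bool) \<Rightarrow> bool" where
  "left_marked \<omega> \<longleftrightarrow> (\<forall>l t. \<exists>b\<le>t. mark l \<omega> b)"

definition right_marked :: "(int \<Rightarrow> bool) \<Rightarrow> bool" where
  "right_marked \<omega> \<longleftrightarrow> (\<forall>l t. \<exists>b>t. mark l \<omega> b)"

lemma last_mark_le: "last_mark l \<omega> t \<le> t"
  by (simp add: last_mark_def)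

lemma last_mark_bounds:
  assumes "mark l \<omega> b" "b \<le> t"
  shows mark_last_mark: "mark l \<omega> (last_mark l \<omega> t)" and last_mark_ge: "b \<le> last_mark l \<omega> t"
proof -
  have *: "mark l \<omega> (t - int (nat (t - b)))" using assms by simp
  show "mark l \<omega> (last_mark l \<omega> t)"
    unfolding last_mark_def by (rule LeastI[where P = "\<lambda>n. mark l \<omega> (t - int n)", OF *])
  have "(LEAST n. mark l \<omega> (t - int n)) \<le> nat (t - b)"
    by (rule Least_le[where P = "\<lambda>n. mark l \<omega> (t - int n)", OF *])
  then show "b \<le> last_mark l \<omega> t" using assms(2) by (simp add: last_mark_def)
qed

lemma last_mark_eqI:
  assumes "mark l \<omega> b" "b \<le> t" "\<And>c. b < c \<Longrightarrow> c \<le> t \<Longrightarrow> \<not> mark l \<omega> c"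
  shows "last_mark l \<omega> t = b"
  using last_mark_bounds[OF assms(1,2)] last_mark_le[of l \<omega> t] assms(3)[of "last_mark l \<omega> t"]
  by fastforce

lemma mark_antimono: "l \<le> l' \<Longrightarrow> mark l' \<omega> b \<Longrightarrow> mark l \<omega> b"
  by (auto simp: mark_def)

lemma left_marked_mark: "left_marked \<omega> \<Longrightarrow> mark l \<omega> (last_mark l \<omega> t)"
  using last_mark_bounds(1) unfolding left_marked_def by blast

lemma last_mark_antimono: "left_marked \<omega> \<Longrightarrow> l \<le> l' \<Longrightarrow> last_mark l' \<omega> t \<le> last_mark l \<omega> t"
  using left_marked_mark[of \<omega> l' t] mark_antimono last_mark_ge last_mark_le by blast

lemma last_mark_mono: "left_marked \<omega> \<Longrightarrow> s \<le> t \<Longrightarrow> last_mark l \<omega> s \<le> last_mark l \<omega> t"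
  using left_marked_mark[of \<omega> l s] last_mark_ge last_mark_le order.trans by metis

lemma last_mark_const:
  assumes "left_marked \<omega>" "last_mark l \<omega> t \<le> s" "s \<le> t"
  shows "last_mark l \<omega> s = last_mark l \<omega> t"
  using left_marked_mark[OF assms(1), of l t] assms last_mark_ge last_mark_mono
  by (metis order_antisym)

text \<open>A fixed 0 at or before \<open>u\<close> cannot lie among the ones of a marker. Once
  \<open>l\<close> exceeds its distance to \<open>t\<close>, no marker of length \<open>l\<close>
  ends after \<open>u\<close> and up to \<open>t\<close>.\<close>

lemma last_mark_unbounded:
  assumes "left_marked \<omega>"
  shows "\<exists>l0. \<forall>l\<ge>l0. last_mark l \<omega> t \<le> u"
proof -
  obtain b where b: "b \<le> min t u" "mark 0 \<omega> b" using assms unfolding left_marked_def by blast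
  have "last_mark l \<omega> t \<le> u" if l: "nat (t - b) + 1 \<le> l" for l
  proof (rule ccontr)
    assume "\<not> last_mark l \<omega> t \<le> u"
    moreover have "last_mark l \<omega> t - int l < b" using last_mark_le[of l \<omega> t] l b by linarith
    ultimately have "\<omega> b"
      using left_marked_mark[OF assms, of l t] b unfolding mark_def by auto
    then show False using b by (simp add: mark_def)
  qed
  then show ?thesis by blast
qed

lemma mark_shift: "(\<And>s. s \<le> b \<Longrightarrow> \<omega>' s = \<omega> (s + d)) \<Longrightarrow> mark l \<omega>' b \<longleftrightarrow> mark l \<omega> (b + d)"
proof -
  assume *: "\<And>s. s \<le> b \<Longrightarrow> \<omega>' s = \<omega> (s + d)"
  have "(\<forall>s\<in>{b - int l<..<b}. \<omega>' s) \<longleftrightarrow> (\<forall>s\<in>{b - int l<..<b}. \<omega> (s + d))"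
    using * by auto
  also have "\<dots> \<longleftrightarrow> (\<forall>s\<in>(\<lambda>s. s + d) ` {b - int l<..<b}. \<omega> s)" by simp
  also have "(\<lambda>s. s + d) ` {b - int l<..<b} = {b + d - int l<..<b + d}"
    by (auto simp: image_iff intro!: bexI[where x = "_ - d"])
  finally show ?thesis using *[of b] by (simp add: mark_def)
qed

lemma last_mark_shift:
  assumes "\<And>s. s \<le> t \<Longrightarrow> \<omega>' s = \<omega> (s + d)"
  shows "last_mark l \<omega>' t = last_mark l \<omega> (t + d) - d"
proof -
  have "mark l \<omega>' (t - int n) \<longleftrightarrow> mark l \<omega> (t + d - int n)" for n
    using mark_shift[of "t - int n" \<omega>' \<omega> d l] assms by (simp add: algebra_simps)
  then show ?thesis by (simp add: last_mark_def)
qed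

section \<open>Marker lengths and blocks\<close>

lemma ell_ge_1: "0 < \<epsilon> \<Longrightarrow> 1 \<le> ell \<epsilon> k"
proof -
  assume "0 < \<epsilon>"
  then have "0 < (1 + \<epsilon>) ^ k" by simp
  then have "1 \<le> \<lceil>(1 + \<epsilon>) ^ k\<rceil>" by linarith
  then show ?thesis unfolding ell_def by linarith
qed

lemma ell_mono: "0 < \<epsilon> \<Longrightarrow> j \<le> k \<Longrightarrow> ell \<epsilon> j \<le> ell \<epsilon> k"
  unfolding ell_def by (intro nat_mono ceiling_mono power_increasing) auto

lemma ell_at_top: "0 < \<epsilon> \<Longrightarrow> filterlim (ell \<epsilon>) at_top sequentially"
  unfolding filterlim_at_top
proof
  fix Z :: nat assume "0 < \<epsilon>"
  then obtain n where n: "real Z < (1 + \<epsilon>) ^ n" using real_arch_pow[of "1 + \<epsilon>"] by auto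
  have "Z \<le> ell \<epsilon> k" if "n \<le> k" for k
  proof -
    have "(1 + \<epsilon>) ^ n \<le> (1 + \<epsilon>) ^ k" using that \<open>0 < \<epsilon>\<close> by (intro power_increasing) auto
    then have "int Z \<le> \<lceil>(1 + \<epsilon>) ^ k\<rceil>" using n by linarith
    then show ?thesis by (simp add: ell_def)
  qed
  then show "\<forall>\<^sub>F k in sequentially. Z \<le> ell \<epsilon> k" by (auto simp: eventually_sequentially)
qed

lemma seen_iff:
  assumes "0 < \<epsilon>"
  shows "seen \<epsilon> \<omega> k a b \<longleftrightarrow> a = b - int (ell \<epsilon> k) + 1 \<and> mark (ell \<epsilon> k) \<omega> b"
proof -
  let ?l = "ell \<epsilon> k"
  note l = ell_ge_1[OF assms, of k]
  have *: "map \<omega> [a..b] = replicate (?l - 1) True @ [False] \<longleftrightarrow> mark ?l \<omega> b"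
    if ab: "a = b - int ?l + 1"
  proof -
    have "[a..b] = [a..b - 1] @ [b]" using ab l by (intro upto_rec2) auto
    moreover have "length (map \<omega> [a..b - 1]) = ?l - 1" using ab l by simp
    moreover have "map \<omega> [a..b - 1] = replicate (?l - 1) True \<longleftrightarrow> (\<forall>s\<in>{b - int ?l<..<b}. \<omega> s)"
    proof -
      have len: "length (map \<omega> [a..b - 1]) = ?l - 1" using ab l by simp
      have "map \<omega> [a..b - 1] = replicate (?l - 1) True \<longleftrightarrow> (\<forall>y\<in>set (map \<omega> [a..b - 1]). y = True)"
      proof
        assume "map \<omega> [a..b - 1] = replicate (?l - 1) True"
        then show "\<forall>y\<in>set (map \<omega> [a..b - 1]). y = True" by (metis in_set_replicate)
      next
        assume "\<forall>y\<in>set (map \<omega> [a..b - 1]). y = True"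
        from replicate_length_same[OF this] show "map \<omega> [a..b - 1] = replicate (?l - 1) True"
          unfolding len by (rule sym)
      qed
      also have "\<dots> \<longleftrightarrow> (\<forall>s\<in>{b - int ?l<..<b}. \<omega> s)"
        using ab by auto
      finally show ?thesis .
    qed
    ultimately show ?thesis by (simp add: mark_def)
  qed
  have "a = b - int ?l + 1" if "map \<omega> [a..b] = replicate (?l - 1) True @ [False]"
  proof -
    have "nat (b - a + 1) = ?l" using arg_cong[OF that, of length] l by simp
    then show ?thesis using l by arith
  qed
  then show ?thesis unfolding seen_def marker_def using * by blast
qed

text \<open>The final 0 of the earlier marker cannot be among the ones of the later one. Distinct
  occurrences of a marker are therefore disjoint.\<close>

lemma mark_gap: "mark l \<omega> b \<Longrightarrow> mark l \<omega> b' \<Longrightarrow> b < b' \<Longrightarrow> b \<le> b' - int l"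
  unfolding mark_def by (meson greaterThanLessThan_iff linorder_not_le)

text \<open>By \<open>mark_gap\<close> the disjointness demanded in \<open>is_block\<close> is
  automatic, and a further occurrence inside \<open>{a..b'}\<close> would be a mark strictly between
  \<open>b\<close> and \<open>b'\<close>. Blocks are thus the gaps between consecutive
  marks.\<close>

lemma is_block_iff:
  assumes "0 < \<epsilon>"
  shows "is_block \<epsilon> \<omega> k B \<longleftrightarrow> (\<exists>b b'. mark (ell \<epsilon> k) \<omega> b \<and> mark (ell \<epsilon> k) \<omega> b' \<and> b < b' \<and>
    (\<forall>c. b < c \<and> c < b' \<longrightarrow> \<not> mark (ell \<epsilon> k) \<omega> c) \<and> B = {b..b' - 1})"
    (is "_ \<longleftrightarrow> (\<exists>b b'. ?P b b')")
proof
  let ?l = "int (ell \<epsilon> k)"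
  note l = ell_ge_1[OF assms, of k]
  {
    assume "is_block \<epsilon> \<omega> k B"
    then obtain a b a' b' where b0: "seen \<epsilon> \<omega> k a b" "seen \<epsilon> \<omega> k a' b'" "b < a'" "B = {b..b' - 1}"
      and uniq: "\<And>c d. seen \<epsilon> \<omega> k c d \<Longrightarrow> {c..d} \<subseteq> {a..b'} \<Longrightarrow> (c, d) = (a, b) \<or> (c, d) = (a', b')"
      unfolding is_block_def by blast
    have ab: "a = b - ?l + 1" "a' = b' - ?l + 1" and m: "mark (ell \<epsilon> k) \<omega> b" "mark (ell \<epsilon> k) \<omega> b'"
      using b0 unfolding seen_iff[OF assms] by blast+
    have no: "\<not> mark (ell \<epsilon> k) \<omega> c" if "b < c" "c < b'" for c
    proof
      assume "mark (ell \<epsilon> k) \<omega> c"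
      then have "seen \<epsilon> \<omega> k (c - ?l + 1) c" unfolding seen_iff[OF assms] by blast
      moreover have "{c - ?l + 1..c} \<subseteq> {a..b'}" unfolding ab using that l by simp
      ultimately show False using uniq that by blast
    qed
    have "b < b'" using b0(3) ab l by linarith
    then have "?P b b'" using m no b0(4) by blast
    then show "\<exists>b b'. ?P b b'" by blast
  }
  {
    assume "\<exists>b b'. ?P b b'"
    then obtain b b' where P: "?P b b'" by blast
    have gap: "b \<le> b' - ?l" using P mark_gap by blast
    have "(c, d) = (b - ?l + 1, b) \<or> (c, d) = (b' - ?l + 1, b')"
      if "seen \<epsilon> \<omega> k c d" "{c..d} \<subseteq> {b - ?l + 1..b'}" for c d
    proof -
      have c: "c = d - ?l + 1" and d: "mark (ell \<epsilon> k) \<omega> d"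
        using that(1) unfolding seen_iff[OF assms] by blast+
      have "c \<in> {b - ?l + 1..b'}" "d \<in> {b - ?l + 1..b'}" using c l that(2) by (auto simp: subset_iff)
      then have "d = b \<or> d = b'" using P c d by force
      then show ?thesis using c by blast
    qed
    moreover have "seen \<epsilon> \<omega> k (b - ?l + 1) b" "seen \<epsilon> \<omega> k (b' - ?l + 1) b'"
      using P unfolding seen_iff[OF assms] by blast+
    moreover have "b < b' - ?l + 1" using gap by linarith
    ultimately show "is_block \<epsilon> \<omega> k B"
      unfolding is_block_def using P by blast
  }
qed

lemma last_mark_cell:
  assumes "mark l \<omega> b" "mark l \<omega> b'" "b < b'" "\<And>c. b < c \<Longrightarrow> c < b' \<Longrightarrow> \<not> mark l \<omega> c"
  shows "{s. last_mark l \<omega> s = b} = {b..b' - 1}"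
proof (intro equalityI subsetI CollectI)
  fix s assume "s \<in> {s. last_mark l \<omega> s = b}"
  then have s: "last_mark l \<omega> s = b" by simp
  have "\<not> b' \<le> s" using last_mark_ge[OF assms(2), of s] s assms(3) by auto
  then show "s \<in> {b..b' - 1}" using last_mark_le[of l \<omega> s] s by auto
next
  fix s assume "s \<in> {b..b' - 1}"
  then show "last_mark l \<omega> s = b" using assms by (intro last_mark_eqI) auto
qed

lemma next_mark:
  assumes "right_marked \<omega>"
  obtains b' where "t < b'" "mark l \<omega> b'" "\<And>c. t < c \<Longrightarrow> c < b' \<Longrightarrow> \<not> mark l \<omega> c"
proof -
  obtain b where b: "t < b" "mark l \<omega> b" using assms unfolding right_marked_def by blast
  let ?P = "\<lambda>n. mark l \<omega> (t + 1 + int n)"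
  have P: "?P (nat (b - t - 1))" using b by simp
  define n where "n = (LEAST n. ?P n)"
  have 1: "?P n" unfolding n_def using P by (rule LeastI)
  have 2: "\<not> mark l \<omega> c" if "t < c" "c < t + 1 + int n" for c
  proof -
    have "nat (c - t - 1) < n" using that by linarith
    then have "\<not> ?P (nat (c - t - 1))" unfolding n_def by (rule not_less_Least)
    then show ?thesis using that by simp
  qed
  show ?thesis by (rule that[OF _ 1 2]) simp
qed

context
  fixes \<epsilon> :: real and \<omega> :: "int \<Rightarrow> bool"
  assumes eps: "0 < \<epsilon>" and lm: "left_marked \<omega>" and rm: "right_marked \<omega>"
begin

text \<open>Two consecutive marks delimit a level set of \<open>last_mark\<close>, and
  \<open>right_marked\<close> provides the right end. This makes the definite description in
  \<open>block\<close> denote.\<close>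

lemma is_block_containing_iff:
  "is_block \<epsilon> \<omega> k B \<and> t \<in> B \<longleftrightarrow> B = {s. last_mark (ell \<epsilon> k) \<omega> s = last_mark (ell \<epsilon> k) \<omega> t}"
proof
  let ?l = "ell \<epsilon> k"
  {
    assume "is_block \<epsilon> \<omega> k B \<and> t \<in> B"
    then obtain b b' where P: "mark ?l \<omega> b" "mark ?l \<omega> b'" "b < b'" "\<And>c. b < c \<Longrightarrow> c < b' \<Longrightarrow> \<not> mark ?l \<omega> c"
      "B = {b..b' - 1}" and "t \<in> B" unfolding is_block_iff[OF eps] by blast
    then have "last_mark ?l \<omega> t = b" using last_mark_cell[OF P(1-4)] P(5) by blast
    then show "B = {s. last_mark ?l \<omega> s = last_mark ?l \<omega> t}"
      using last_mark_cell[OF P(1-4)] P(5) by simp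
  }
  {
    assume B: "B = {s. last_mark ?l \<omega> s = last_mark ?l \<omega> t}"
    obtain b' where b': "t < b'" "mark ?l \<omega> b'" "\<And>c. t < c \<Longrightarrow> c < b' \<Longrightarrow> \<not> mark ?l \<omega> c"
      using next_mark[OF rm] by blast
    let ?b = "last_mark ?l \<omega> t"
    have m: "mark ?l \<omega> ?b" using lm by (rule left_marked_mark)
    have lt: "?b < b'" using last_mark_le[of ?l \<omega> t] b' by linarith
    have no: "\<not> mark ?l \<omega> c" if "?b < c" "c < b'" for c
      using last_mark_ge[of ?l \<omega> c t] b'(3)[of c] that by force
    have "B = {?b..b' - 1}" unfolding B by (rule last_mark_cell[OF m b'(2) lt no])
    then show "is_block \<epsilon> \<omega> k B \<and> t \<in> B"
      unfolding is_block_iff[OF eps] using m b'(2) lt no B by blast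
  }
qed

lemma block_eq: "block \<epsilon> \<omega> k t = {s. last_mark (ell \<epsilon> k) \<omega> s = last_mark (ell \<epsilon> k) \<omega> t}"
  unfolding block_def is_block_containing_iff by simp

lemma Min_block:
  "Min {s. last_mark (ell \<epsilon> k) \<omega> s = last_mark (ell \<epsilon> k) \<omega> t} = last_mark (ell \<epsilon> k) \<omega> t"
proof -
  let ?l = "ell \<epsilon> k" and ?B = "{s. last_mark (ell \<epsilon> k) \<omega> s = last_mark (ell \<epsilon> k) \<omega> t}"
  have "is_block \<epsilon> \<omega> k ?B" using is_block_containing_iff[of k ?B t] by blast
  then have fin: "finite ?B" unfolding is_block_iff[OF eps] by auto
  have "last_mark ?l \<omega> (last_mark ?l \<omega> t) = last_mark ?l \<omega> t"
    using last_mark_const[OF lm order.refl last_mark_le] .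
  moreover have "last_mark ?l \<omega> t \<le> s" if "s \<in> ?B" for s
    using that last_mark_le[of ?l \<omega> s] by simp
  ultimately show ?thesis using fin by (intro Min_eqI) auto
qed

lemma block_start_eq: "block_start \<epsilon> \<omega> k t = last_mark (ell \<epsilon> k) \<omega> t"
  unfolding block_start_def block_eq by (rule Min_block)

end

section \<open>Activity, levels and drift, read off from the past alone\<close>

definition in_beginning :: "real \<Rightarrow> nat \<Rightarrow> (int \<Rightarrow> bool) \<Rightarrow> nat \<Rightarrow> int \<Rightarrow> bool" where
  "in_beginning \<epsilon> ks \<omega> k t \<longleftrightarrow>
     (if k = ks then real_of_int (t - last_mark (ell \<epsilon> ks) \<omega> t) \<le> beta \<epsilon> ks powr (1 + \<epsilon>)
      else int (card {b \<in> {last_mark (ell \<epsilon> k) \<omega> t..<last_mark (ell \<epsilon> (k - 1)) \<omega> t}.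
             mark (ell \<epsilon> (k - 1)) \<omega> b}) < \<lfloor>nu \<epsilon> k powr (1 - \<epsilon>)\<rfloor>)"

definition act :: "real \<Rightarrow> nat \<Rightarrow> (int \<Rightarrow> bool) \<Rightarrow> nat \<Rightarrow> int \<Rightarrow> bool" where
  "act \<epsilon> ks \<omega> k t \<longleftrightarrow> (\<forall>j\<in>{ks..k}. in_beginning \<epsilon> ks \<omega> j t \<and>
     real_of_int (t - last_mark (ell \<epsilon> j) \<omega> t) < beta \<epsilon> (j + 1))"

text \<open>Activity decreases with the level, so at most one \<open>k\<close> qualifies. A first
  failure at \<open>ks\<close> is excluded, since the influence set is then empty.\<close>

definition has_level :: "real \<Rightarrow> nat \<Rightarrow> (int \<Rightarrow> bool) \<Rightarrow> int \<Rightarrow> nat \<Rightarrow> bool" where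
  "has_level \<epsilon> ks \<omega> t k \<longleftrightarrow> ks < k \<and> act \<epsilon> ks \<omega> (k - 1) t \<and> \<not> act \<epsilon> ks \<omega> k t"

text \<open>Cutting at \<open>t\<close> makes the set finite and independent of the future in every
  environment; \<open>act_level_past\<close> shows that nothing is lost where the drift is not cut
  off.\<close>

definition parents :: "real \<Rightarrow> nat \<Rightarrow> (int \<Rightarrow> bool) \<Rightarrow> int \<Rightarrow> nat \<Rightarrow> int set" where
  "parents \<epsilon> ks \<omega> t k = {s \<in> {last_mark (ell \<epsilon> k) \<omega> t..<t}.
     act \<epsilon> ks \<omega> k s \<and> last_mark (ell \<epsilon> k) \<omega> s = last_mark (ell \<epsilon> k) \<omega> t}"

definition average :: "int set \<Rightarrow> (int \<Rightarrow> bool) \<Rightarrow> real" where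
  "average S x = (\<Sum>s\<in>S. spin (x s)) / card S"

definition drift :: "real \<Rightarrow> nat \<Rightarrow> (real \<Rightarrow> real) \<Rightarrow> (nat \<Rightarrow> real) \<Rightarrow> (int \<Rightarrow> bool) \<Rightarrow> int \<Rightarrow>
    (int \<Rightarrow> bool) \<Rightarrow> real" where
  "drift \<epsilon> ks \<phi> h \<omega> t x =
     (let k = (LEAST k. has_level \<epsilon> ks \<omega> t k) in
      if has_level \<epsilon> ks \<omega> t k \<and> real_of_int (t - last_mark (ell \<epsilon> k) \<omega> t) < beta \<epsilon> (k + 1)
      then h k * \<phi> (average (parents \<epsilon> ks \<omega> t k) x) else 0)"

lemma act_antimono: "j \<le> k \<Longrightarrow> act \<epsilon> ks \<omega> k t \<Longrightarrow> act \<epsilon> ks \<omega> j t"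
  by (auto simp: act_def)

lemma act_SucI:
  assumes "act \<epsilon> ks \<omega> (k - 1) t" "in_beginning \<epsilon> ks \<omega> k t" "real_of_int (t - last_mark (ell \<epsilon> k) \<omega> t) < beta \<epsilon> (k + 1)"
  shows "act \<epsilon> ks \<omega> k t"
  unfolding act_def
proof
  fix j assume "j \<in> {ks..k}"
  then have "j = k \<or> j \<in> {ks..k - 1}" by auto
  then show "in_beginning \<epsilon> ks \<omega> j t \<and> real_of_int (t - last_mark (ell \<epsilon> j) \<omega> t) < beta \<epsilon> (j + 1)"
    using assms unfolding act_def by blast
qed

lemma has_level_unique:
  assumes "has_level \<epsilon> ks \<omega> t j" "has_level \<epsilon> ks \<omega> t k"
  shows "j = k"
proof -
  have "\<not> j < k" if "has_level \<epsilon> ks \<omega> t j" "has_level \<epsilon> ks \<omega> t k" for j k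
  proof
    assume "j < k"
    then have "j \<le> k - 1" by linarith
    then show False using that act_antimono[of j "k - 1" \<epsilon> ks \<omega> t] unfolding has_level_def by blast
  qed
  then show ?thesis using assms by (meson linorder_neqE_nat)
qed

lemma drift_level:
  assumes "has_level \<epsilon> ks \<omega> t k"
  shows "drift \<epsilon> ks \<phi> h \<omega> t x =
    (if real_of_int (t - last_mark (ell \<epsilon> k) \<omega> t) < beta \<epsilon> (k + 1)
     then h k * \<phi> (average (parents \<epsilon> ks \<omega> t k) x) else 0)"
proof -
  have "(LEAST k. has_level \<epsilon> ks \<omega> t k) = k"
    using assms has_level_unique by (metis LeastI)
  then show ?thesis using assms by (simp add: drift_def Let_def)
qed

lemma drift_no_level: "(\<And>k. \<not> has_level \<epsilon> ks \<omega> t k) \<Longrightarrow> drift \<epsilon> ks \<phi> h \<omega> t x = 0"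
  by (simp add: drift_def Let_def)

lemma abs_average_le: "\<bar>average S x\<bar> \<le> 1"
proof -
  have "\<bar>\<Sum>s\<in>S. spin (x s)\<bar> \<le> (\<Sum>s\<in>S. 1)"
    by (intro order.trans[OF sum_abs] sum_mono) simp
  then show ?thesis by (auto simp: average_def divide_le_eq_1)
qed

lemma average_mono: "x \<le> y \<Longrightarrow> average S x \<le> average S y"
  unfolding average_def
  by (intro divide_right_mono sum_mono) (auto simp: le_fun_def spin_def)

lemma average_cong: "(\<And>s. s \<in> S \<Longrightarrow> x s = y s) \<Longrightarrow> average S x = average S y"
  unfolding average_def by (intro arg_cong2[where f = "(/)"] sum.cong) auto

lemma finite_parents: "finite (parents \<epsilon> ks \<omega> t k)"
  by (auto simp: parents_def intro: finite_subset[of _ "{last_mark (ell \<epsilon> k) \<omega> t..<t}"])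

text \<open>One statement for two uses: \<open>d = 0\<close> is causality, and shifted
  configurations give translation invariance. Agreement up to \<open>t\<close> suffices because
  marks, activity and parents are all determined from the left.\<close>

lemma drift_shift:
  assumes w: "\<And>s. s \<le> t \<Longrightarrow> \<omega>' s = \<omega> (s + d)" and x: "\<And>s. s < t \<Longrightarrow> x' s = x (s + d)"
  shows "drift \<epsilon> ks \<phi> h \<omega>' t x' = drift \<epsilon> ks \<phi> h \<omega> (t + d) x"
proof -
  have lm: "last_mark l \<omega>' s = last_mark l \<omega> (s + d) - d" if "s \<le> t" for l s
    using that w by (intro last_mark_shift) auto
  have beg: "in_beginning \<epsilon> ks \<omega>' k s \<longleftrightarrow> in_beginning \<epsilon> ks \<omega> k (s + d)" if s: "s \<le> t" for k s
  proof -
    let ?a = "last_mark (ell \<epsilon> k) \<omega> (s + d)" and ?b = "last_mark (ell \<epsilon> (k - 1)) \<omega> (s + d)"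
    have b: "?b \<le> s + d" by (rule last_mark_le)
    have "{b \<in> {?a..<?b}. mark (ell \<epsilon> (k - 1)) \<omega> b} =
      (\<lambda>b. b + d) ` {b \<in> {?a - d..<?b - d}. mark (ell \<epsilon> (k - 1)) \<omega>' b}"
      (is "?L = _ ` ?R")
    proof (intro equalityI subsetI)
      fix b' assume "b' \<in> ?L"
      moreover have "mark (ell \<epsilon> (k - 1)) \<omega>' (b' - d) \<longleftrightarrow> mark (ell \<epsilon> (k - 1)) \<omega> b'" if "b' < ?b"
        using mark_shift[of "b' - d" \<omega>' \<omega> d] w b s that by simp
      ultimately show "b' \<in> (\<lambda>b. b + d) ` ?R" by (intro image_eqI[of _ _ "b' - d"]) auto
    next
      fix b' assume "b' \<in> (\<lambda>b. b + d) ` ?R"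
      then show "b' \<in> ?L"
        using mark_shift[of "b' - d" \<omega>' \<omega> d] w b s by auto
    qed
    then have "card ?L = card ?R" by (simp add: card_image)
    moreover have "s - last_mark l \<omega>' s = s + d - last_mark l \<omega> (s + d)" for l
      using lm[OF s] by simp
    ultimately show ?thesis unfolding in_beginning_def by (simp only: lm[OF s])
  qed
  have act: "act \<epsilon> ks \<omega>' k s \<longleftrightarrow> act \<epsilon> ks \<omega> k (s + d)" if s: "s \<le> t" for k s
  proof -
    have "s - last_mark l \<omega>' s = s + d - last_mark l \<omega> (s + d)" for l
      using lm[OF s] by simp
    then show ?thesis unfolding act_def using beg[OF s] by (simp only:)
  qed
  have lev: "has_level \<epsilon> ks \<omega>' t = has_level \<epsilon> ks \<omega> (t + d)"
    by (simp add: fun_eq_iff has_level_def act)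
  have par: "parents \<epsilon> ks \<omega> (t + d) k = (\<lambda>s. s + d) ` parents \<epsilon> ks \<omega>' t k" for k
  proof (intro equalityI subsetI)
    fix s assume "s \<in> parents \<epsilon> ks \<omega> (t + d) k"
    then show "s \<in> (\<lambda>s. s + d) ` parents \<epsilon> ks \<omega>' t k"
      using act[of "s - d" k] lm[of "s - d"] lm[of t]
      by (intro image_eqI[of _ _ "s - d"]) (auto simp: parents_def)
  next
    fix s assume "s \<in> (\<lambda>s. s + d) ` parents \<epsilon> ks \<omega>' t k"
    then show "s \<in> parents \<epsilon> ks \<omega> (t + d) k"
      using act[of "s - d" k] lm[of "s - d"] lm[of t] by (auto simp: parents_def)
  qed
  have "average (parents \<epsilon> ks \<omega> (t + d) k) x = average (parents \<epsilon> ks \<omega>' t k) x'" for k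
  proof -
    have "(\<Sum>s\<in>parents \<epsilon> ks \<omega> (t + d) k. spin (x s)) = (\<Sum>s\<in>parents \<epsilon> ks \<omega>' t k. spin (x' s))"
      unfolding par using x by (subst sum.reindex) (auto simp: parents_def intro!: sum.cong)
    moreover have "card (parents \<epsilon> ks \<omega> (t + d) k) = card (parents \<epsilon> ks \<omega>' t k)"
      unfolding par by (simp add: card_image)
    ultimately show ?thesis by (simp add: average_def)
  qed
  then show ?thesis
    unfolding drift_def Let_def lev by (simp add: lm)
qed

lemma drift_cong:
  assumes "\<And>s. s \<le> t \<Longrightarrow> \<omega>' s = \<omega> s" "\<And>s. s < t \<Longrightarrow> x' s = x s"
  shows "drift \<epsilon> ks \<phi> h \<omega>' t x' = drift \<epsilon> ks \<phi> h \<omega> t x"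
  using drift_shift[of t \<omega>' \<omega> 0 x' x] assms by simp

context
  fixes \<epsilon> :: real and \<omega> :: "int \<Rightarrow> bool"
  assumes eps: "0 < \<epsilon>" and lm: "left_marked \<omega>" and rm: "right_marked \<omega>"
begin

text \<open>A \<open>(k - 1)\<close>-block is named by its first point, which is a mark of level
  \<open>k - 1\<close>. Every mark of level \<open>k\<close> is also one of level
  \<open>k - 1\<close>, so the start of the \<open>k\<close>-block is constant on
  \<open>(k - 1)\<close>-blocks, and the subblocks to the left of the one containing
  \<open>t\<close> correspond to the marks that \<open>in_beginning\<close> counts.\<close>

lemma mem_beginning_iff:
  assumes "ks \<le> k"
  shows "t \<in> beginning \<epsilon> ks \<omega> k (block \<epsilon> \<omega> k t) \<longleftrightarrow> in_beginning \<epsilon> ks \<omega> k t"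
proof (cases "k = ks")
  case True
  then show ?thesis
    unfolding beginning_def in_beginning_def block_eq[OF eps lm rm] Min_block[OF eps lm rm]
    using last_mark_le[of "ell \<epsilon> ks" \<omega> t] by simp
next
  case False
  let ?a = "last_mark (ell \<epsilon> k) \<omega>" and ?b = "last_mark (ell \<epsilon> (k - 1)) \<omega>"
  let ?m = "mark (ell \<epsilon> (k - 1)) \<omega>"
  let ?sub = "subblocks \<epsilon> \<omega> k (block \<epsilon> \<omega> k t)"
  let ?cell = "\<lambda>c. {s. ?b s = c}"
  have ab: "?a s \<le> ?b s" for s
    using last_mark_antimono[OF lm ell_mono[OF eps, of "k - 1" k]] by simp
  have nest: "?a s = ?a s'" if "?b s = ?b s'" for s s'
    using that last_mark_const[OF lm ab[of s] last_mark_le]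
      last_mark_const[OF lm ab[of s'] last_mark_le] by simp
  have bc: "?b c = c" if "?m c" for c using that by (intro last_mark_eqI) auto
  have MinB: "Min (?cell c) = c" if "?m c" for c
    using Min_block[OF eps lm rm, of "k - 1" c] bc[OF that] by simp
  have sub_iff: "B \<in> ?sub \<longleftrightarrow> (\<exists>c. ?m c \<and> ?a c = ?a t \<and> B = ?cell c)" for B
  proof
    assume "B \<in> ?sub"
    then have B: "is_block \<epsilon> \<omega> (k - 1) B" "B \<subseteq> block \<epsilon> \<omega> k t" by (auto simp: subblocks_def)
    then obtain s where s: "s \<in> B" unfolding is_block_iff[OF eps] by force
    then have "B = ?cell (?b s)" using B is_block_containing_iff[OF eps lm rm] by blast
    moreover have "?b s \<in> B" using calculation bc left_marked_mark[OF lm] by simp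
    then have "?a (?b s) = ?a t" using B(2) unfolding block_eq[OF eps lm rm] by auto
    ultimately show "\<exists>c. ?m c \<and> ?a c = ?a t \<and> B = ?cell c"
      using left_marked_mark[OF lm] by blast
  next
    assume "\<exists>c. ?m c \<and> ?a c = ?a t \<and> B = ?cell c"
    then obtain c where c: "?m c" "?a c = ?a t" "B = ?cell c" by blast
    then have "is_block \<epsilon> \<omega> (k - 1) B"
      using is_block_containing_iff[OF eps lm rm, of "k - 1" B c] bc[OF c(1)] by simp
    moreover have "B \<subseteq> block \<epsilon> \<omega> k t"
    proof
      fix s assume "s \<in> B"
      then have "?b s = ?b c" using bc[OF c(1)] unfolding c(3) by simp
      then have "?a s = ?a t" using nest[of s c] c(2) by simp
      then show "s \<in> block \<epsilon> \<omega> k t" unfolding block_eq[OF eps lm rm] by simp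
    qed
    ultimately show "B \<in> ?sub" by (simp add: subblocks_def)
  qed
  have card_eq: "card {b' \<in> ?sub. Min b' < ?b t} = card {b \<in> {?a t..<?b t}. ?m b}"
  proof (rule bij_betw_same_card[symmetric, of ?cell], rule bij_betw_imageI)
    show "inj_on ?cell {b \<in> {?a t..<?b t}. ?m b}"
    proof (intro inj_onI)
      fix x y assume "x \<in> {b \<in> {?a t..<?b t}. ?m b}" and eq: "?cell x = ?cell y"
      then have "?b x = x" using bc by blast
      moreover from this have "x \<in> ?cell y" using eq by blast
      ultimately show "x = y" by simp
    qed
    have "?a c = ?a t \<longleftrightarrow> ?a t \<le> c" if "c < ?b t" for c
    proof
      show "?a t \<le> c" if "?a c = ?a t" using that last_mark_le by metis
      show "?a c = ?a t" if "?a t \<le> c"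
        using that \<open>c < ?b t\<close> last_mark_le[of "ell \<epsilon> (k - 1)" \<omega> t]
        by (intro last_mark_const[OF lm]) auto
    qed
    note a_iff = this
    show "?cell ` {b \<in> {?a t..<?b t}. ?m b} = {b' \<in> ?sub. Min b' < ?b t}"
    proof (intro equalityI subsetI)
      fix B assume "B \<in> ?cell ` {b \<in> {?a t..<?b t}. ?m b}"
      then obtain c where c: "B = ?cell c" "?m c" "?a t \<le> c" "c < ?b t" by auto
      have "Min B < ?b t" unfolding c(1) MinB[OF c(2)] by (rule c(4))
      moreover have "B \<in> ?sub" unfolding sub_iff using c a_iff by blast
      ultimately show "B \<in> {b' \<in> ?sub. Min b' < ?b t}" by blast
    next
      fix B assume B: "B \<in> {b' \<in> ?sub. Min b' < ?b t}"
      then obtain c where c: "B = ?cell c" "?m c" "?a c = ?a t" unfolding sub_iff by blast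
      have "c < ?b t" using B unfolding c(1) mem_Collect_eq MinB[OF c(2)] by blast
      then have "c \<in> {b \<in> {?a t..<?b t}. ?m b}" using c a_iff by simp
      then show "B \<in> ?cell ` {b \<in> {?a t..<?b t}. ?m b}" unfolding c(1) by (rule imageI)
    qed
  qed
  have own: "?cell (?b t) \<in> ?sub"
  proof -
    have m: "?m (?b t)" using lm by (rule left_marked_mark)
    have "?a (?b t) = ?a t" by (rule nest, rule bc[OF m])
    then show ?thesis unfolding sub_iff using m by blast
  qed
  have "t \<in> beginning \<epsilon> ks \<omega> k (block \<epsilon> \<omega> k t) \<longleftrightarrow>
    (\<exists>b\<in>?sub. int (card {b' \<in> ?sub. Min b' < Min b}) < \<lfloor>nu \<epsilon> k powr (1 - \<epsilon>)\<rfloor> \<and> t \<in> b)"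
    unfolding beginning_def if_not_P[OF False] by blast
  also have "\<dots> \<longleftrightarrow> int (card {b' \<in> ?sub. Min b' < ?b t}) < \<lfloor>nu \<epsilon> k powr (1 - \<epsilon>)\<rfloor>"
  proof -
    have b: "b = ?cell (?b t)" if "b \<in> ?sub" "t \<in> b" for b
      using that unfolding sub_iff by auto
    have Mint: "Min (?cell (?b t)) = ?b t" by (intro MinB left_marked_mark lm)
    show ?thesis (is "(\<exists>b\<in>_. ?P (Min b) \<and> t \<in> b) \<longleftrightarrow> ?P (?b t)")
    proof
      assume "\<exists>b\<in>?sub. ?P (Min b) \<and> t \<in> b"
      then obtain B where B: "B \<in> ?sub" "?P (Min B)" "t \<in> B" by blast
      have MinB: "Min B = ?b t"
        by (rule trans[OF arg_cong[where f = Min, OF b[OF B(1,3)]] Mint])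
      show "?P (?b t)" using B(2) unfolding MinB .
    next
      assume "?P (?b t)"
      then have "?P (Min (?cell (?b t)))" unfolding Mint .
      moreover have "t \<in> ?cell (?b t)" by simp
      ultimately show "\<exists>b\<in>?sub. ?P (Min b) \<and> t \<in> b"
        by (intro bexI[OF _ own] conjI)
    qed
  qed
  finally show ?thesis unfolding card_eq in_beginning_def if_not_P[OF False] .
qed

lemma mem_active_iff: "t \<in> active \<epsilon> ks \<omega> k \<longleftrightarrow> act \<epsilon> ks \<omega> k t"
proof -
  have "\<bar>t - last_mark l \<omega> t\<bar> = t - last_mark l \<omega> t" for l
    using last_mark_le[of l \<omega> t] by simp
  note abs_eq = this
  show ?thesis
    unfolding active_def act_def mem_Collect_eq
  proof (rule ball_cong[OF refl])
    fix j assume "j \<in> {ks..k}"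
    then have "ks \<le> j" by simp
    show "t \<in> beginning \<epsilon> ks \<omega> j (block \<epsilon> \<omega> j t) \<and>
        real_of_int \<bar>t - block_start \<epsilon> \<omega> j t\<bar> < beta \<epsilon> (j + 1) \<longleftrightarrow>
      in_beginning \<epsilon> ks \<omega> j t \<and> real_of_int (t - last_mark (ell \<epsilon> j) \<omega> t) < beta \<epsilon> (j + 1)"
      unfolding mem_beginning_iff[OF \<open>ks \<le> j\<close>] block_start_eq[OF eps lm rm] abs_eq ..
  qed
qed

text \<open>Within a block the beginning is closed to the left. An active \<open>s\<close> at or
  after \<open>t\<close> would put \<open>t\<close> in the beginning, and the cut-off condition
  would then make \<open>t\<close> active at its own level.\<close>

lemma act_level_past:
  assumes lev: "has_level \<epsilon> ks \<omega> t k" and cut: "real_of_int (t - last_mark (ell \<epsilon> k) \<omega> t) < beta \<epsilon> (k + 1)"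
    and s: "act \<epsilon> ks \<omega> k s" "last_mark (ell \<epsilon> k) \<omega> s = last_mark (ell \<epsilon> k) \<omega> t"
  shows "s < t"
proof (rule ccontr)
  assume "\<not> s < t"
  let ?X = "\<lambda>t. {b \<in> {last_mark (ell \<epsilon> k) \<omega> t..<last_mark (ell \<epsilon> (k - 1)) \<omega> t}. mark (ell \<epsilon> (k - 1)) \<omega> b}"
  have "finite (?X s)"
    by (rule finite_subset[of _ "{last_mark (ell \<epsilon> k) \<omega> s..<last_mark (ell \<epsilon> (k - 1)) \<omega> s}"]) auto
  moreover have "?X t \<subseteq> ?X s"
    using s(2) last_mark_mono[OF lm, of t s "ell \<epsilon> (k - 1)"] \<open>\<not> s < t\<close> by auto
  ultimately have "card (?X t) \<le> card (?X s)" by (rule card_mono)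
  moreover have "ks < k" using lev by (simp add: has_level_def)
  moreover have "in_beginning \<epsilon> ks \<omega> k s" using s(1) \<open>ks < k\<close> unfolding act_def by simp
  ultimately have "in_beginning \<epsilon> ks \<omega> k t" by (simp add: in_beginning_def)
  moreover have "act \<epsilon> ks \<omega> (k - 1) t" using lev by (simp add: has_level_def)
  ultimately have "act \<epsilon> ks \<omega> k t" using cut by - (rule act_SucI)
  then show False using lev by (simp add: has_level_def)
qed

lemma psi_eq_drift:
  assumes "\<phi> 0 = 0" and y: "\<And>s. s < t \<Longrightarrow> y (nat (t - 1 - s)) = spin (x s)"
  shows "psi \<epsilon> ks \<phi> h \<omega> t y = drift \<epsilon> ks \<phi> h \<omega> t x"
proof -
  let ?K = "{enat k | k. k \<ge> ks \<and> \<not> act \<epsilon> ks \<omega> k t}"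
  have level: "level \<epsilon> ks \<omega> t = Inf ?K" by (simp add: level_def mem_active_iff)
  show ?thesis
  proof (cases "\<exists>k. has_level \<epsilon> ks \<omega> t k")
    case True
    then obtain k where k: "has_level \<epsilon> ks \<omega> t k" by blast
    have "Inf ?K = enat k"
    proof (rule Inf_eqI)
      fix i assume "i \<in> ?K"
      then obtain j where "i = enat j" "\<not> act \<epsilon> ks \<omega> j t" by auto
      then show "enat k \<le> i"
        using k act_antimono[of j "k - 1"] by (cases "k \<le> j") (auto simp: has_level_def)
    next
      fix i assume "\<And>j. j \<in> ?K \<Longrightarrow> i \<le> j"
      then show "i \<le> enat k" using k by (auto simp: has_level_def)
    qed
    then have level_k: "level \<epsilon> ks \<omega> t = enat k" using level by simp
    have "ks < k" using k by (simp add: has_level_def)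
    let ?a = "last_mark (ell \<epsilon> k) \<omega> t"
    show ?thesis
    proof (cases "real_of_int (t - ?a) < beta \<epsilon> (k + 1)")
      case cut: True
      have S: "infl_set \<epsilon> ks \<omega> t = parents \<epsilon> ks \<omega> t k"
      proof (intro equalityI subsetI)
        fix s assume "s \<in> infl_set \<epsilon> ks \<omega> t"
        then have s: "act \<epsilon> ks \<omega> k s" "last_mark (ell \<epsilon> k) \<omega> s = ?a"
          using \<open>ks < k\<close> by (auto simp: infl_set_def level_k block_eq[OF eps lm rm] mem_active_iff)
        then show "s \<in> parents \<epsilon> ks \<omega> t k"
          using act_level_past[OF k cut s] last_mark_le[of "ell \<epsilon> k" \<omega> s] by (simp add: parents_def)
      next
        fix s assume "s \<in> parents \<epsilon> ks \<omega> t k"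
        then show "s \<in> infl_set \<epsilon> ks \<omega> t"
          using \<open>ks < k\<close>
          by (simp add: infl_set_def level_k block_eq[OF eps lm rm] mem_active_iff parents_def)
      qed
      have "(\<Sum>s\<in>parents \<epsilon> ks \<omega> t k. y (nat (t - 1 - s))) = (\<Sum>s\<in>parents \<epsilon> ks \<omega> t k. spin (x s))"
        by (intro sum.cong) (auto simp: parents_def y)
      \<comment> \<open>An empty parent set has average \<open>0 / 0 = 0\<close>, and \<phi>
        vanishes there, in agreement with the value 0 that \<open>psi\<close> takes by
        default.\<close>
      then show ?thesis
        unfolding psi_def S level_k Let_def drift_level[OF k] block_start_eq[OF eps lm rm]
        using cut last_mark_le[of "ell \<epsilon> k" \<omega> t] assms(1) by (simp add: average_def)
    next
      case False
      then show ?thesis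
        unfolding psi_def level_k Let_def drift_level[OF k] block_start_eq[OF eps lm rm]
        using last_mark_le[of "ell \<epsilon> k" \<omega> t] by simp
    qed
  next
    case False
    have "psi \<epsilon> ks \<phi> h \<omega> t y = 0"
    proof (cases "\<exists>k\<ge>ks. \<not> act \<epsilon> ks \<omega> k t")
      case True
      define k where "k = (LEAST k. ks \<le> k \<and> \<not> act \<epsilon> ks \<omega> k t)"
      have k: "ks \<le> k \<and> \<not> act \<epsilon> ks \<omega> k t"
        unfolding k_def using True by (rule LeastI_ex)
      have "\<not> ks < k"
      proof
        assume "ks < k"
        then have "\<not> (ks \<le> k - 1 \<and> \<not> act \<epsilon> ks \<omega> (k - 1) t)"
          using not_less_Least[of "k - 1" "\<lambda>k. ks \<le> k \<and> \<not> act \<epsilon> ks \<omega> k t"] unfolding k_def by linarith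
        then have "has_level \<epsilon> ks \<omega> t k" using k \<open>ks < k\<close> by (simp add: has_level_def)
        then show False using False by blast
      qed
      then have "enat ks \<in> ?K" using k by auto
      then have "level \<epsilon> ks \<omega> t \<le> enat ks" unfolding level by (rule Inf_lower)
      then obtain j where "level \<epsilon> ks \<omega> t = enat j" "j \<le> ks" by (cases "level \<epsilon> ks \<omega> t") auto
      then show ?thesis by (simp add: psi_def infl_set_def Let_def)
    next
      case False
      then have "?K = {}" by blast
      then have "level \<epsilon> ks \<omega> t = Inf {}" using level by (rule trans[OF _ arg_cong, rotated])
      then have "level \<epsilon> ks \<omega> t = \<infinity>" by (simp add: Inf_enat_def)
      then show ?thesis by (simp add: psi_def Let_def)
    qed
    then show ?thesis using False by (simp add: drift_no_level)
  qed
qed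

end

subsection \<open>Loss of memory in a fixed environment\<close>

text \<open>\<open>phi_linear\<close> carries the information on the slope at 0. Together with
  \<open>h_lim\<close> it drives the loss of memory, while \<open>phi_mono\<close> serves
  measurability and existence.\<close>

locale drift_model =
  fixes \<epsilon> :: real and ks :: nat and \<phi> :: "real \<Rightarrow> real" and h :: "nat \<Rightarrow> real" and C :: real
  assumes eps: "0 < \<epsilon>"
    and phi_range: "\<And>z. \<bar>z\<bar> \<le> 1 \<Longrightarrow> \<bar>\<phi> z\<bar> \<le> 1"
    and phi_linear: "\<And>z. \<bar>z\<bar> \<le> 1 \<Longrightarrow> \<bar>\<phi> z\<bar> \<le> C * \<bar>z\<bar>"
    and phi_mono: "\<And>y z. -1 \<le> y \<Longrightarrow> y \<le> z \<Longrightarrow> z \<le> 1 \<Longrightarrow> \<phi> y \<le> \<phi> z"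
    and h_nonneg: "\<And>k. 0 \<le> h k" and h_le_1: "\<And>k. h k \<le> 1"
    and h_lim: "h \<longlonglongrightarrow> 0"
begin

abbreviation start :: "(int \<Rightarrow> bool) \<Rightarrow> nat \<Rightarrow> int \<Rightarrow> int" where
  "start \<omega> k t \<equiv> last_mark (ell \<epsilon> k) \<omega> t"

abbreviation dr :: "(int \<Rightarrow> bool) \<Rightarrow> int \<Rightarrow> (int \<Rightarrow> bool) \<Rightarrow> real" where
  "dr \<equiv> drift \<epsilon> ks \<phi> h"

lemma phi_zero: "\<phi> 0 = 0"
  using phi_linear[of 0] by simp

lemma C_nonneg: "0 \<le> C"
  using phi_linear[of 1] by simp

lemma abs_h_phi_le:
  assumes "\<bar>m\<bar> \<le> 1"
  shows "\<bar>h k * \<phi> m\<bar> \<le> 1" "\<bar>h k * \<phi> m\<bar> \<le> h k * (C * \<bar>m\<bar>)"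
proof -
  have "\<bar>h k * \<phi> m\<bar> = h k * \<bar>\<phi> m\<bar>" using h_nonneg by (simp add: abs_mult)
  then show "\<bar>h k * \<phi> m\<bar> \<le> 1" "\<bar>h k * \<phi> m\<bar> \<le> h k * (C * \<bar>m\<bar>)"
    using phi_range[OF assms] phi_linear[OF assms] h_nonneg[of k] h_le_1[of k]
    by (auto intro: mult_le_one mult_left_mono)
qed

lemma abs_drift_le: "\<bar>dr \<omega> t x\<bar> \<le> 1"
  using abs_h_phi_le(1)[OF abs_average_le] by (simp add: drift_def Let_def)

section \<open>How the distant past enters a block\<close>

context
  fixes \<omega> :: "int \<Rightarrow> bool" and v :: int
  assumes lm: "left_marked \<omega>"
begin

abbreviation left_end :: "nat \<Rightarrow> int" where
  "left_end k \<equiv> start \<omega> k v"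

text \<open>All points of the \<open>k\<close>-block of \<open>v\<close> up to \<open>v\<close> share their blocks of level at least \<open>k\<close>. Let \<open>K > k\<close> be the
  first level at which the \<open>K - 1\<close>-block of \<open>v\<close> is not in the beginning of its \<open>K\<close>-block (\<open>is_late K\<close>).
  The spins of the \<open>k\<close>-active points then depend on the past only through the average over
  the set \<open>anc K\<close>, which lies to the left of the \<open>K - 1\<close>-block of \<open>v\<close>.\<close>

definition is_late :: "nat \<Rightarrow> bool" where
  "is_late K \<longleftrightarrow> \<not> int (card {b \<in> {left_end K..<left_end (K - 1)}. mark (ell \<epsilon> (K - 1)) \<omega> b}) < \<lfloor>nu \<epsilon> K powr (1 - \<epsilon>)\<rfloor>"

definition anc :: "nat \<Rightarrow> int set" where
  "anc K = {s \<in> {left_end K..<left_end (K - 1)}. act \<epsilon> ks \<omega> K s}"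

definition gate :: "nat \<Rightarrow> int \<Rightarrow> bool" where
  "gate K t \<longleftrightarrow> has_level \<epsilon> ks \<omega> t K \<and> real_of_int (t - start \<omega> K t) < beta \<epsilon> (K + 1)"

text \<open>Sites active at level \<open>k\<close> get a prescribed mean, while the others keep
  their drift, which reads no site before \<open>left_end k\<close> by
  \<open>drift_inactive_cong\<close>. Once \<open>g\<close> is fixed, such an evolution of the block
  does not remember what came before it.\<close>

definition gated :: "(int \<Rightarrow> real) \<Rightarrow> nat \<Rightarrow> int \<Rightarrow> (int \<Rightarrow> bool) \<Rightarrow> real" where
  "gated g k t y = (if act \<epsilon> ks \<omega> k t then g t else dr \<omega> t y)"

lemma left_end_antimono: "j \<le> k \<Longrightarrow> left_end k \<le> left_end j"
  by (intro last_mark_antimono lm ell_mono eps)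

lemma left_end_pred_le: "j < k \<Longrightarrow> left_end (k - 1) \<le> left_end j"
  by (intro left_end_antimono) linarith

lemma start_eq: "left_end k \<le> t \<Longrightarrow> t \<le> v \<Longrightarrow> k \<le> j \<Longrightarrow> start \<omega> j t = left_end j"
  using left_end_antimono[of k j] by (intro last_mark_const lm) auto

lemma in_beginning_iff_not_late:
  assumes "ks < K" "left_end (K - 1) \<le> t" "t \<le> v"
  shows "in_beginning \<epsilon> ks \<omega> K t \<longleftrightarrow> \<not> is_late K"
  using assms start_eq[of "K - 1" t K] start_eq[of "K - 1" t "K - 1"]
  by (simp add: in_beginning_def is_late_def)

lemma act_in_beginning: "act \<epsilon> ks \<omega> k t \<Longrightarrow> ks \<le> k \<Longrightarrow> in_beginning \<epsilon> ks \<omega> k t"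
  by (auto simp: act_def)

text \<open>A site that is inactive at level \<open>k\<close> has a level of at most
  \<open>k\<close>, if any, so its parents lie in its block of that level and hence in the
  \<open>k\<close>-block.\<close>

lemma drift_inactive_cong:
  assumes t: "left_end k \<le> t" "t \<le> v" and act: "\<not> act \<epsilon> ks \<omega> k t"
    and eq: "\<And>s. left_end k \<le> s \<Longrightarrow> s < t \<Longrightarrow> x s = y s"
  shows "dr \<omega> t x = dr \<omega> t y"
proof (cases "\<exists>K. has_level \<epsilon> ks \<omega> t K")
  case True
  then obtain K where K: "has_level \<epsilon> ks \<omega> t K" by blast
  have "K \<le> k"
  proof (rule ccontr)
    assume "\<not> K \<le> k"
    then have "k \<le> K - 1" by linarith
    then show False using K act act_antimono unfolding has_level_def by blast
  qed
  have "left_end k \<le> start \<omega> K t"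
    using start_eq[OF t order.refl] last_mark_antimono[OF lm ell_mono[OF eps \<open>K \<le> k\<close>], of t] by simp
  then have "average (parents \<epsilon> ks \<omega> t K) x = average (parents \<epsilon> ks \<omega> t K) y"
    using eq by (intro average_cong) (auto simp: parents_def)
  then show ?thesis unfolding drift_level[OF K] by simp
qed (simp add: drift_no_level)

text \<open>A \<open>(K - 1)\<close>-active site in the beginning of its \<open>K\<close>-block can
  fail to be \<open>K\<close>-active only through the distance cut-off, and the same cut-off sets
  its drift to 0.\<close>

lemma drift_zero_of_early:
  assumes K: "has_level \<epsilon> ks \<omega> t K" "left_end (K - 1) \<le> t" "t \<le> v" "\<not> is_late K"
  shows "dr \<omega> t x = 0" "\<not> gate K t"
proof -
  have "ks < K" using K(1) by (simp add: has_level_def)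
  then have "in_beginning \<epsilon> ks \<omega> K t" using in_beginning_iff_not_late K by blast
  then have "\<not> real_of_int (t - start \<omega> K t) < beta \<epsilon> (K + 1)"
    using K(1) act_SucI[where k = K and t = t] unfolding has_level_def by blast
  then show "dr \<omega> t x = 0" "\<not> gate K t"
    unfolding drift_level[OF K(1)] gate_def by simp_all
qed

lemma level_greater:
  assumes "act \<epsilon> ks \<omega> k t" "has_level \<epsilon> ks \<omega> t L"
  shows "k < L"
  using assms act_antimono[of L k] unfolding has_level_def by (meson linorder_not_le)

lemma drift_active_early:
  assumes t: "left_end k \<le> t" "t \<le> v" and act: "act \<epsilon> ks \<omega> k t" and early: "\<And>j. k < j \<Longrightarrow> \<not> is_late j"
  shows "dr \<omega> t x = 0"
proof (cases "\<exists>L. has_level \<epsilon> ks \<omega> t L")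
  case True
  then obtain L where L: "has_level \<epsilon> ks \<omega> t L" by blast
  then have "k < L" using level_greater act by blast
  then have "left_end (L - 1) \<le> t" using left_end_pred_le[of k L] t by linarith
  then show ?thesis using drift_zero_of_early(1) L early \<open>k < L\<close> t by blast
qed (simp add: drift_no_level)

text \<open>The level \<open>L\<close> of \<open>t\<close>, if there is one, exceeds
  \<open>k\<close>. For \<open>L < K\<close> the drift vanishes by
  \<open>drift_zero_of_early\<close>. \<open>L > K\<close> is impossible, since \<open>t\<close> is
  not in the beginning of its \<open>K\<close>-block. For \<open>L = K\<close>, no site from
  \<open>left_end (K - 1)\<close> on is active at level \<open>K\<close>, so the parents lie before
  it and do not depend on \<open>t\<close>.\<close>

lemma drift_active_late:
  assumes t: "left_end k \<le> t" "t \<le> v" and act: "act \<epsilon> ks \<omega> k t" and k: "ks \<le> k"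
    and K: "k < K" "is_late K" and early: "\<And>j. k < j \<Longrightarrow> j < K \<Longrightarrow> \<not> is_late j"
  shows "dr \<omega> t x = of_bool (gate K t) * (h K * \<phi> (average (anc K) x))"
proof (cases "\<exists>L. has_level \<epsilon> ks \<omega> t L")
  case True
  then obtain L where L: "has_level \<epsilon> ks \<omega> t L" by blast
  then have kL: "k < L" using level_greater act by blast
  have aL: "left_end (L - 1) \<le> t" using left_end_pred_le[of k L] t kL by simp
  have aK: "left_end (K - 1) \<le> t" using left_end_pred_le[of k K] t K by simp
  consider "L < K" | "L = K" | "K < L" by linarith
  then show ?thesis
  proof cases
    case 1
    have "\<not> gate K t" using has_level_unique[OF L, of K] 1 unfolding gate_def by blast
    then show ?thesis using drift_zero_of_early(1)[OF L aL t(2) early[OF kL 1]] by simp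
  next
    case 3
    then have "K \<le> L - 1" by linarith
    then have "act \<epsilon> ks \<omega> K t" using L act_antimono unfolding has_level_def by blast
    then have "in_beginning \<epsilon> ks \<omega> K t" using K k by (intro act_in_beginning) auto
    then show ?thesis using in_beginning_iff_not_late[of K t] aK t K k by simp
  next
    case 2
    have par: "parents \<epsilon> ks \<omega> t K = anc K"
    proof (intro equalityI subsetI)
      fix s assume "s \<in> anc K"
      then have s: "left_end K \<le> s" "s < left_end (K - 1)" "act \<epsilon> ks \<omega> K s" by (auto simp: anc_def)
      have "left_end (K - 1) \<le> v" by (rule last_mark_le)
      then have "start \<omega> K s = left_end K" using s by (intro start_eq) auto
      moreover have "start \<omega> K t = left_end K" using aK t s by (intro start_eq) auto
      ultimately show "s \<in> parents \<epsilon> ks \<omega> t K" using s aK by (simp add: parents_def)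
    next
      fix s assume "s \<in> parents \<epsilon> ks \<omega> t K"
      moreover have "start \<omega> K t = left_end K" using start_eq[of "K - 1" t K] aK t by simp
      ultimately have s: "left_end K \<le> s" "s < t" "act \<epsilon> ks \<omega> K s" by (auto simp: parents_def)
      have "s < left_end (K - 1)"
      proof (rule ccontr)
        assume "\<not> s < left_end (K - 1)"
        then show False
          using in_beginning_iff_not_late[of K s] act_in_beginning[OF s(3)] K k s t by simp
      qed
      then show "s \<in> anc K" using s by (simp add: anc_def)
    qed
    show ?thesis
      using L unfolding 2 drift_level[OF L[unfolded 2]] par gate_def by simp
  qed
next
  case False
  then show ?thesis by (simp add: drift_no_level gate_def)
qed

lemma evolve_gated:
  assumes k: "left_end k + int n \<le> v + 1"
    and g: "\<And>t y. left_end k \<le> t \<Longrightarrow> t \<le> v \<Longrightarrow> act \<epsilon> ks \<omega> k t \<Longrightarrow> (\<And>s. s < left_end k \<Longrightarrow> y s = x s) \<Longrightarrow> dr \<omega> t y = g t"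
    and G: "\<And>x y. (\<And>s. left_end k \<le> s \<Longrightarrow> s < left_end k + int n \<Longrightarrow> x s = y s) \<Longrightarrow> G x = G y"
  shows "evolve (dr \<omega>) (left_end k) n G x = evolve (gated g k) (left_end k) n G x'"
\<comment> \<open>The sites before the window keep the values of \<open>x\<close>, and the two
  configurations share the newly drawn spins. Nothing relates \<open>x'\<close> to
  \<open>x\<close>.\<close>
proof (rule evolve_eq[where R = "\<lambda>t y y'. (\<forall>s<left_end k. y s = x s) \<and> (\<forall>s\<in>{left_end k..<t}. y s = y' s)"])
  fix y y' t b
  assume R: "(\<forall>s<left_end k. y s = x s) \<and> (\<forall>s\<in>{left_end k..<t}. y s = y' s)" and t: "left_end k \<le> t" "t < left_end k + int n"
  show "(\<forall>s<left_end k. (y(t := b)) s = x s) \<and> (\<forall>s\<in>{left_end k..<t + 1}. (y(t := b)) s = (y'(t := b)) s)"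
    using R t by auto
  show "dr \<omega> t y = gated g k t y'"
  proof (cases "act \<epsilon> ks \<omega> k t")
    case True
    then show ?thesis using g[of t y] t k R by (simp add: gated_def)
  next
    case False
    have "dr \<omega> t y = dr \<omega> t y'"
      by (rule drift_inactive_cong[OF t(1) _ False]) (use R t k in auto)
    then show ?thesis using False by (simp add: gated_def)
  qed
next
  show "G y = G y'"
    if "(\<forall>s<left_end k. y s = x s) \<and> (\<forall>s\<in>{left_end k..<left_end k + int n}. y s = y' s)" for y y'
    using that by (intro G) simp
qed simp

definition evolve_from :: "nat \<Rightarrow> ((int \<Rightarrow> bool) \<Rightarrow> real) \<Rightarrow> (int \<Rightarrow> bool) \<Rightarrow> real" where
  "evolve_from k F = evolve (dr \<omega>) (left_end k) (nat (v + 1 - left_end k)) F"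

lemma evolve_from_split:
  assumes "j \<le> k"
  shows "evolve_from k F = evolve (dr \<omega>) (left_end k) (nat (left_end j - left_end k)) (evolve_from j F)"
proof -
  have 1: "left_end k \<le> left_end j" using assms by (rule left_end_antimono)
  have 2: "left_end j \<le> v" by (rule last_mark_le)
  have "nat (v + 1 - left_end k) = nat (left_end j - left_end k) + nat (v + 1 - left_end j)"
    using 1 2 by simp
  then show ?thesis
    unfolding evolve_from_def using 1 by (simp add: fun_eq_iff evolve_add)
qed

definition gate_drift :: "nat \<Rightarrow> real \<Rightarrow> int \<Rightarrow> real" where
  "gate_drift K m t = of_bool (gate K t) * (h K * \<phi> m)"

lemma abs_gate_drift_le:
  assumes "\<bar>m\<bar> \<le> 1"
  shows "\<bar>gate_drift K m t\<bar> \<le> \<bar>h K * \<phi> m\<bar>" "\<bar>gate_drift K m t\<bar> \<le> 1"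
  using abs_h_phi_le(1)[OF assms, of K] by (simp_all add: gate_drift_def of_bool_def)

lemma abs_gated_le: "(\<And>t. \<bar>g t\<bar> \<le> 1) \<Longrightarrow> \<bar>gated g k t y\<bar> \<le> 1"
  using abs_drift_le by (simp add: gated_def)

lemma anc_average_cong:
  assumes "k < K" "\<And>s. s < left_end k \<Longrightarrow> y s = x s"
  shows "average (anc K) y = average (anc K) x"
  using assms left_end_pred_le[OF assms(1)] by (intro average_cong) (auto simp: anc_def)

lemma evolve_no_late:
  assumes k: "left_end k + int n \<le> v + 1" "\<And>j. k < j \<Longrightarrow> \<not> is_late j"
    and G: "\<And>x y. (\<And>s. left_end k \<le> s \<Longrightarrow> s < left_end k + int n \<Longrightarrow> x s = y s) \<Longrightarrow> G x = G y"
  shows "evolve (dr \<omega>) (left_end k) n G x = evolve (gated (\<lambda>_. 0) k) (left_end k) n G (\<lambda>_. True)"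
  by (rule evolve_gated[OF k(1) _ G]) (use drift_active_early k(2) in blast)+

text \<open>The set \<open>anc K\<close> ends before \<open>left_end k\<close> and is not redrawn,
  so its average remains that of \<open>x\<close>. The starting configuration on the right is an
  arbitrary constant.\<close>

lemma evolve_next_late:
  assumes k: "left_end k + int n \<le> v + 1" "ks \<le> k"
    and K: "k < K" "is_late K" "\<And>j. k < j \<Longrightarrow> j < K \<Longrightarrow> \<not> is_late j"
    and G: "\<And>x y. (\<And>s. left_end k \<le> s \<Longrightarrow> s < left_end k + int n \<Longrightarrow> x s = y s) \<Longrightarrow> G x = G y"
  shows "evolve (dr \<omega>) (left_end k) n G x =
    evolve (gated (gate_drift K (average (anc K) x)) k) (left_end k) n G (\<lambda>_. True)"
proof (rule evolve_gated[OF k(1) _ G])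
  fix t y
  assume t: "left_end k \<le> t" "t \<le> v" "act \<epsilon> ks \<omega> k t" and y: "\<And>s. s < left_end k \<Longrightarrow> y s = x s"
  have "average (anc K) y = average (anc K) x" by (rule anc_average_cong[OF K(1) y])
  moreover have "dr \<omega> t y = of_bool (gate K t) * (h K * \<phi> (average (anc K) y))"
    by (rule drift_active_late[OF t k(2) K(1,2)]) (rule K(3))
  ultimately show "dr \<omega> t y = gate_drift K (average (anc K) x) t"
    unfolding gate_drift_def by (simp only:)
qed

section \<open>The chain of late levels and its contraction\<close>

lemma next_late:
  assumes "k < j" "is_late j"
  obtains K where "k < K" "is_late K" "\<And>j. k < j \<Longrightarrow> j < K \<Longrightarrow> \<not> is_late j"
proof -
  let ?P = "\<lambda>j. k < j \<and> is_late j"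
  have "?P (LEAST j. ?P j)" using assms by (intro LeastI[of ?P j]) simp
  moreover have "\<not> is_late i" if "k < i" "i < (LEAST j. ?P j)" for i
    using not_less_Least[OF that(2)] that(1) by blast
  ultimately show ?thesis using that by blast
qed

text \<open>The bound compares \<open>f\<close> only with its value at 0: as \<phi> may jump
  elsewhere, no modulus of continuity between other averages is available.\<close>

definition factors :: "((int \<Rightarrow> bool) \<Rightarrow> real) \<Rightarrow> nat \<Rightarrow> nat \<Rightarrow> real \<Rightarrow> bool" where
  "factors F k K L \<longleftrightarrow> ks \<le> k \<and> k < K \<and> is_late K \<and>
     (\<exists>f. (\<forall>x. evolve_from k F x = f (average (anc K) x)) \<and> (\<forall>m. \<bar>m\<bar> \<le> 1 \<longrightarrow> \<bar>f m - f 0\<bar> \<le> L * \<bar>m\<bar>))"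

text \<open>Crude coupling is enough here: changing the means of \<open>n\<close> spins by at most
  \<open>C * \<bar>m\<bar>\<close> each costs \<open>n * (C * \<bar>m\<bar> * B)\<close>. The size
  of the resulting constant is immaterial, because later steps contract it.\<close>

lemma factors_base:
  assumes k: "ks \<le> k"
    and F: "\<And>x y. (\<And>s. left_end k \<le> s \<Longrightarrow> s \<le> v \<Longrightarrow> x s = y s) \<Longrightarrow> F x = F y" "\<And>x. \<bar>F x\<bar> \<le> B"
  shows "(\<exists>c. \<forall>x. evolve_from k F x = c) \<or> (\<exists>K L. factors F k K L)"
proof -
  define n where "n = nat (v + 1 - left_end k)"
  have n: "left_end k + int n = v + 1" using last_mark_le[of "ell \<epsilon> k" \<omega> v] by (simp add: n_def)
  have G: "F x = F y" if "\<And>s. left_end k \<le> s \<Longrightarrow> s < left_end k + int n \<Longrightarrow> x s = y s" for x y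
    by (rule F(1)) (use that n in simp)
  show ?thesis
  proof (cases "\<exists>j>k. is_late j")
    case False
    then have early: "\<not> is_late j" if "k < j" for j using that by blast
    have "evolve_from k F x = evolve (gated (\<lambda>_. 0) k) (left_end k) n F (\<lambda>_. True)" for x
      unfolding evolve_from_def n_def[symmetric]
      by (rule evolve_no_late[OF eq_refl[OF n]]) (rule early, assumption, rule G, blast)
    then show ?thesis by blast
  next
    case True
    then obtain K where K: "k < K" "is_late K" "\<And>j. k < j \<Longrightarrow> j < K \<Longrightarrow> \<not> is_late j"
      using next_late by blast
    define f where "f m = evolve (gated (gate_drift K m) k) (left_end k) n F (\<lambda>_. True)" for m
    have 1: "evolve_from k F x = f (average (anc K) x)" for x
      unfolding evolve_from_def n_def[symmetric] f_def
      by (rule evolve_next_late[OF eq_refl[OF n] k K(1,2)]) (rule K(3), assumption+, rule G, blast)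
    have B: "0 \<le> B" using F(2)[of undefined] by linarith
    have 2: "\<bar>f m - f 0\<bar> \<le> (real n * C * B) * \<bar>m\<bar>" if m: "\<bar>m\<bar> \<le> 1" for m
    proof -
      have "\<bar>f m - f 0\<bar> \<le> real n * (C * \<bar>m\<bar> * B)"
        unfolding f_def
      proof (rule evolve_coupling[where R = "\<lambda>_. (=)"])
        fix y y' t assume "y = (y' :: int \<Rightarrow> bool)"
        have "\<bar>h K * \<phi> m\<bar> \<le> h K * (C * \<bar>m\<bar>)" by (rule abs_h_phi_le(2)[OF m])
        also have "\<dots> \<le> 1 * (C * \<bar>m\<bar>)" using h_le_1 C_nonneg by (intro mult_right_mono) auto
        finally have "\<bar>gate_drift K m t\<bar> \<le> C * \<bar>m\<bar>"
          using abs_gate_drift_le(1)[OF m, of K t] by linarith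
        then show "\<bar>gated (gate_drift K m) k t y - gated (gate_drift K 0) k t y'\<bar> \<le> C * \<bar>m\<bar>"
          using \<open>y = y'\<close> C_nonneg by (simp add: gated_def gate_drift_def phi_zero)
      qed (use F(2) m in \<open>auto intro!: abs_gated_le abs_gate_drift_le(2)\<close>)
      then show ?thesis by (simp add: mult_ac)
    qed
    have "factors F k K (real n * C * B)"
      unfolding factors_def using k K 1 2 by blast
    then show ?thesis by blast
  qed
qed

text \<open>From \<open>left_end K\<close> to \<open>left_end k\<close> the only output is the
  average over \<open>anc K\<close>, whose sites are \<open>K\<close>-active. Given the average
  \<open>m\<close> over the next ancestor set, their spins are independent with means 0 or
  \<open>h K' * \<phi> m\<close>, and \<open>\<bar>\<phi> m\<bar> \<le> C * \<bar>m\<bar>\<close>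
  makes the bound of \<open>spin_mean_of_average_bound\<close> linear in \<open>m\<close>
  again.\<close>

lemma factors_step:
  assumes fac: "factors F k K L"
  shows "(\<exists>c. \<forall>x. evolve_from K F x = c) \<or> (\<exists>K'. factors F K K' (3 * L * (h K' * C)))"
proof -
  from fac obtain f where k: "ks \<le> k" "k < K" "is_late K"
    and f: "\<And>x. evolve_from k F x = f (average (anc K) x)" "\<And>m. \<bar>m\<bar> \<le> 1 \<Longrightarrow> \<bar>f m - f 0\<bar> \<le> L * \<bar>m\<bar>"
    unfolding factors_def by blast
  define n where "n = nat (left_end k - left_end K)"
  define G where "G x = f (average (anc K) x)" for x
  have L: "0 \<le> L" using f(2)[of 1] by simp
  have aKk: "left_end K \<le> left_end k" using k by (intro left_end_antimono) simp
  have n: "left_end K + int n = left_end k" using aKk by (simp add: n_def)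
  have nv: "left_end K + int n \<le> v + 1" using last_mark_le[of "ell \<epsilon> k" \<omega> v] n by simp
  have anc: "anc K \<subseteq> {left_end K..<left_end K + int n}"
    using left_end_pred_le[OF k(2)] n by (auto simp: anc_def)
  have "evolve_from k F = G" unfolding G_def by (rule ext) (rule f(1))
  then have E: "evolve_from K F x = evolve (dr \<omega>) (left_end K) n G x" for x
    using evolve_from_split[of k K F] k(2) by (simp add: n_def)
  have G_anc: "G x = G y" if "\<And>s. s \<in> anc K \<Longrightarrow> x s = y s" for x y
    unfolding G_def by (intro arg_cong[where f = f] average_cong that)
  have G: "G x = G y" if "\<And>s. left_end K \<le> s \<Longrightarrow> s < left_end K + int n \<Longrightarrow> x s = y s" for x y
    by (rule G_anc) (use that anc in auto)
  show ?thesis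
  proof (cases "\<exists>j>K. is_late j")
    case False
    then have early: "\<not> is_late j" if "K < j" for j using that by blast
    have "evolve_from K F x = evolve (gated (\<lambda>_. 0) K) (left_end K) n G (\<lambda>_. True)" for x
      unfolding E by (rule evolve_no_late[OF nv]) (rule early, assumption, rule G, blast)
    then show ?thesis by blast
  next
    case True
    then obtain K' where K': "K < K'" "is_late K'" "\<And>j. K < j \<Longrightarrow> j < K' \<Longrightarrow> \<not> is_late j"
      using next_late by blast
    have ksK: "ks \<le> K" using k by simp
    define f' where "f' m = evolve (gated (gate_drift K' m) K) (left_end K) n G (\<lambda>_. True)" for m
    have 1: "evolve_from K F x = f' (average (anc K') x)" for x
      unfolding E f'_def
      by (rule evolve_next_late[OF nv ksK K'(1,2)]) (rule K'(3), assumption+, rule G, blast)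
    let ?m = "\<lambda>Y. (\<Sum>t\<in>anc K. spin (t \<in> Y)) / card (anc K)"
    have fin: "finite (anc K)" using anc by (rule finite_subset) simp
    have f'_eq: "f' m = spin_mean (anc K) (gate_drift K' m) (\<lambda>Y. f (?m Y))" for m
    proof -
      have inter: "anc K \<inter> {left_end K..<left_end K + int n} = anc K" using anc by blast
      have "f' m = spin_mean (anc K \<inter> {left_end K..<left_end K + int n}) (gate_drift K' m)
          (\<lambda>Y. G (\<lambda>s. if s \<in> anc K \<inter> {left_end K..<left_end K + int n} then s \<in> Y else True))"
        unfolding f'_def
      proof (rule evolve_product_law)
        show "gated (gate_drift K' m) K t y = gate_drift K' m t" if "t \<in> anc K" for t y
          using that by (simp add: gated_def anc_def)
        show "G x = G y" if "\<And>t. t \<in> anc K \<Longrightarrow> x t = y t" for x y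
          by (rule G_anc) (rule that)
      qed
      also have "\<dots> = spin_mean (anc K) (gate_drift K' m) (\<lambda>Y. f (?m Y))"
        unfolding inter by (intro spin_mean_cong) (simp_all add: G_def average_def)
      finally show ?thesis .
    qed
    have 2: "\<bar>f' m - f' 0\<bar> \<le> 3 * L * (h K' * C) * \<bar>m\<bar>" if m: "\<bar>m\<bar> \<le> 1" for m
    proof -
      have zero: "gate_drift K' 0 = (\<lambda>_. 0)" by (simp add: gate_drift_def phi_zero fun_eq_iff)
      have "\<bar>f' m - f' 0\<bar> \<le> 3 * L * \<bar>h K' * \<phi> m\<bar>"
        unfolding f'_eq zero
      proof (rule spin_mean_of_average_bound[OF fin])
        show "\<bar>gate_drift K' m t\<bar> \<le> \<bar>h K' * \<phi> m\<bar>" for t by (rule abs_gate_drift_le(1)[OF m])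
        show "\<bar>h K' * \<phi> m\<bar> \<le> 1" by (rule abs_h_phi_le(1)[OF m])
      qed (use f(2) in auto)
      also have "\<dots> \<le> 3 * L * (h K' * (C * \<bar>m\<bar>))"
        using L abs_h_phi_le(2)[OF m] by (intro mult_left_mono) auto
      finally show ?thesis by (simp add: mult_ac)
    qed
    have "factors F K K' (3 * L * (h K' * C))"
      unfolding factors_def using ksK K' 1 2 by blast
    then show ?thesis by blast
  qed
qed

text \<open>If the chain of late levels ends, some \<open>evolve_from k F\<close> is constant.
  Otherwise every step from a sufficiently high level at least halves the constant, and an average
  is at most 1 in absolute value.\<close>

lemma evolve_from_almost_constant:
  assumes F: "\<And>x y. (\<And>s. u \<le> s \<Longrightarrow> s \<le> v \<Longrightarrow> x s = y s) \<Longrightarrow> F x = F y" "\<And>x. \<bar>F x\<bar> \<le> B" and e: "0 < e"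
  shows "\<exists>k c. \<forall>x. \<bar>evolve_from k F x - c\<bar> \<le> e"
proof (rule ccontr)
  assume neg: "\<not> ?thesis"
  have no_const: "\<not> (\<exists>c. \<forall>x. evolve_from k F x = c)" for k
  proof
    assume "\<exists>c. \<forall>x. evolve_from k F x = c"
    then obtain c where "\<And>x. evolve_from k F x = c" by blast
    then have "\<forall>x. \<bar>evolve_from k F x - c\<bar> \<le> e" using e by simp
    then show False using neg by blast
  qed
  obtain l0 where l0: "\<And>l. l0 \<le> l \<Longrightarrow> last_mark l \<omega> v \<le> u"
    using last_mark_unbounded[OF lm] by blast
  have "\<forall>\<^sub>F k in sequentially. l0 \<le> ell \<epsilon> k"
    using ell_at_top[OF eps] by (simp add: filterlim_at_top)
  moreover have "\<forall>\<^sub>F k in sequentially. 3 * (h k * C) < 1 / 2"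
  proof (rule order_tendstoD(2))
    show "(\<lambda>k. 3 * (h k * C)) \<longlonglongrightarrow> 3 * (0 * C)" by (intro tendsto_intros h_lim)
  qed simp
  moreover have "\<forall>\<^sub>F k in sequentially. ks \<le> k" by (rule eventually_ge_at_top)
  ultimately have "\<forall>\<^sub>F k in sequentially. l0 \<le> ell \<epsilon> k \<and> 3 * (h k * C) < 1 / 2 \<and> ks \<le> k"
    by eventually_elim simp
  \<comment> \<open>From \<open>k0\<close> on, the block of \<open>v\<close> reaches back to
    \<open>u\<close>, the contraction factor is below 1/2, and the levels are at least
    \<open>ks\<close>.\<close>
  then obtain k0 where k0: "\<And>k. k0 \<le> k \<Longrightarrow> l0 \<le> ell \<epsilon> k \<and> 3 * (h k * C) < 1 / 2 \<and> ks \<le> k"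
    unfolding eventually_sequentially by blast
  have "left_end k0 \<le> u" using k0[of k0] l0 by blast
  then have "(\<exists>c. \<forall>x. evolve_from k0 F x = c) \<or> (\<exists>K L. factors F k0 K L)"
  proof (intro factors_base)
    show "ks \<le> k0" using k0[of k0] by simp
    show "F x = F y" if "\<And>s. left_end k0 \<le> s \<Longrightarrow> s \<le> v \<Longrightarrow> x s = y s" for x y
      by (rule F(1)) (use that \<open>left_end k0 \<le> u\<close> in simp)
  qed (rule F(2))
  then obtain K L where fac0: "factors F k0 K L" using no_const by blast
  have nonneg: "0 \<le> L'" if "factors F k K L'" for k K L'
  proof -
    from that obtain f :: "real \<Rightarrow> real" where "\<And>m. \<bar>m\<bar> \<le> 1 \<Longrightarrow> \<bar>f m - f 0\<bar> \<le> L' * \<bar>m\<bar>"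
      unfolding factors_def by blast
    from this[of 1] show ?thesis by simp
  qed
  have iter: "\<exists>k K. k0 \<le> k \<and> factors F k K (L * (1 / 2) ^ j)" for j
  proof (induction j)
    case 0
    show ?case using fac0 by auto
  next
    case (Suc j)
    then obtain k K where fac: "k0 \<le> k" "factors F k K (L * (1 / 2) ^ j)" by blast
    then have kK: "k < K" by (simp add: factors_def)
    obtain K' where K': "factors F K K' (3 * (L * (1 / 2) ^ j) * (h K' * C))"
      using factors_step[OF fac(2)] no_const by blast
    then have "k0 \<le> K'" using fac(1) kK by (simp add: factors_def)
    have "3 * (L * (1 / 2) ^ j) * (h K' * C) = L * (1 / 2) ^ j * (3 * (h K' * C))" by simp
    also have "\<dots> \<le> L * (1 / 2) ^ j * (1 / 2)"
      using nonneg[OF fac(2)] k0[OF \<open>k0 \<le> K'\<close>] by (intro mult_left_mono) auto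
    finally have le: "3 * (L * (1 / 2) ^ j) * (h K' * C) \<le> L * (1 / 2) ^ Suc j" by simp
    have "factors F K K' (L * (1 / 2) ^ Suc j)"
    proof -
      have "y \<le> L * (1 / 2) ^ Suc j * \<bar>m\<bar>" if "y \<le> 3 * (L * (1 / 2) ^ j) * (h K' * C) * \<bar>m\<bar>" for y m
        using that mult_right_mono[OF le abs_ge_zero[of m]] by linarith
      then show ?thesis using K' unfolding factors_def by blast
    qed
    moreover have "k0 \<le> K" using fac(1) kK by simp
    ultimately show ?case by blast
  qed
  have "(\<lambda>j. L * (1 / 2) ^ j) \<longlonglongrightarrow> L * 0"
    by (intro tendsto_intros LIMSEQ_power_zero) simp
  then have "\<forall>\<^sub>F j in sequentially. L * (1 / 2) ^ j < e"
    using e by (intro order_tendstoD) auto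
  then obtain j where j: "L * (1 / 2) ^ j < e"
    unfolding eventually_sequentially by blast
  obtain k K f where f: "\<And>x. evolve_from k F x = f (average (anc K) x)"
    "\<And>m. \<bar>m\<bar> \<le> 1 \<Longrightarrow> \<bar>f m - f 0\<bar> \<le> L * (1 / 2) ^ j * \<bar>m\<bar>" and fac: "factors F k K (L * (1 / 2) ^ j)"
    using iter[of j] unfolding factors_def by blast
  have "\<bar>evolve_from k F x - f 0\<bar> \<le> e" for x
  proof -
    have "\<bar>evolve_from k F x - f 0\<bar> \<le> L * (1 / 2) ^ j * \<bar>average (anc K) x\<bar>"
      unfolding f(1) by (rule f(2)[OF abs_average_le])
    also have "\<dots> \<le> L * (1 / 2) ^ j * 1"
      using nonneg[OF fac] abs_average_le by (intro mult_left_mono)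
    finally show ?thesis using j by simp
  qed
  then show False using neg by blast
qed

text \<open>Starting further back only averages \<open>evolve_from k F\<close> over its argument, so
  all initial configurations give values within \<open>e / 3\<close> of the same
  \<open>c\<close>.\<close>

theorem evolve_forgets:
  assumes F: "\<And>x y. (\<And>s. u \<le> s \<Longrightarrow> s \<le> v \<Longrightarrow> x s = y s) \<Longrightarrow> F x = F y" "\<And>x. \<bar>F x\<bar> \<le> B"
  shows "(\<lambda>n. evolve (dr \<omega>) (v - int n) (Suc n) F x - evolve (dr \<omega>) (v - int n) (Suc n) F x') \<longlonglongrightarrow> 0"
proof (rule LIMSEQ_I)
  fix e :: real assume "0 < e"
  then have "\<exists>k c. \<forall>x. \<bar>evolve_from k F x - c\<bar> \<le> e / 3"
    by (intro evolve_from_almost_constant[OF _ F(2)]) (rule F(1), blast, simp)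
  then obtain k c where kc: "\<And>x. \<bar>evolve_from k F x - c\<bar> \<le> e / 3" by blast
  have "\<bar>evolve (dr \<omega>) (v - int n) (Suc n) F x - evolve (dr \<omega>) (v - int n) (Suc n) F x'\<bar> < e"
    if n: "nat (v - left_end k) \<le> n" for n
  proof -
    let ?m = "nat (left_end k - (v - int n))" and ?l = "nat (v + 1 - left_end k)"
    have av: "left_end k \<le> v" by (rule last_mark_le)
    have "Suc n = ?m + ?l" "v - int n + int ?m = left_end k" using n av by auto
    then have eq: "evolve (dr \<omega>) (v - int n) (Suc n) F y = evolve (dr \<omega>) (v - int n) ?m (evolve_from k F) y" for y
      using evolve_add[of "dr \<omega>" "v - int n" ?m ?l F y] unfolding evolve_from_def by simp
    have "c - e / 3 \<le> evolve_from k F y" "evolve_from k F y \<le> c + e / 3" for y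
      using kc[of y] by linarith+
    then have "c - e / 3 \<le> evolve (dr \<omega>) (v - int n) ?m (evolve_from k F) y \<and>
      evolve (dr \<omega>) (v - int n) ?m (evolve_from k F) y \<le> c + e / 3" for y
      by (rule evolve_bounds[OF abs_drift_le])
    from this[of x] this[of x'] show ?thesis unfolding eq using \<open>0 < e\<close> by linarith
  qed
  then show "\<exists>no. \<forall>n\<ge>no. norm (evolve (dr \<omega>) (v - int n) (Suc n) F x - evolve (dr \<omega>) (v - int n) (Suc n) F x' - 0) < e"
    by auto
qed

end

end

subsection \<open>Fair environments\<close>

context
  fixes M :: "'w measure" and W :: "'w \<Rightarrow> int \<Rightarrow> bool"
  assumes W [measurable]: "\<And>s. (\<lambda>w. W w s) \<in> measurable M (count_space UNIV)"
begin

lemma measurable_mark [measurable]: "Measurable.pred M (\<lambda>w. mark l (W w) b)"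
  unfolding mark_def by measurable

lemma measurable_last_mark [measurable]:
  "(\<lambda>w. last_mark l (W w) t) \<in> measurable M (count_space UNIV)"
  unfolding last_mark_def by measurable

lemma measurable_count_marks [measurable]:
  "(\<lambda>w. real (card {b \<in> {c..<d}. mark l (W w) b})) \<in> borel_measurable M"
proof -
  have "real (card {b \<in> {c..<d}. mark l (W w) b}) = (\<Sum>b\<in>{c..<d}. if mark l (W w) b then 1 else 0)" for w
    by (simp add: sum.If_cases Int_def)
  then show ?thesis by simp
qed

lemma measurable_in_beginning [measurable]: "Measurable.pred M (\<lambda>w. in_beginning \<epsilon> ks (W w) k t)"
proof (cases "k = ks")
  case True
  then show ?thesis unfolding in_beginning_def by simp
next
  case False
  let ?c = "\<lambda>w c d. real (card {b \<in> {c..<d}. mark (ell \<epsilon> (k - 1)) (W w) b})"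
  let ?a = "\<lambda>w. last_mark (ell \<epsilon> k) (W w) t" and ?b = "\<lambda>w. last_mark (ell \<epsilon> (k - 1)) (W w) t"
  \<comment> \<open>Both ends of the counted interval are random integers. They are fixed one after
    the other, each time by countability.\<close>
  have 1: "(\<lambda>w. ?c w c (?b w)) \<in> borel_measurable M" for c
    by (rule measurable_compose_countable[where f = "\<lambda>d w. ?c w c d"]) measurable
  have [measurable]: "(\<lambda>w. ?c w (?a w) (?b w)) \<in> borel_measurable M"
    by (rule measurable_compose_countable[where f = "\<lambda>c w. ?c w c (?b w)", OF 1]) measurable
  have "in_beginning \<epsilon> ks (W w) k t \<longleftrightarrow> ?c w (?a w) (?b w) < real_of_int \<lfloor>nu \<epsilon> k powr (1 - \<epsilon>)\<rfloor>" for w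
    unfolding in_beginning_def if_not_P[OF False] by linarith
  then show ?thesis by (simp only:) measurable
qed

lemma measurable_act [measurable]: "Measurable.pred M (\<lambda>w. act \<epsilon> ks (W w) k t)"
  unfolding act_def by measurable

lemma measurable_has_level [measurable]: "Measurable.pred M (\<lambda>w. has_level \<epsilon> ks (W w) t k)"
  unfolding has_level_def by measurable

lemma measurable_average_parents:
  assumes X [measurable]: "\<And>s. (\<lambda>w. X w s) \<in> measurable M (count_space UNIV)"
  shows "(\<lambda>w. average (parents \<epsilon> ks (W w) t k) (X w)) \<in> borel_measurable M"
proof -
  let ?P = "\<lambda>w s c. act \<epsilon> ks (W w) k s \<and> last_mark (ell \<epsilon> k) (W w) s = c"
  have "average (parents \<epsilon> ks (W w) t k) (X w) =
      (\<lambda>c w. (\<Sum>s\<in>{c..<t}. if ?P w s c then spin (X w s) else 0) / (\<Sum>s\<in>{c..<t}. if ?P w s c then 1 else 0))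
        (last_mark (ell \<epsilon> k) (W w) t) w" for w
    unfolding average_def parents_def by (simp add: sum.If_cases Int_def conj_ac)
  moreover have "(\<lambda>w. (\<lambda>c w. (\<Sum>s\<in>{c..<t}. if ?P w s c then spin (X w s) else 0) / (\<Sum>s\<in>{c..<t}. if ?P w s c then 1 else 0))
        (last_mark (ell \<epsilon> k) (W w) t) w) \<in> borel_measurable M"
    by (rule measurable_compose_countable) measurable
  ultimately show ?thesis by simp
qed

end

context drift_model
begin

lemma measurable_drift:
  assumes W [measurable]: "\<And>s. (\<lambda>w. W w s) \<in> measurable M (count_space UNIV)"
    and X [measurable]: "\<And>s. (\<lambda>w. X w s) \<in> measurable M (count_space UNIV)"
  shows "(\<lambda>w. dr (W w) t (X w)) \<in> borel_measurable M"
proof -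
  \<comment> \<open>\<phi> is controlled between -1 and 1 only. Clamping the argument gives a
    monotone, hence Borel, function on the whole line that agrees with \<phi> on averages.\<close>
  let ?\<phi> = "\<lambda>z. \<phi> (max (-1) (min 1 z))"
  have "mono ?\<phi>" by (intro monoI phi_mono) auto
  then have [measurable]: "?\<phi> \<in> borel_measurable borel" by (rule borel_measurable_mono)
  let ?g = "\<lambda>k w. if has_level \<epsilon> ks (W w) t k \<and> real_of_int (t - last_mark (ell \<epsilon> k) (W w) t) < beta \<epsilon> (k + 1)
     then h k * ?\<phi> (average (parents \<epsilon> ks (W w) t k) (X w)) else 0"
  have [measurable]: "(\<lambda>w. average (parents \<epsilon> ks (W w) t k) (X w)) \<in> borel_measurable M" for k
    by (rule measurable_average_parents[OF W X])
  have [measurable]: "Measurable.pred M (\<lambda>w. has_level \<epsilon> ks (W w) t k)"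
    "(\<lambda>w. last_mark l (W w) t) \<in> measurable M (count_space UNIV)" for k l
    by (rule measurable_has_level[OF W], rule measurable_last_mark[OF W])
  have "?\<phi> (average S x) = \<phi> (average S x)" for S x
    using abs_average_le[of S x] by (simp add: abs_le_iff min_absorb2 max_absorb2 minus_le_iff)
  then have "dr (W w) t (X w) = ?g (LEAST k. has_level \<epsilon> ks (W w) t k) w" for w
    by (simp add: drift_def Let_def)
  moreover have "(\<lambda>w. ?g (LEAST k. has_level \<epsilon> ks (W w) t k) w) \<in> borel_measurable M"
    by (rule measurable_compose_countable[where f = ?g]) measurable
  ultimately show ?thesis by simp
qed

end

section \<open>Local functions and laws with fair bits\<close>

type_synonym config = "int \<Rightarrow> bool \<times> bool"

definition spins :: "config \<Rightarrow> int \<Rightarrow> bool" where "spins z s = fst (z s)"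
definition bits :: "config \<Rightarrow> int \<Rightarrow> bool" where "bits z s = snd (z s)"

text \<open>Locality is measurability on the whole path space together with invariance under changes
  off \<open>S\<close>, which avoids a separate sigma-algebra for each \<open>S\<close>.\<close>

definition tame :: "int set \<Rightarrow> (config \<Rightarrow> real) \<Rightarrow> bool" where
  "tame S Y \<longleftrightarrow> Y \<in> borel_measurable path_space \<and> (\<exists>B. \<forall>z. \<bar>Y z\<bar> \<le> B) \<and>
     (\<forall>z z'. (\<forall>s\<in>S. z s = z' s) \<longrightarrow> Y z = Y z')"

text \<open>The bit at \<open>t\<close> is fair and independent of everything before
  \<open>t\<close>, spins included. Testing against bounded functions of the past states this
  without conditional expectations.\<close>

definition fair :: "config measure \<Rightarrow> bool" where
  "fair P \<longleftrightarrow> prob_space P \<and> sets P = sets path_space \<and>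
     (\<forall>t A Y. tame {..<t} Y \<longrightarrow> (\<integral>z. indicator A (snd (z t)) * Y z \<partial>P) = card A / 2 * (\<integral>z. Y z \<partial>P))"

lemma tameD: "tame S Y \<Longrightarrow> (\<And>s. s \<in> S \<Longrightarrow> z s = z' s) \<Longrightarrow> Y z = Y z'"
  by (simp add: tame_def)

lemma tame_mono: "tame S Y \<Longrightarrow> S \<subseteq> S' \<Longrightarrow> tame S' Y"
  unfolding tame_def by (meson subsetD)

lemma tame_measurable: "tame S Y \<Longrightarrow> Y \<in> borel_measurable path_space"
  by (simp add: tame_def)

lemma tame_const: "tame S (\<lambda>_. c)"
  by (auto simp: tame_def)

lemma tame_mult:
  assumes "tame S X" "tame S Y"
  shows "tame S (\<lambda>z. X z * Y z)"
proof -
  from assms obtain B B' where B: "\<And>z. \<bar>X z\<bar> \<le> B" "\<And>z. \<bar>Y z\<bar> \<le> B'"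
    unfolding tame_def by blast
  have "\<bar>X z * Y z\<bar> \<le> B * B'" for z
    unfolding abs_mult using B[of z] by (intro mult_mono) auto
  moreover have "(\<lambda>z. X z * Y z) \<in> borel_measurable path_space"
    using assms by (intro borel_measurable_times) (auto simp: tame_def)
  moreover have "X z * Y z = X z' * Y z'" if "\<forall>s\<in>S. z s = z' s" for z z'
    using assms that unfolding tame_def by metis
  ultimately show ?thesis unfolding tame_def by blast
qed

lemma tame_add:
  assumes "tame S X" "tame S Y"
  shows "tame S (\<lambda>z. X z + Y z)"
proof -
  from assms obtain B B' where B: "\<And>z. \<bar>X z\<bar> \<le> B" "\<And>z. \<bar>Y z\<bar> \<le> B'"
    unfolding tame_def by blast
  have "\<bar>X z + Y z\<bar> \<le> B + B'" for z
    using B[of z] by linarith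
  moreover have "(\<lambda>z. X z + Y z) \<in> borel_measurable path_space"
    using assms by (intro borel_measurable_add) (auto simp: tame_def)
  moreover have "X z + Y z = X z' + Y z'" if "\<forall>s\<in>S. z s = z' s" for z z'
    using assms that unfolding tame_def by metis
  ultimately show ?thesis unfolding tame_def by blast
qed

lemma tame_bit: "s \<in> S \<Longrightarrow> tame S (\<lambda>z. indicator A (snd (z s)))"
  by (auto simp: tame_def intro!: exI[of _ 1] split: split_indicator)

lemma measurable_path:
  fixes f :: "'w \<Rightarrow> int \<Rightarrow> 'a"
  assumes "\<And>s. (\<lambda>w. f w s) \<in> measurable M (count_space UNIV)"
  shows "f \<in> measurable M path_space"
  by (rule measurable_PiM_single'[where f = "\<lambda>i w. f w i"]) (use assms in auto)

lemma measurable_upd: "(\<lambda>z. z(t := a)) \<in> measurable path_space path_space"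
  by (rule measurable_path) (simp add: fun_upd_def)

lemma tame_upd:
  assumes "tame S H" "S \<subseteq> insert t S'"
  shows "tame S' (\<lambda>z. H (z(t := a)))"
proof -
  have "(\<lambda>z. H (z(t := a))) \<in> borel_measurable path_space"
    by (rule measurable_compose[OF measurable_upd tame_measurable[OF assms(1)]])
  moreover have "H (z(t := a)) = H (z'(t := a))" if "\<forall>s\<in>S'. z s = z' s" for z z'
  proof -
    have "\<forall>s\<in>S. (z(t := a)) s = (z'(t := a)) s" using that assms(2) by auto
    then show ?thesis using assms(1) unfolding tame_def by blast
  qed
  ultimately show ?thesis using assms(1) unfolding tame_def by blast
qed

lemma tame_integrable:
  assumes "prob_space P" "sets P = sets path_space" "tame S Y"
  shows "integrable P Y"
proof -
  interpret prob_space P by fact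
  obtain B where "\<And>z. \<bar>Y z\<bar> \<le> B" using assms(3) unfolding tame_def by blast
  then show ?thesis
    using assms(2,3) by (intro integrable_const_bound[of _ B]) (auto simp: tame_def cong: measurable_cong_sets)
qed

text \<open>Peeling off the largest index leaves the earlier bits and \<open>Y\<close>, which
  together form a function of the past of that index.\<close>

lemma fair_product:
  assumes P: "fair P" and Y: "tame {..u} Y" and J: "finite J" "J \<subseteq> {u<..}"
  shows "(\<integral>z. (\<Prod>s\<in>J. indicator (A s) (snd (z s))) * Y z \<partial>P)
    = (\<Prod>s\<in>J. card (A s) / 2) * (\<integral>z. Y z \<partial>P)"
  using J
proof (induction J rule: finite_linorder_max_induct)
  case (insert b J)
  have "tame {..<b} (\<lambda>z. (\<Prod>s\<in>J'. indicator (A s) (snd (z s))))" if "J' \<subseteq> J" for J'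
    using finite_subset[OF that insert.hyps(1)] that
  proof (induction J' rule: finite_induct)
    case (insert s J')
    then have "s < b" using \<open>\<forall>a\<in>J. a < b\<close> by simp
    then show ?case using insert by (simp add: tame_mult tame_bit)
  qed (simp add: tame_const)
  then have "tame {..<b} (\<lambda>z. (\<Prod>s\<in>J. indicator (A s) (snd (z s))) * Y z)"
    using insert.prems by (intro tame_mult tame_mono[OF Y]) auto
  moreover have "b \<notin> J" using insert.hyps by blast
  ultimately show ?case
    using P insert by (simp add: fair_def mult.assoc)
qed simp

lemma measurable_bits: "(\<lambda>z. bits z s) \<in> measurable path_space (count_space UNIV)"
  unfolding bits_def
  by (rule measurable_compose[where f = "\<lambda>z. z s", OF measurable_component_singleton]) auto

lemma measurable_spins: "(\<lambda>z. spins z s) \<in> measurable path_space (count_space UNIV)"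
  unfolding spins_def
  by (rule measurable_compose[where f = "\<lambda>z. z s", OF measurable_component_singleton]) auto

text \<open>Cut the past of \<open>t\<close> into windows of \<open>l + 1\<close> sites. Each is a
  marker with probability \<open>(1 / 2) ^ Suc l\<close>, independently of what lies further left,
  so the absence of marks has probability at most every power of some \<open>q < 1\<close>. The
  length \<open>Suc l\<close> keeps the final 0 inside the window.\<close>

lemma fair_AE_left_marked:
  assumes "fair P"
  shows "AE z in P. left_marked (bits z)"
proof -
  interpret prob_space P using assms by (simp add: fair_def)
  have sets_P [measurable_cong]: "sets P = sets path_space" using assms by (simp add: fair_def)
  have space_P: "space P = UNIV" using sets_eq_imp_space_eq[OF sets_P] by (simp add: space_PiM)
  have [measurable]: "Measurable.pred path_space (\<lambda>z. mark l (bits z) b)" for l b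
    by (rule measurable_mark[OF measurable_bits])
  have "AE z in P. \<exists>b\<le>t. mark (Suc l) (bits z) b" for l t
  proof -
    define N where "N t = {z \<in> space P. \<forall>b\<in>{..t}. \<not> mark (Suc l) (bits z) b}" for t
    define q :: real where "q = 1 - (1 / 2) ^ Suc l"
    have "(1 / 2) ^ Suc l \<le> (1::real)" by (rule power_le_one) auto
    then have q: "0 \<le> q" "q < 1" by (auto simp: q_def)
    have N_sets [measurable]: "N t \<in> sets P" for t unfolding N_def by measurable
    have dec: "prob (N t) \<le> q * prob (N (t - int (Suc l)))" for t
    proof -
      let ?u = "t - int (Suc l)"
      let ?J = "{?u<..t}"
      \<comment> \<open>This prescribes the bit 1 at every site of the window but the last and 0 at
        \<open>t\<close>; the product \<open>?I\<close> then indicates that the window is a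
        marker.\<close>
      let ?A = "\<lambda>s. {s \<noteq> t}"
      let ?I = "\<lambda>z. \<Prod>s\<in>?J. indicator (?A s) (snd (z s)) :: real"
      have card: "card ?J = Suc l" by simp
      have Y: "tame {..?u} (indicator (N ?u))"
      proof -
        have "z \<in> N ?u \<longleftrightarrow> z' \<in> N ?u" if "\<forall>s\<in>{..?u}. z s = z' s" for z z'
        proof -
          have "mark (Suc l) (bits z) b \<longleftrightarrow> mark (Suc l) (bits z') b" if "b \<le> ?u" for b
            using mark_shift[of b "bits z" "bits z'" 0] \<open>\<forall>s\<in>{..?u}. z s = z' s\<close> that
            by (simp add: bits_def)
          then show ?thesis unfolding N_def space_P by simp
        qed
        moreover have "indicator (N ?u) \<in> borel_measurable path_space"
          using N_sets[of ?u] sets_P by simp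
        ultimately show ?thesis
          unfolding tame_def by (auto intro!: exI[of _ 1] split: split_indicator)
      qed
      have int_N: "integrable P (indicator (N t) :: _ \<Rightarrow> real)" for t
        by (rule integrable_const_bound[of _ 1]) auto
      have int_prod: "(\<integral>z. ?I z * indicator (N ?u) z \<partial>P) = (1 / 2) ^ Suc l * prob (N ?u)"
      proof -
        have "(\<Prod>s\<in>?J. card (?A s) / 2) = (\<Prod>s\<in>?J. 1 / 2 :: real)" by (intro prod.cong) auto
        also have "\<dots> = (1 / 2) ^ Suc l" by (simp only: prod_constant card)
        finally have prod_half: "(\<Prod>s\<in>?J. card (?A s) / 2) = (1 / 2 :: real) ^ Suc l" .
        have "finite ?J" "?J \<subseteq> {?u<..}" by auto
        from fair_product[OF assms Y this, of ?A] show ?thesis unfolding prod_half by simp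
      qed
      have tame_I: "tame {..t} ?I"
      proof -
        have "tame {..t} (\<lambda>z. (\<Prod>s\<in>J'. indicator (?A s) (snd (z s))))" if "finite J'" "J' \<subseteq> ?J" for J'
          using that
          by (induction J' rule: finite_induct) (auto intro!: tame_mult tame_bit tame_const)
        then show ?thesis by simp
      qed
      have int1: "integrable P (\<lambda>z. ?I z * indicator (N ?u) z)"
        by (rule tame_integrable[OF prob_space_axioms sets_P tame_mult[OF tame_I tame_mono[OF Y]]]) auto
      have le: "indicator (N t) z \<le> indicator (N ?u) z - ?I z * indicator (N ?u) z" for z
      proof (cases "z \<in> N t")
        case True
        then have "z \<in> N ?u" by (auto simp: N_def)
        then have N1: "indicator (N ?u) z = (1 :: real)" by (rule indicator_simps)
        have N2: "indicator (N t) z \<le> (1 :: real)" by (rule indicator_le_1)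
        have "?I z = 0"
        proof (rule ccontr)
          assume "?I z \<noteq> 0"
          then have "snd (z s) = (s \<noteq> t)" if "s \<in> ?J" for s
            using that by (auto simp: indicator_def split: if_splits)
          then have "mark (Suc l) (bits z) t" by (auto simp: mark_def bits_def)
          then show False using True by (auto simp: N_def)
        qed
        then have "?I z * indicator (N ?u) z = 0" by (simp only: mult_zero_left)
        then show ?thesis using N1 N2 by linarith
      next
        case False
        have "?I z \<le> 1" by (intro prod_le_1) (auto split: split_indicator)
        then have "?I z * indicator (N ?u) z \<le> 1 * indicator (N ?u) z" by (intro mult_right_mono) auto
        moreover have "indicator (N t) z = (0 :: real)" using False by (rule indicator_simps)
        ultimately show ?thesis by linarith
      qed
      have "prob (N t) = (\<integral>z. indicator (N t) z \<partial>P)" by simp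
      also have "\<dots> \<le> (\<integral>z. indicator (N ?u) z - ?I z * indicator (N ?u) z \<partial>P)"
        by (rule integral_mono[OF int_N Bochner_Integration.integrable_diff[OF int_N int1] le])
      also have "\<dots> = (\<integral>z. indicator (N ?u) z \<partial>P) - (\<integral>z. ?I z * indicator (N ?u) z \<partial>P)"
        by (rule Bochner_Integration.integral_diff[OF int_N int1])
      also have "\<dots> = q * prob (N ?u)"
        unfolding int_prod q_def by (simp add: algebra_simps)
      finally show ?thesis .
    qed
    have "prob (N t) \<le> q ^ i" for i
    proof (induction i arbitrary: t)
      case (Suc i)
      have "prob (N t) \<le> q * prob (N (t - int (Suc l)))" by (rule dec)
      also have "\<dots> \<le> q * q ^ i" using Suc q by (intro mult_left_mono)
      finally show ?case by simp
    qed simp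
    moreover have "(\<lambda>i. q ^ i) \<longlonglongrightarrow> 0" using q by (intro LIMSEQ_power_zero) simp
    ultimately have "prob (N t) \<le> 0" by (intro LIMSEQ_le_const) auto
    then have "prob (N t) = 0" using measure_nonneg[of P "N t"] by linarith
    then have "AE z in P. z \<notin> N t" by (simp add: prob_eq_0)
    then show ?thesis by eventually_elim (auto simp: N_def space_P)
  qed
  then have "AE z in P. \<forall>l t. \<exists>b\<le>t. mark (Suc l) (bits z) b"
    by (simp add: AE_all_countable)
  then show ?thesis
  proof eventually_elim
    case (elim z)
    have "\<exists>b\<le>t. mark l (bits z) b" for l t
      using elim mark_antimono[of l "Suc l"] by (meson le_SucI order.refl)
    then show ?case by (simp add: left_marked_def)
  qed
qed

subsection \<open>Uniqueness\<close>

lemma sum_bool_pair: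
  "(\<Sum>a\<in>UNIV. f a) = f (True, True) + f (True, False) + f (False, True) + f (False, False)"
  for f :: "bool \<times> bool \<Rightarrow> 'b::comm_monoid_add"
  by (simp add: UNIV_bool UNIV_Times_UNIV[symmetric] sum.cartesian_product[symmetric] ac_simps del: UNIV_Times_UNIV)

lemma card_bool_set: "real (card A) = indicator A True + indicator A False"
proof -
  have "card A = (\<Sum>w\<in>UNIV. of_bool (w \<in> A))" by (simp add: Int_def)
  then show ?thesis by (simp add: UNIV_bool indicator_def)
qed

section \<open>One-site conditional laws and the redrawing of a single spin\<close>

context drift_model
begin

definition config_drift :: "int \<Rightarrow> config \<Rightarrow> real" where
  "config_drift t z = dr (bits z) t (spins z)"

text \<open>The whole symbol at \<open>t\<close> is redrawn, and the drift is evaluated with the new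
  bit in place because it reads the bit at \<open>t\<close>. In contrast, \<open>refresh\<close>
  keeps the bit and redraws the spin alone.\<close>

definition site_kernel :: "int \<Rightarrow> (config \<Rightarrow> real) \<Rightarrow> config \<Rightarrow> real" where
  "site_kernel t H z = (\<Sum>a\<in>UNIV. (1 + spin (fst a) * config_drift t (z(t := a))) / 4 * H (z(t := a)))"

definition refresh :: "int \<Rightarrow> (config \<Rightarrow> real) \<Rightarrow> config \<Rightarrow> real" where
  "refresh t G z = (1 + config_drift t z) / 2 * G (z(t := (True, snd (z t)))) +
     (1 - config_drift t z) / 2 * G (z(t := (False, snd (z t))))"

text \<open>\<open>follows P\<close> is equivalent to \<open>specified_by g P (\<lambda>t z. z t)\<close>, but avoids conditional expectations.\<close>

definition follows :: "config measure \<Rightarrow> bool" where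
  "follows P \<longleftrightarrow> prob_space P \<and> sets P = sets path_space \<and>
     (\<forall>t H. tame {..t} H \<longrightarrow> (\<integral>z. H z \<partial>P) = (\<integral>z. site_kernel t H z \<partial>P))"

lemma config_drift_cong:
  assumes "\<And>s. s < t \<Longrightarrow> z s = z' s" "snd (z t) = snd (z' t)"
  shows "config_drift t z = config_drift t z'"
  unfolding config_drift_def
proof (rule drift_cong)
  show "bits z s = bits z' s" if "s \<le> t" for s
    using assms that unfolding bits_def by (cases "s = t") auto
  show "spins z s = spins z' s" if "s < t" for s
    using assms(1)[OF that] unfolding spins_def by simp
qed

lemma abs_config_drift_le: "\<bar>config_drift t z\<bar> \<le> 1"
  unfolding config_drift_def by (rule abs_drift_le)

lemma tame_config_drift: "tame {..t} (config_drift t)"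
proof -
  have "config_drift t \<in> borel_measurable path_space"
    unfolding config_drift_def[abs_def] by (rule measurable_drift[OF measurable_bits measurable_spins])
  moreover have "config_drift t z = config_drift t z'" if "\<forall>s\<in>{..t}. z s = z' s" for z z'
    using that by (intro config_drift_cong) auto
  ultimately show ?thesis unfolding tame_def using abs_config_drift_le by blast
qed

lemma site_kernel_bits:
  "site_kernel t H z = (\<Sum>w\<in>UNIV. ((1 + config_drift t (z(t := (True, w)))) / 2 * H (z(t := (True, w))) +
     (1 - config_drift t (z(t := (True, w)))) / 2 * H (z(t := (False, w)))) / 2)"
proof -
  have "config_drift t (z(t := (False, w))) = config_drift t (z(t := (True, w)))" for w
    by (rule config_drift_cong) auto
  then show ?thesis
    unfolding site_kernel_def sum_bool_pair by (simp add: UNIV_bool field_simps)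
qed

lemma site_kernel_spin_free:
  assumes "\<And>w. H (z(t := (False, w))) = H (z(t := (True, w)))"
  shows "site_kernel t H z = (H (z(t := (True, True))) + H (z(t := (True, False)))) / 2"
  unfolding site_kernel_bits assms by (simp add: UNIV_bool field_simps)

text \<open>For each bit the weights of the two spins add up to 1/2, whatever the drift.\<close>

lemma follows_fair:
  assumes "follows P"
  shows "fair P"
  unfolding fair_def
proof (intro conjI allI impI)
  fix t A Y assume Y: "tame {..<t} Y"
  let ?H = "\<lambda>z. indicator A (snd (z t)) * Y z :: real"
  have Y_upd: "Y (z(t := a)) = Y z" for z a
    using Y unfolding tame_def by simp
  have "tame {..t} ?H" by (intro tame_mult tame_bit tame_mono[OF Y]) auto
  then have eq: "(\<integral>z. ?H z \<partial>P) = (\<integral>z. site_kernel t ?H z \<partial>P)" using assms by (simp add: follows_def)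
  have "site_kernel t ?H z = card A / 2 * Y z" for z
  proof -
    have "site_kernel t ?H z = (indicator A True + indicator A False) / 2 * Y z"
      by (subst site_kernel_spin_free) (simp_all add: Y_upd field_simps)
    then show ?thesis by (simp add: card_bool_set)
  qed
  then have "site_kernel t ?H = (\<lambda>z. card A / 2 * Y z)" by (rule ext)
  then show "(\<integral>z. ?H z \<partial>P) = card A / 2 * (\<integral>z. Y z \<partial>P)" unfolding eq by simp
qed (use assms in \<open>auto simp: follows_def\<close>)

text \<open>Functions of the bits up to \<open>v\<close> and the spins up to \<open>t\<close>. They
  arise when the spins after \<open>t\<close> are integrated out with the bits held fixed.\<close>

definition spin_local :: "int \<Rightarrow> int \<Rightarrow> (config \<Rightarrow> real) \<Rightarrow> bool" where
  "spin_local t v G \<longleftrightarrow> tame {..v} G \<and>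
     (\<forall>z z'. (\<forall>s. snd (z s) = snd (z' s)) \<longrightarrow> (\<forall>s\<le>t. z s = z' s) \<longrightarrow> G z = G z')"

lemma spin_local_tame: "spin_local t v G \<Longrightarrow> tame {..v} G"
  by (simp add: spin_local_def)

lemma spin_localD:
  "spin_local t v G \<Longrightarrow> (\<And>s. snd (z s) = snd (z' s)) \<Longrightarrow> (\<And>s. s \<le> t \<Longrightarrow> z s = z' s) \<Longrightarrow> G z = G z'"
  by (simp add: spin_local_def)

lemma measurable_refresh:
  assumes "G \<in> borel_measurable path_space"
  shows "refresh t G \<in> borel_measurable path_space"
proof -
  have [measurable]: "config_drift t \<in> borel_measurable path_space"
    using tame_config_drift tame_measurable by blast
  have "(\<lambda>z :: config. z(t := (b, snd (z t)))) \<in> measurable path_space path_space" for b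
  proof (rule measurable_path)
    fix s
    show "(\<lambda>z :: config. (z(t := (b, snd (z t)))) s) \<in> measurable path_space (count_space UNIV)"
    proof (cases "s = t")
      case True
      have "(\<lambda>z. (b, bits z t)) \<in> measurable path_space (count_space UNIV)"
        by (rule measurable_compose[OF measurable_bits]) simp
      then show ?thesis unfolding True fun_upd_same bits_def .
    qed simp
  qed
  then have [measurable]: "(\<lambda>z. G (z(t := (b, snd (z t))))) \<in> borel_measurable path_space" for b
    using assms by (rule measurable_compose)
  show ?thesis unfolding refresh_def[abs_def] by measurable
qed

lemma abs_refresh_le:
  assumes "\<And>z. \<bar>G z\<bar> \<le> B"
  shows "\<bar>refresh t G z\<bar> \<le> B"
proof -
  let ?F = "\<lambda>x. G (\<lambda>s. (x s, snd (z s)))"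
  have "(\<lambda>s. (((\<lambda>s. fst (z s))(t := b)) s, snd (z s))) = z(t := (b, snd (z t)))" for b
    by (simp add: fun_eq_iff)
  then have "refresh t G z = evolve (\<lambda>t' x. config_drift t (\<lambda>s. (x s, snd (z s)))) t 1 ?F (\<lambda>s. fst (z s))"
    by (simp add: refresh_def resample_def)
  also have "\<bar>\<dots>\<bar> \<le> B" using abs_config_drift_le assms by (rule evolve_abs_le)
  finally show ?thesis .
qed

lemma spin_local_refresh:
  assumes G: "spin_local t v G" and t: "t \<le> v"
  shows "spin_local (t - 1) v (refresh t G)"
  unfolding spin_local_def
proof (intro conjI allI impI)
  have "refresh t G z = refresh t G z'" if "\<forall>s\<in>{..v}. z s = z' s" for z z'
  proof -
    have "G (z(t := (b, snd (z t)))) = G (z'(t := (b, snd (z' t))))" for b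
      using G that t unfolding spin_local_def tame_def by simp
    moreover have "config_drift t z = config_drift t z'"
      using that t by (intro config_drift_cong) auto
    ultimately show ?thesis by (simp add: refresh_def)
  qed
  moreover obtain B where "\<And>z. \<bar>G z\<bar> \<le> B" using G unfolding spin_local_def tame_def by blast
  then have "\<bar>refresh t G z\<bar> \<le> B" for z by (rule abs_refresh_le)
  moreover have "refresh t G \<in> borel_measurable path_space"
    by (rule measurable_refresh[OF tame_measurable[OF spin_local_tame[OF G]]])
  ultimately show "tame {..v} (refresh t G)" unfolding tame_def by blast
next
  fix z z' :: config assume eq: "\<forall>s. snd (z s) = snd (z' s)" "\<forall>s\<le>t - 1. z s = z' s"
  have "G (z(t := (b, snd (z t)))) = G (z'(t := (b, snd (z' t))))" for b
    using G by (rule spin_localD) (use eq in auto)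
  moreover have "config_drift t z = config_drift t z'"
    using eq by (intro config_drift_cong) auto
  ultimately show "refresh t G z = refresh t G z'" by (simp add: refresh_def)
qed

text \<open>After \<open>refresh\<close> the spin at \<open>t\<close> is no longer visible, so only
  the fair average over the bit remains, and this reproduces the weights of
  \<open>site_kernel\<close>.\<close>

lemma site_kernel_refresh: "site_kernel t (refresh t G) z = site_kernel t G z"
proof -
  have "config_drift t (z(t := (False, w))) = config_drift t (z(t := (True, w)))" for w
    by (rule config_drift_cong) auto
  then have "refresh t G (z(t := (False, w))) = refresh t G (z(t := (True, w)))" for w
    by (simp add: refresh_def)
  then have "site_kernel t (refresh t G) z =
      (refresh t G (z(t := (True, True))) + refresh t G (z(t := (True, False)))) / 2"
    by (rule site_kernel_spin_free)
  then show ?thesis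
    unfolding site_kernel_bits by (simp add: refresh_def UNIV_bool add_divide_distrib)
qed

text \<open>Conditioning on bits after time \<open>t\<close> does not change the law of the spin at time \<open>t\<close>: averaging
  over a later bit commutes with \<open>refresh t\<close>.\<close>

lemma integral_refresh:
  assumes P: "follows P" and t: "t \<le> v" and G: "spin_local t v G"
  shows "(\<integral>z. G z \<partial>P) = (\<integral>z. refresh t G z \<partial>P)"
  using t G
proof (induction v arbitrary: G rule: int_ge_induct)
  case base
  have "(\<integral>z. G z \<partial>P) = (\<integral>z. site_kernel t G z \<partial>P)"
    "(\<integral>z. refresh t G z \<partial>P) = (\<integral>z. site_kernel t (refresh t G) z \<partial>P)"
    using P spin_local_tame[OF base] spin_local_tame[OF spin_local_refresh[OF base]]
    unfolding follows_def by auto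
  then show ?case by (simp only: site_kernel_refresh)
next
  case (step v)
  let ?b = "v + 1"
  \<comment> \<open>The induction removes the last bit. Functions that are \<open>spin_local\<close>
    up to \<open>t\<close> ignore the spin at \<open>v + 1\<close>, so the kernel there is a fair
    average over the bit.\<close>
  define avg :: "(config \<Rightarrow> real) \<Rightarrow> config \<Rightarrow> real" where
    "avg G z = G (z(?b := (True, True))) * (1 / 2) + G (z(?b := (True, False))) * (1 / 2)" for G z
  have avg: "(\<integral>z. G z \<partial>P) = (\<integral>z. avg G z \<partial>P)" if "spin_local t' ?b G" "t' \<le> t" for G t'
  proof -
    have "G (z(?b := (False, w))) = G (z(?b := (True, w)))" for z w
      using that(1) by (rule spin_localD) (use that(2) step.hyps in auto)
    then have "site_kernel ?b G z = avg G z" for z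
      by (subst site_kernel_spin_free) (simp_all add: avg_def add_divide_distrib)
    then have "site_kernel ?b G = avg G" by (rule ext)
    moreover have "(\<integral>z. G z \<partial>P) = (\<integral>z. site_kernel ?b G z \<partial>P)"
      using P spin_local_tame[OF that(1)] unfolding follows_def by blast
    ultimately show ?thesis by (simp only:)
  qed
  have "spin_local t v (avg G)"
    unfolding spin_local_def
  proof (intro conjI allI impI)
    show "tame {..v} (avg G)"
      unfolding avg_def[abs_def]
      by (intro tame_add tame_mult tame_const tame_upd[OF spin_local_tame[OF step.prems]]) auto
    fix z z' :: config assume eq: "\<forall>s. snd (z s) = snd (z' s)" "\<forall>s\<le>t. z s = z' s"
    have "G (z(?b := a)) = G (z'(?b := a))" for a
      using step.prems by (rule spin_localD) (use eq in auto)
    then show "avg G z = avg G z'" by (simp add: avg_def)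
  qed
  then have "(\<integral>z. avg G z \<partial>P) = (\<integral>z. refresh t (avg G) z \<partial>P)" by (rule step.IH)
  moreover have "refresh t (avg G) z = avg (refresh t G) z" for z
  proof -
    have "config_drift t (z(?b := a)) = config_drift t z" for a
      using step.hyps by (intro config_drift_cong) auto
    moreover have "t \<noteq> ?b" using step.hyps by simp
    ultimately show ?thesis
      unfolding refresh_def avg_def by (simp add: fun_upd_twist field_simps)
  qed
  moreover have "t \<le> ?b" using step.hyps by simp
  ultimately show ?case
    using avg[OF step.prems] avg[OF spin_local_refresh[OF step.prems]] by simp
qed

end

text \<open>\<open>fair_product\<close> determines the probabilities of all cylinders, and these fix
  the law of the bits.\<close>

lemma distr_bits_eq:
  assumes "fair P" "fair P'"
  shows "distr P path_space bits = distr P' path_space bits"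
proof (rule measure_eqI_PiM_infinite)
  fix A :: "int \<Rightarrow> bool set" and J :: "int set"
  assume J: "finite J"
  let ?E = "prod_emb UNIV (\<lambda>_. count_space UNIV) J (Pi\<^sub>E J A)"
  have E: "?E = {\<omega>. \<forall>s\<in>J. \<omega> s \<in> A s}"
    by (auto simp: prod_emb_def PiE_iff space_PiM)
  have E_sets: "?E \<in> sets path_space"
    using J by (intro sets_PiM_I) auto
  have "emeasure (distr P path_space bits) ?E = ennreal (\<Prod>s\<in>J. card (A s) / 2)" if P: "fair P" for P
  proof -
    interpret prob_space P using P by (simp add: fair_def)
    have sets_P [measurable_cong]: "sets P = sets path_space" using P by (simp add: fair_def)
    have space_P: "space P = UNIV" using sets_eq_imp_space_eq[OF sets_P] by (simp add: space_PiM)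
    have bits [measurable]: "bits \<in> measurable P path_space"
      using measurable_path[OF measurable_bits] sets_P by (simp cong: measurable_cong_sets)
    obtain u where u: "J \<subseteq> {u<..}"
    proof
      show "J \<subseteq> {Min (insert 0 J) - 1<..}"
      proof
        fix s assume "s \<in> J"
        then have "Min (insert 0 J) \<le> s" using J by (intro Min_le) auto
        then show "s \<in> {Min (insert 0 J) - 1<..}" by simp
      qed
    qed
    have ind: "indicator (bits -` ?E \<inter> space P) z = ((\<Prod>s\<in>J. indicator (A s) (snd (z s))) * 1 :: real)" for z
    proof (cases "\<forall>s\<in>J. snd (z s) \<in> A s")
      case True
      then have "(\<Prod>s\<in>J. indicator (A s) (snd (z s))) = (1 :: real)" by (intro prod.neutral) simp
      moreover have "z \<in> bits -` ?E \<inter> space P" using True by (simp add: E space_P bits_def)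
      ultimately show ?thesis by simp
    next
      case False
      then obtain s where "s \<in> J" "snd (z s) \<notin> A s" by blast
      then have "(\<Prod>s\<in>J. indicator (A s) (snd (z s))) = (0 :: real)"
        using J by (intro prod_zero bexI[of _ s]) auto
      moreover have "z \<notin> bits -` ?E \<inter> space P" using False by (simp add: E space_P bits_def)
      ultimately show ?thesis by simp
    qed
    have "emeasure (distr P path_space bits) ?E = emeasure P (bits -` ?E \<inter> space P)"
      using E_sets by (intro emeasure_distr bits)
    also have "\<dots> = ennreal (\<integral>z. indicator (bits -` ?E \<inter> space P) z \<partial>P)"
      using E_sets bits by (simp add: emeasure_eq_measure measurable_sets)
    also have "(\<integral>z. indicator (bits -` ?E \<inter> space P) z \<partial>P) =
        (\<integral>z. (\<Prod>s\<in>J. indicator (A s) (snd (z s))) * 1 \<partial>P :: real)"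
      by (rule Bochner_Integration.integral_cong[OF refl ind])
    also have "(\<integral>z. (\<Prod>s\<in>J. indicator (A s) (snd (z s))) * 1 \<partial>P) = (\<Prod>s\<in>J. card (A s) / 2)"
      using fair_product[OF P tame_const J u, of A 1] by (simp add: prob_space)
    finally show ?thesis .
  qed
  then show "emeasure (distr P path_space bits) ?E = emeasure (distr P' path_space bits) ?E"
    using assms by simp
next
  interpret prob_space P using assms(1) by (simp add: fair_def)
  show "finite_measure (distr P path_space bits)"
  proof (intro prob_space.finite_measure prob_space_distr)
    show "bits \<in> measurable P path_space"
      using measurable_path[OF measurable_bits] assms(1) by (simp add: fair_def cong: measurable_cong_sets)
  qed
qed simp_all

section \<open>Comparison of two laws through their common environment\<close>

context drift_model
begin

text \<open>The bits are frozen and the last \<open>n\<close> spins up to \<open>v\<close> are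
  redrawn in sequence, which links \<open>evolve\<close> with repeated
  \<open>refresh\<close>.\<close>

definition unroll :: "int \<Rightarrow> (config \<Rightarrow> real) \<Rightarrow> nat \<Rightarrow> config \<Rightarrow> real" where
  "unroll v F n z = evolve (dr (bits z)) (v + 1 - int n) n (\<lambda>x. F (\<lambda>s. (x s, bits z s))) (spins z)"

lemma unroll_0: "unroll v F 0 = F"
  by (simp add: unroll_def fun_eq_iff spins_def bits_def)

text \<open>The added site is the earliest one. It is redrawn first in time, hence its operator is
  applied last to \<open>F\<close>.\<close>

lemma unroll_Suc: "unroll v F (Suc n) = refresh (v - int n) (unroll v F n)"
proof
  fix z
  have "bits (z(t := (b, snd (z t)))) = bits z" "spins (z(t := (b, snd (z t)))) = (spins z)(t := b)" for t b
    by (auto simp: bits_def spins_def fun_eq_iff)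
  then show "unroll v F (Suc n) z = refresh (v - int n) (unroll v F n) z"
    by (simp add: unroll_def refresh_def resample_def config_drift_def algebra_simps)
qed

lemma spin_local_unroll:
  assumes "tame {..v} F"
  shows "spin_local (v - int n) v (unroll v F n)"
proof (induction n)
  case 0
  show ?case using assms unfolding spin_local_def tame_def unroll_0 by simp
next
  case (Suc n)
  have eq: "v - int (Suc n) = v - int n - 1" by simp
  show ?case unfolding unroll_Suc eq by (rule spin_local_refresh[OF Suc]) simp
qed

lemma integral_unroll:
  assumes "follows P" "tame {..v} F"
  shows "(\<integral>z. F z \<partial>P) = (\<integral>z. unroll v F n z \<partial>P)"
proof (induction n)
  case (Suc n)
  have "(\<integral>z. unroll v F n z \<partial>P) = (\<integral>z. unroll v F (Suc n) z \<partial>P)"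
    unfolding unroll_Suc by (rule integral_refresh[OF assms(1) _ spin_local_unroll[OF assms(2)]]) simp
  then show ?case using Suc by simp
qed (simp add: unroll_0)

text \<open>Erasing the spins leaves a function of the bits alone, whose integral is the same under
  all laws with fair bits. The constant plus is an arbitrary choice.\<close>

definition all_plus :: "config \<Rightarrow> config" where
  "all_plus z s = (True, bits z s)"

lemma unroll_forgets:
  assumes F: "tame {u..v} F" and z: "left_marked (bits z)"
  shows "(\<lambda>n. unroll v F (Suc n) z - unroll v F (Suc n) (all_plus z)) \<longlonglongrightarrow> 0"
proof -
  obtain B where B: "\<And>z. \<bar>F z\<bar> \<le> B" using F unfolding tame_def by blast
  let ?F = "\<lambda>x. F (\<lambda>s. (x s, bits z s))"
  have "(\<lambda>n. evolve (dr (bits z)) (v - int n) (Suc n) ?F (spins z) -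
      evolve (dr (bits z)) (v - int n) (Suc n) ?F (\<lambda>_. True)) \<longlonglongrightarrow> 0"
  proof (rule evolve_forgets[OF z])
    show "?F x = ?F y" if "\<And>s. u \<le> s \<Longrightarrow> s \<le> v \<Longrightarrow> x s = y s" for x y
      by (rule tameD[OF F]) (use that in simp)
    show "\<bar>?F x\<bar> \<le> B" for x by (rule B)
  qed
  moreover have "bits (all_plus z) = bits z" "spins (all_plus z) = (\<lambda>_. True)"
    by (auto simp: all_plus_def bits_def spins_def fun_eq_iff)
  moreover have "v + 1 - int (Suc n) = v - int n" for n by simp
  ultimately show ?thesis unfolding unroll_def by (simp only:)
qed

text \<open>Unrolling does not change the integral. By loss of memory the spins before the redrawn
  sites may be replaced by plus in the limit, and boundedness permits dominated convergence.\<close>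

lemma integral_limit:
  assumes P: "follows P" and F: "tame {u..v} F"
  shows "(\<lambda>n. \<integral>z. unroll v F (Suc n) (all_plus z) \<partial>P) \<longlonglongrightarrow> (\<integral>z. F z \<partial>P)"
proof -
  interpret prob_space P using P by (simp add: follows_def)
  have sets_P [measurable_cong]: "sets P = sets path_space" using P by (simp add: follows_def)
  obtain B where B: "\<And>z. \<bar>F z\<bar> \<le> B" using F unfolding tame_def by blast
  have Fv: "tame {..v} F" using F by (rule tame_mono) auto
  have U: "tame {..v} (unroll v F n)" for n by (rule spin_local_tame[OF spin_local_unroll[OF Fv]])
  have UB: "\<bar>unroll v F n z\<bar> \<le> B" for n z
    unfolding unroll_def using abs_drift_le B by (intro evolve_abs_le)
  have [measurable]: "unroll v F n \<in> borel_measurable P" for n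
    using tame_measurable[OF U] sets_P by (simp cong: measurable_cong_sets)
  have "all_plus \<in> measurable path_space path_space"
  proof (rule measurable_path)
    show "(\<lambda>z. all_plus z s) \<in> measurable path_space (count_space UNIV)" for s
      unfolding all_plus_def by (rule measurable_compose[OF measurable_bits]) simp
  qed
  then have [measurable]: "all_plus \<in> measurable P P"
    using sets_P by (simp cong: measurable_cong_sets)
  have int: "integrable P (unroll v F n)" "integrable P (\<lambda>z. unroll v F n (all_plus z))" for n
    using UB by (auto intro!: integrable_const_bound[of _ B])
  have "(\<lambda>n. \<integral>z. unroll v F (Suc n) z - unroll v F (Suc n) (all_plus z) \<partial>P) \<longlonglongrightarrow> (\<integral>z. 0 \<partial>P)"
  proof (rule integral_dominated_convergence[where w = "\<lambda>_. 2 * B"])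
    show "AE z in P. (\<lambda>n. unroll v F (Suc n) z - unroll v F (Suc n) (all_plus z)) \<longlonglongrightarrow> 0"
      using fair_AE_left_marked[OF follows_fair[OF P]]
      by eventually_elim (rule unroll_forgets[OF F])
    show "AE z in P. norm (unroll v F (Suc n) z - unroll v F (Suc n) (all_plus z)) \<le> 2 * B" for n
    proof (rule AE_I2)
      fix z
      show "norm (unroll v F (Suc n) z - unroll v F (Suc n) (all_plus z)) \<le> 2 * B"
        using UB[of "Suc n" z] UB[of "Suc n" "all_plus z"] by (simp add: abs_le_iff)
    qed
  qed simp_all
  then have "(\<lambda>n. (\<integral>z. F z \<partial>P) - (\<integral>z. unroll v F (Suc n) (all_plus z) \<partial>P)) \<longlonglongrightarrow> 0"
    unfolding Bochner_Integration.integral_diff[OF int] integral_unroll[OF P Fv, symmetric] by simp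
  from tendsto_diff[OF tendsto_const this, of "\<integral>z. F z \<partial>P"] show ?thesis by simp
qed

lemma integral_all_plus:
  fixes G :: "config \<Rightarrow> real"
  assumes "follows P" "follows P'" "G \<in> borel_measurable path_space"
  shows "(\<integral>z. G (all_plus z) \<partial>P) = (\<integral>z. G (all_plus z) \<partial>P')"
proof -
  have meas: "(\<lambda>\<omega>. G (\<lambda>s. (True, \<omega> s))) \<in> borel_measurable path_space"
  proof (rule measurable_compose[OF measurable_path assms(3)])
    show "(\<lambda>\<omega>. (True, \<omega> s)) \<in> measurable path_space (count_space UNIV)" for s :: int
      by (rule measurable_compose[where f = "\<lambda>\<omega>. \<omega> s", OF measurable_component_singleton]) auto
  qed
  have "(\<integral>z. G (all_plus z) \<partial>P) = (\<integral>\<omega>. G (\<lambda>s. (True, \<omega> s)) \<partial>distr P path_space bits)" if "follows P" for P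
  proof -
    have "bits \<in> measurable P path_space"
      using measurable_path[OF measurable_bits] that by (simp add: follows_def cong: measurable_cong_sets)
    from integral_distr[OF this meas] show ?thesis by (simp only: all_plus_def[abs_def])
  qed
  from this[OF assms(1)] this[OF assms(2)] show ?thesis
    unfolding distr_bits_eq[OF follows_fair[OF assms(1)] follows_fair[OF assms(2)]] by (rule trans[OF _ sym])
qed

text \<open>The probability of a cylinder is the limit of a sequence of integrals that depend only
  on the law of the bits, and that law is common to both measures.\<close>

theorem follows_unique:
  assumes P: "follows P" and P': "follows P'"
  shows "P = P'"
proof (rule measure_eqI_PiM_infinite)
  show "sets P = sets path_space" "sets P' = sets path_space"
    using assms by (auto simp: follows_def)
  show "finite_measure P" using P by (simp add: follows_def prob_space.finite_measure)
  fix A :: "int \<Rightarrow> (bool \<times> bool) set" and J :: "int set"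
  assume J: "finite J"
  let ?E = "prod_emb UNIV (\<lambda>_. count_space UNIV) J (Pi\<^sub>E J A)"
  have E: "?E = {z. \<forall>s\<in>J. z s \<in> A s}"
    by (auto simp: prod_emb_def PiE_iff space_PiM)
  have E_sets: "?E \<in> sets path_space"
    using J by (intro sets_PiM_I) auto
  define u where "u = Min (insert 0 J)"
  define v where "v = Max (insert 0 J)"
  have uv: "J \<subseteq> {u..v}" using J by (auto simp: u_def v_def)
  have F: "tame {u..v} (indicator ?E)"
  proof -
    have "z \<in> ?E \<longleftrightarrow> z' \<in> ?E" if "\<forall>s\<in>{u..v}. z s = z' s" for z z'
    proof -
      have "z s = z' s" if "s \<in> J" for s
        using \<open>\<forall>s\<in>{u..v}. z s = z' s\<close> uv that by blast
      then show ?thesis unfolding E by simp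
    qed
    then show ?thesis
      unfolding tame_def using E_sets by (auto intro!: exI[of _ 1] split: split_indicator)
  qed
  have "(\<integral>z. unroll v (indicator ?E) n (all_plus z) \<partial>P) = (\<integral>z. unroll v (indicator ?E) n (all_plus z) \<partial>P')" for n
    by (rule integral_all_plus[OF P P' tame_measurable[OF spin_local_tame[OF spin_local_unroll[OF tame_mono[OF F]]]]]) auto
  then have "(\<integral>z. indicator ?E z \<partial>P) = (\<integral>z. indicator ?E z \<partial>P' :: real)"
    using LIMSEQ_unique[OF integral_limit[OF P F]] integral_limit[OF P' F] by simp
  moreover have "emeasure P ?E = ennreal (\<integral>z. indicator ?E z \<partial>P)" if "follows P" for P
  proof -
    interpret prob_space P using that by (simp add: follows_def)
    have "?E \<in> sets P" using E_sets that by (simp add: follows_def)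
    then show ?thesis by (simp add: emeasure_eq_measure)
  qed
  ultimately show "emeasure P ?E = emeasure P' ?E" using P P' by simp
qed

end

subsection \<open>Existence\<close>

text \<open>A fair bit and an independent uniform variable. Comparing the latter with
  \<open>(1 + d) / 2\<close> yields a spin of mean \<open>d\<close>.\<close>

definition noise :: "(bool \<times> real) measure" where
  "noise = measure_pmf (bernoulli_pmf (1 / 2)) \<Otimes>\<^sub>M uniform_measure lborel {0..1}"

lemma prob_space_unit_interval: "prob_space (uniform_measure lborel {0..1 :: real})"
  by (intro prob_space_uniform_measure) auto

lemma prob_space_noise: "prob_space noise"
proof -
  interpret U: prob_space "uniform_measure lborel {0..1 :: real}" by (rule prob_space_unit_interval)
  interpret pair_prob_space "measure_pmf (bernoulli_pmf (1 / 2))" "uniform_measure lborel {0..1 :: real}" ..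
  show ?thesis unfolding noise_def by (rule prob_space_axioms)
qed

lemma sets_noise [measurable_cong]: "sets noise = sets (count_space UNIV \<Otimes>\<^sub>M borel)"
  unfolding noise_def by (intro sets_pair_measure_cong) auto

lemma measurable_noise:
  "fst \<in> measurable noise (count_space UNIV)" "snd \<in> borel_measurable noise"
  by measurable

lemma integral_unit_interval_threshold:
  fixes b :: "bool \<Rightarrow> real"
  assumes "0 \<le> c" "c \<le> 1"
  shows "(\<integral>u. b (u < c) \<partial>uniform_measure lborel {0..1}) = c * b True + (1 - c) * b False"
proof -
  interpret U: prob_space "uniform_measure lborel {0..1 :: real}" by (rule prob_space_unit_interval)
  have set: "{0..1} \<inter> {..<c} = {0..<c}" using assms by auto
  have meas: "measure (uniform_measure lborel {0..1}) {..<c} = c"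
    using assms by (subst measure_uniform_measure) (auto simp: set)
  have "b (u < c) = b False + (b True - b False) * indicator {..<c} u" for u
    by (simp add: indicator_def)
  then have "(\<integral>u. b (u < c) \<partial>uniform_measure lborel {0..1}) =
      (\<integral>u. b False + (b True - b False) * indicator {..<c} u \<partial>uniform_measure lborel {0..1})"
    by simp
  also have "\<dots> = b False + (b True - b False) * c"
  proof -
    have "integrable (uniform_measure lborel {0..1}) (indicator {..<c} :: real \<Rightarrow> real)"
      by (rule U.integrable_const_bound[of _ 1]) auto
    then show ?thesis by (subst Bochner_Integration.integral_add) (auto simp: meas U.prob_space)
  qed
  finally show ?thesis by (simp add: algebra_simps)
qed

lemma integral_noise_threshold:
  fixes f :: "bool \<Rightarrow> bool \<Rightarrow> real"
  assumes "\<And>w. \<bar>D w\<bar> \<le> 1"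
  shows "(\<integral>a. f (snd a < (1 + D (fst a)) / 2) (fst a) \<partial>noise) =
    (\<Sum>w\<in>UNIV. ((1 + D w) / 2 * f True w + (1 - D w) / 2 * f False w) / 2)"
proof -
  let ?U = "uniform_measure lborel {0..1 :: real}"
  interpret U: prob_space ?U by (rule prob_space_unit_interval)
  interpret pair_prob_space "measure_pmf (bernoulli_pmf (1 / 2))" ?U ..
  let ?g = "\<lambda>w u. f (u < (1 + D w) / 2) w"
  have [measurable]: "(\<lambda>a. ?g (fst a) (snd a)) \<in> borel_measurable noise"
  proof -
    have [measurable]: "fst \<in> measurable noise (count_space UNIV)" "snd \<in> borel_measurable noise"
      by (rule measurable_noise)+
    have "(\<lambda>a. ?g w (snd a)) \<in> borel_measurable noise" for w by measurable
    then show ?thesis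
      by (rule measurable_compose_countable) (rule measurable_noise)
  qed
  define B where "B = \<bar>f True True\<bar> + \<bar>f True False\<bar> + \<bar>f False True\<bar> + \<bar>f False False\<bar>"
  have B: "\<bar>f x y\<bar> \<le> B" for x y by (cases x; cases y) (auto simp: B_def)
  interpret N: prob_space noise by (rule prob_space_noise)
  have "integrable noise (\<lambda>a. ?g (fst a) (snd a))"
    using B by (intro N.integrable_const_bound[of _ B]) auto
  then have int: "integrable (measure_pmf (bernoulli_pmf (1 / 2)) \<Otimes>\<^sub>M ?U) (case_prod ?g)"
    by (simp add: noise_def case_prod_beta')
  have "(\<integral>a. ?g (fst a) (snd a) \<partial>noise) = (\<integral>w. (\<integral>u. ?g w u \<partial>?U) \<partial>measure_pmf (bernoulli_pmf (1 / 2)))"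
    using integral_fst[OF int] by (simp add: noise_def case_prod_beta')
  also have "(\<lambda>w. \<integral>u. ?g w u \<partial>?U) = (\<lambda>w. (1 + D w) / 2 * f True w + (1 - D w) / 2 * f False w)"
  proof
    fix w
    have "0 \<le> (1 + D w) / 2" "(1 + D w) / 2 \<le> 1" "1 - (1 + D w) / 2 = (1 - D w) / 2"
      using assms[of w] by (auto simp: abs_le_iff field_simps)
    then show "(\<integral>u. ?g w u \<partial>?U) = (1 + D w) / 2 * f True w + (1 - D w) / 2 * f False w"
      using integral_unit_interval_threshold[of "(1 + D w) / 2" "\<lambda>b. f b w"] by simp
  qed
  finally show ?thesis by (simp add: UNIV_bool)
qed

text \<open>Fubini for a single coordinate: the noise at \<open>t\<close> is independent of the rest
  and may be drawn last.\<close>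

lemma integral_resample:
  fixes g :: "('i \<Rightarrow> 'a) \<Rightarrow> real"
  assumes N: "prob_space N" and g: "g \<in> borel_measurable (PiM UNIV (\<lambda>_. N))" "\<And>\<theta>. \<bar>g \<theta>\<bar> \<le> B"
  shows "(\<integral>\<theta>. g \<theta> \<partial>PiM UNIV (\<lambda>_. N)) =
    (\<integral>X. (\<integral>x. g (X(t := x)) \<partial>N) \<partial>PiM (UNIV - {t}) (\<lambda>_. N))"
proof -
  let ?I = "PiM (UNIV - {t}) (\<lambda>_. N)"
  interpret N: prob_space N by fact
  interpret I: prob_space ?I by (intro prob_space_PiM N)
  interpret pair_prob_space N ?I ..
  have distr: "distr (N \<Otimes>\<^sub>M ?I) (PiM UNIV (\<lambda>_. N)) (\<lambda>(x, X). X(t := x)) = PiM UNIV (\<lambda>_. N)"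
    using distr_pair_PiM_eq_PiM[of "UNIV - {t}" "\<lambda>_. N" t] N by (simp add: insert_absorb)
  have upd: "(\<lambda>(x, X). X(t := x)) \<in> measurable (N \<Otimes>\<^sub>M ?I) (PiM UNIV (\<lambda>_. N))"
    unfolding case_prod_beta' by (rule measurable_fun_upd[where J = "UNIV - {t}"]) auto
  have "(\<lambda>p. g ((\<lambda>(x, X). X(t := x)) p)) \<in> borel_measurable (N \<Otimes>\<^sub>M ?I)"
    using upd g(1) by (rule measurable_compose)
  then have int: "integrable (N \<Otimes>\<^sub>M ?I) (case_prod (\<lambda>x X. g (X(t := x))))"
    using g(2) by (intro integrable_const_bound[of _ B]) (auto simp: case_prod_beta')
  have "(\<integral>\<theta>. g \<theta> \<partial>PiM UNIV (\<lambda>_. N)) = (\<integral>p. g ((\<lambda>(x, X). X(t := x)) p) \<partial>(N \<Otimes>\<^sub>M ?I))"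
    by (subst distr[symmetric]) (rule integral_distr[OF upd g(1)])
  also have "\<dots> = (\<integral>X. (\<integral>x. g (X(t := x)) \<partial>N) \<partial>?I)"
    using integral_snd[OF int] by (simp add: case_prod_beta')
  finally show ?thesis .
qed

section \<open>The maximal process driven by the noise\<close>

context drift_model
begin

lemma drift_mono:
  assumes "x \<le> y"
  shows "dr \<omega> t x \<le> dr \<omega> t y"
proof -
  have "\<phi> (average S x) \<le> \<phi> (average S y)" for S
    using abs_average_le[of S x] abs_average_le[of S y] average_mono[OF assms]
    by (intro phi_mono) (auto simp: abs_le_iff)
  then show ?thesis
    using h_nonneg by (simp add: drift_def Let_def mult_left_mono)
qed

lemma drift_finitely_many_parents:
  obtains S where "finite S" "\<And>x y. (\<And>s. s \<in> S \<Longrightarrow> x s = y s) \<Longrightarrow> dr \<omega> t x = dr \<omega> t y"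
proof -
  let ?S = "parents \<epsilon> ks \<omega> t (LEAST k. has_level \<epsilon> ks \<omega> t k)"
  have eq: "dr \<omega> t x = dr \<omega> t y" if "\<And>s. s \<in> ?S \<Longrightarrow> x s = y s" for x y
  proof -
    have "average ?S x = average ?S y" by (rule average_cong) (rule that)
    then show ?thesis by (simp only: drift_def Let_def)
  qed
  show ?thesis by (rule that[OF finite_parents]) (rule eq)
qed

definition spin_update :: "(int \<Rightarrow> bool \<times> real) \<Rightarrow> (int \<Rightarrow> bool) \<Rightarrow> int \<Rightarrow> bool" where
  "spin_update \<theta> x t \<longleftrightarrow> snd (\<theta> t) < (1 + dr (\<lambda>s. fst (\<theta> s)) t x) / 2"

primrec iterates :: "(int \<Rightarrow> bool \<times> real) \<Rightarrow> nat \<Rightarrow> int \<Rightarrow> bool" where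
  "iterates \<theta> 0 = (\<lambda>_. True)"
| "iterates \<theta> (Suc i) = spin_update \<theta> (iterates \<theta> i)"

text \<open>Since \<open>\<phi>\<close> is monotone, the iteration from the all-plus configuration decreases, and its limit is a
  fixed point because every drift depends on finitely many spins.\<close>

definition max_spins :: "(int \<Rightarrow> bool \<times> real) \<Rightarrow> int \<Rightarrow> bool" where
  "max_spins \<theta> t \<longleftrightarrow> (\<forall>i. iterates \<theta> i t)"

lemma spin_update_mono:
  assumes "x \<le> y"
  shows "spin_update \<theta> x \<le> spin_update \<theta> y"
proof (rule le_funI, rule le_boolI)
  fix t assume "spin_update \<theta> x t"
  then show "spin_update \<theta> y t"
    unfolding spin_update_def
    by (rule less_le_trans) (intro divide_right_mono add_left_mono drift_mono assms, simp)
qed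

lemma iterates_antimono: "i \<le> j \<Longrightarrow> iterates \<theta> j \<le> iterates \<theta> i"
proof -
  have "iterates \<theta> (Suc i) \<le> iterates \<theta> i" for i
  proof (induction i)
    case (Suc i)
    show ?case using spin_update_mono[OF Suc] by (simp only: iterates.simps)
  qed (simp add: le_fun_def)
  then show "i \<le> j \<Longrightarrow> iterates \<theta> j \<le> iterates \<theta> i" by (rule lift_Suc_antimono_le)
qed

lemma max_spins_fixpoint: "max_spins \<theta> t = spin_update \<theta> (max_spins \<theta>) t"
proof
  have le: "max_spins \<theta> \<le> iterates \<theta> i" for i by (auto simp: max_spins_def le_fun_def)
  show "max_spins \<theta> t" if "spin_update \<theta> (max_spins \<theta>) t"
    unfolding max_spins_def
  proof
    fix i
    show "iterates \<theta> i t"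
    proof (cases i)
      case (Suc j)
      have "spin_update \<theta> (iterates \<theta> j) t"
        using le_funD[OF spin_update_mono[OF le[of j]], of \<theta> t] that by simp
      then show ?thesis using Suc by simp
    qed simp
  qed
  show "spin_update \<theta> (max_spins \<theta>) t" if t: "max_spins \<theta> t"
  proof -
    obtain S where S: "finite S"
      "\<And>x y. (\<And>s. s \<in> S \<Longrightarrow> x s = y s) \<Longrightarrow> dr (\<lambda>s. fst (\<theta> s)) t x = dr (\<lambda>s. fst (\<theta> s)) t y"
      using drift_finitely_many_parents by blast
    have "\<exists>i. \<forall>j\<ge>i. iterates \<theta> j s = max_spins \<theta> s" for s
    proof (cases "max_spins \<theta> s")
      case True
      then show ?thesis by (auto simp: max_spins_def)
    next
      case False
      then obtain i where i: "\<not> iterates \<theta> i s" by (auto simp: max_spins_def)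
      have "\<not> iterates \<theta> j s" if "i \<le> j" for j
        using le_funD[OF iterates_antimono[OF that], of \<theta> s] i by simp
      then show ?thesis using False by auto
    qed
    then have "\<exists>i. \<forall>s. \<forall>j\<ge>i s. iterates \<theta> j s = max_spins \<theta> s" by (rule choice[OF allI])
    then obtain i where i: "\<And>s j. i s \<le> j \<Longrightarrow> iterates \<theta> j s = max_spins \<theta> s" by blast
    \<comment> \<open>After \<open>n\<close> steps the finitely many spins read by the drift at
      \<open>t\<close> have reached their limits. Inserting 0 covers an empty
      \<open>S\<close>.\<close>
    define n where "n = Max (insert 0 (i ` S))"
    have "iterates \<theta> n s = max_spins \<theta> s" if "s \<in> S" for s
      using that S(1) by (intro i) (auto simp: n_def)
    then have "dr (\<lambda>s. fst (\<theta> s)) t (iterates \<theta> n) = dr (\<lambda>s. fst (\<theta> s)) t (max_spins \<theta>)" by (rule S(2))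
    moreover have "iterates \<theta> (Suc n) t" using t unfolding max_spins_def by blast
    ultimately show ?thesis by (simp add: spin_update_def)
  qed
qed

text \<open>Each iterate at \<open>s\<close> uses the noise up to \<open>s\<close> only, because the
  drift is causal.\<close>

lemma max_spins_cong:
  assumes "\<And>s. s \<le> t \<Longrightarrow> \<theta> s = \<theta>' s"
  shows "max_spins \<theta> t = max_spins \<theta>' t"
proof -
  have "iterates \<theta> i s = iterates \<theta>' i s" if "s \<le> t" for i s
    using that
  proof (induction i arbitrary: s)
    case (Suc i)
    have "dr (\<lambda>s. fst (\<theta> s)) s (iterates \<theta> i) = dr (\<lambda>s. fst (\<theta>' s)) s (iterates \<theta>' i)"
      using Suc assms by (intro drift_cong) auto
    then show ?case using assms[OF Suc.prems] by (simp add: spin_update_def)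
  qed simp
  then show ?thesis by (simp add: max_spins_def)
qed

abbreviation noise_space :: "(int \<Rightarrow> bool \<times> real) measure" where
  "noise_space \<equiv> PiM UNIV (\<lambda>_. noise)"

lemma measurable_noise_space:
  "(\<lambda>\<theta>. fst (\<theta> s)) \<in> measurable noise_space (count_space UNIV)"
  "(\<lambda>\<theta>. snd (\<theta> s)) \<in> borel_measurable noise_space"
  by (rule measurable_compose[where f = "\<lambda>\<theta>. \<theta> s", OF measurable_component_singleton],
      simp, rule measurable_noise)+

lemma measurable_max_spins: "(\<lambda>\<theta>. max_spins \<theta> t) \<in> measurable noise_space (count_space UNIV)"
proof -
  have "(\<lambda>\<theta>. iterates \<theta> i t) \<in> measurable noise_space (count_space UNIV)" for i t
  proof (induction i arbitrary: t)
    case (Suc i)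
    have [measurable]: "(\<lambda>\<theta>. dr (\<lambda>s. fst (\<theta> s)) t (iterates \<theta> i)) \<in> borel_measurable noise_space"
      by (rule measurable_drift[OF measurable_noise_space(1) Suc])
    have [measurable]: "(\<lambda>\<theta>. snd (\<theta> t)) \<in> borel_measurable noise_space"
      by (rule measurable_noise_space(2))
    show ?case unfolding iterates.simps spin_update_def by measurable
  qed simp
  then show ?thesis unfolding max_spins_def by measurable
qed

definition max_process :: "(int \<Rightarrow> bool \<times> real) \<Rightarrow> config" where
  "max_process \<theta> t = (max_spins \<theta> t, fst (\<theta> t))"

lemma measurable_max_process: "max_process \<in> measurable noise_space path_space"
proof (rule measurable_path)
  fix s
  have "(\<lambda>\<theta>. (max_spins \<theta> s, fst (\<theta> s))) \<in> measurable noise_space (count_space UNIV \<Otimes>\<^sub>M count_space UNIV)"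
    by (rule measurable_Pair[OF measurable_max_spins measurable_noise_space(1)])
  then show "(\<lambda>\<theta>. max_process \<theta> s) \<in> measurable noise_space (count_space UNIV)"
    by (simp add: max_process_def pair_measure_countable)
qed

lemma site_kernel_cong:
  assumes H: "tame {..t} H" and eq: "\<And>s. s < t \<Longrightarrow> z s = z' s"
  shows "site_kernel t H z = site_kernel t H z'"
proof -
  have "H (z(t := p)) = H (z'(t := p))" for p
    by (rule tameD[OF H]) (use eq in auto)
  moreover have "config_drift t (z(t := p)) = config_drift t (z'(t := p))" for p
    by (rule config_drift_cong) (use eq in auto)
  ultimately show ?thesis by (simp add: site_kernel_def)
qed

text \<open>New noise at \<open>t\<close> leaves the process before \<open>t\<close> unchanged, and
  the fixed point equation then gives the symbol at \<open>t\<close> from the old past and the new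
  bit. The \<open>True\<close> in the updated configuration is a placeholder, as the drift at
  \<open>t\<close> ignores the spin at \<open>t\<close>.\<close>

lemma max_process_resample:
  fixes \<theta> :: "int \<Rightarrow> bool \<times> real"
  defines "z \<equiv> max_process \<theta>"
  shows "s < t \<Longrightarrow> max_process (\<theta>(t := p)) s = z s"
    and "max_process (\<theta>(t := p)) t =
      (snd p < (1 + config_drift t (z(t := (True, fst p)))) / 2, fst p)"
proof -
  show *: "max_process (\<theta>(t := p)) s = z s" if "s < t" for s
    using max_spins_cong[of s "\<theta>(t := p)" \<theta>] that by (simp add: z_def max_process_def)
  have "dr (\<lambda>s. fst ((\<theta>(t := p)) s)) t (max_spins (\<theta>(t := p))) = config_drift t (z(t := (True, fst p)))"
    unfolding config_drift_def
  proof (rule drift_cong)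
    show "fst ((\<theta>(t := p)) s) = bits (z(t := (True, fst p))) s" if "s \<le> t" for s
      by (simp add: bits_def z_def max_process_def)
    show "max_spins (\<theta>(t := p)) s = spins (z(t := (True, fst p))) s" if "s < t" for s
      using arg_cong[OF *[OF that], of fst] that by (simp add: max_process_def spins_def)
  qed
  then show "max_process (\<theta>(t := p)) t =
      (snd p < (1 + config_drift t (z(t := (True, fst p)))) / 2, fst p)"
    using max_spins_fixpoint[of "\<theta>(t := p)" t] by (simp add: max_process_def spin_update_def)
qed

text \<open>Integrating out the noise at \<open>t\<close> turns \<open>H\<close> into
  \<open>site_kernel t H\<close>. The result ignores the symbol at \<open>t\<close>, so the integral
  over that noise can be restored around it.\<close>

theorem follows_max_process: "follows (distr noise_space path_space max_process)"
  unfolding follows_def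
proof (intro conjI allI impI)
  interpret N: prob_space noise by (rule prob_space_noise)
  interpret O: prob_space noise_space by (intro prob_space_PiM prob_space_noise)
  show "prob_space (distr noise_space path_space max_process)"
    by (rule O.prob_space_distr[OF measurable_max_process])
  fix t H assume H: "tame {..t} H"
  obtain B where B: "\<And>z. \<bar>H z\<bar> \<le> B" using H unfolding tame_def by blast
  have meas_H: "H \<in> borel_measurable path_space" by (rule tame_measurable[OF H])
  have meas_K: "site_kernel t H \<in> borel_measurable path_space"
  proof -
    have [measurable]: "(\<lambda>z. config_drift t (z(t := p))) \<in> borel_measurable path_space"
      "(\<lambda>z. H (z(t := p))) \<in> borel_measurable path_space" for p
      by (rule measurable_compose[OF measurable_upd], rule tame_measurable, rule tame_config_drift,
        rule measurable_compose[OF measurable_upd meas_H])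
    show ?thesis unfolding site_kernel_def[abs_def] by measurable
  qed
  have BK: "\<bar>site_kernel t H z\<bar> \<le> B" for z
  proof -
    have "site_kernel t H z = (\<integral>p. H (z(t := (snd p < (1 + config_drift t (z(t := (True, fst p)))) / 2, fst p))) \<partial>noise)"
      unfolding site_kernel_bits
      by (rule integral_noise_threshold[where f = "\<lambda>b w. H (z(t := (b, w)))" and
            D = "\<lambda>w. config_drift t (z(t := (True, w)))", OF abs_config_drift_le, symmetric])
    also have "\<bar>\<dots>\<bar> \<le> (\<integral>p. B \<partial>noise)"
    proof (cases "integrable noise (\<lambda>p. H (z(t := (snd p < (1 + config_drift t (z(t := (True, fst p)))) / 2, fst p))))")
      case True
      then show ?thesis using B by (intro order.trans[OF integral_abs_bound] integral_mono) auto
    next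
      \<comment> \<open>The integral of a non-integrable function is 0 by convention, and
        \<open>0 \<le> B\<close>, so integrability need not be decided.\<close>
      case False
      then show ?thesis using B[of z] by (simp add: not_integrable_integral_eq N.prob_space)
    qed
    finally show ?thesis by (simp add: N.prob_space)
  qed
  let ?I = "PiM (UNIV - {t}) (\<lambda>_. noise)"
  have inner: "(\<integral>p. H (max_process (X(t := p))) \<partial>noise) = site_kernel t H (max_process X)" for X
  proof -
    let ?z = "max_process X"
    have "H (max_process (X(t := p))) = H (?z(t := (snd p < (1 + config_drift t (?z(t := (True, fst p)))) / 2, fst p)))" for p
    proof -
      have "max_process (X(t := p)) s =
          (?z(t := (snd p < (1 + config_drift t (?z(t := (True, fst p)))) / 2, fst p))) s" if "s \<le> t" for s
        using max_process_resample(1)[of s t X p] max_process_resample(2)[of X t p] that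
        by (cases "s = t") auto
      then show ?thesis using H unfolding tame_def by simp
    qed
    then show ?thesis
      unfolding site_kernel_bits
      using integral_noise_threshold[where f = "\<lambda>b w. H (?z(t := (b, w)))" and
            D = "\<lambda>w. config_drift t (?z(t := (True, w)))", OF abs_config_drift_le] by simp
  qed
  have const: "site_kernel t H (max_process (X(t := p))) = site_kernel t H (max_process X)" for X p
    by (rule site_kernel_cong[OF H max_process_resample(1)])
  show "(\<integral>z. H z \<partial>distr noise_space path_space max_process) =
      (\<integral>z. site_kernel t H z \<partial>distr noise_space path_space max_process)"
  proof -
    have "(\<integral>z. H z \<partial>distr noise_space path_space max_process) = (\<integral>\<theta>. H (max_process \<theta>) \<partial>noise_space)"
      by (rule integral_distr[OF measurable_max_process meas_H])
    also have "\<dots> = (\<integral>X. (\<integral>p. H (max_process (X(t := p))) \<partial>noise) \<partial>?I)"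
      by (rule integral_resample[OF prob_space_noise measurable_compose[OF measurable_max_process meas_H] B])
    also have "\<dots> = (\<integral>X. (\<integral>p. site_kernel t H (max_process (X(t := p))) \<partial>noise) \<partial>?I)"
      by (simp add: inner const N.prob_space)
    also have "\<dots> = (\<integral>\<theta>. site_kernel t H (max_process \<theta>) \<partial>noise_space)"
      by (rule integral_resample[OF prob_space_noise measurable_compose[OF measurable_max_process meas_K] BK, symmetric])
    also have "\<dots> = (\<integral>z. site_kernel t H z \<partial>distr noise_space path_space max_process)"
      by (rule integral_distr[OF measurable_max_process meas_K, symmetric])
    finally show ?thesis .
  qed
qed simp

end

subsection \<open>Laws specified by the g-function\<close>

text \<open>Agreement on some left half-line suffices, since marks can be sought as far to the left
  as desired.\<close>

lemma left_marked_shift: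
  assumes "left_marked \<omega>" "\<And>s. s \<le> u \<Longrightarrow> \<omega>' s = \<omega> (s + d)"
  shows "left_marked \<omega>'"
  unfolding left_marked_def
proof (intro allI)
  fix l t
  obtain b where b: "b \<le> min t u + d" "mark l \<omega> b" using assms(1) unfolding left_marked_def by blast
  have "mark l \<omega>' (b - d)"
    using mark_shift[of "b - d" \<omega>' \<omega> d l] assms(2) b by simp
  then show "\<exists>b\<le>t. mark l \<omega>' b" using b by (intro exI[of _ "b - d"]) auto
qed

text \<open>Between \<open>(n - 1)\<^sup>2\<close> and \<open>n\<^sup>2\<close> lie
  \<open>2 * n - 2\<close> non-squares, so for \<open>n\<close> larger than \<open>l\<close> the
  square \<open>n\<^sup>2\<close> ends a marker of length \<open>l\<close>. The choice of
  \<open>n\<close> also makes it larger than \<open>t\<close>.\<close>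

lemma right_marked_env: "right_marked (env w p)"
  unfolding right_marked_def
proof (intro allI)
  fix l :: nat and t :: int
  define n where "n = \<bar>t\<bar> + int l + 1"
  have n: "1 \<le> n" "t < n" "int l < n" by (auto simp: n_def)
  have n_sq: "n \<le> n\<^sup>2" using n(1) by (simp add: power2_eq_square)
  have pred_sq: "(n - 1)\<^sup>2 = n\<^sup>2 - 2 * n + 1" by (simp add: power2_eq_square algebra_simps)
  have "mark l (env w p) (n\<^sup>2)"
    unfolding mark_def
  proof (intro conjI ballI)
    have "0 < n\<^sup>2" using n n_sq by linarith
    then have "n\<^sup>2 \<noteq> 0" "\<not> n\<^sup>2 < 0" by linarith+
    then show "\<not> env w p (n\<^sup>2)" unfolding env_def by (simp only: if_False) blast
    fix s assume s: "s \<in> {n\<^sup>2 - int l<..<n\<^sup>2}"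
    then have "(n - 1)\<^sup>2 < s" using n(3) pred_sq by simp
    then have lower: "\<bar>n - 1\<bar> < \<bar>m\<bar>" if "s = m\<^sup>2" for m
      using that abs_le_square_iff[of m "n - 1"] by linarith
    have upper: "\<bar>m\<bar> < \<bar>n\<bar>" if "s = m\<^sup>2" for m
      using s that abs_le_square_iff[of n m] by simp
    have "\<nexists>m. s = m\<^sup>2"
    proof
      assume "\<exists>m. s = m\<^sup>2"
      then obtain m where "s = m\<^sup>2" by blast
      from lower[OF this] upper[OF this] show False using n(1) by linarith
    qed
    moreover have "0 < s" using \<open>(n - 1)\<^sup>2 < s\<close> by (metis le_less_trans zero_le_power2)
    ultimately show "env w p s" by (simp add: env_def)
  qed
  moreover have "t < n\<^sup>2" using n n_sq by linarith
  ultimately show "\<exists>b>t. mark l (env w p) b" by blast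
qed

lemma measurable_past: "(\<lambda>z. past z t) \<in> measurable path_space (\<Pi>\<^sub>M i\<in>UNIV. count_space UNIV)"
proof (rule measurable_PiM_single'[where f = "\<lambda>i z. past z t i"])
  show "(\<lambda>z. past z t i) \<in> measurable path_space (count_space UNIV)" for i
    unfolding past_def by (rule measurable_component_singleton) simp
qed simp

section \<open>Functions of the past and conditional expectations\<close>

context
  fixes P :: "config measure" and t :: int
  assumes P: "prob_space P" "sets P = sets path_space"
begin

abbreviation past_algebra :: "config measure" where
  "past_algebra \<equiv> vimage_algebra (space P) (\<lambda>z. past z t) (\<Pi>\<^sub>M i\<in>UNIV. count_space UNIV)"

lemma space_path_measure: "space P = UNIV"
  using sets_eq_imp_space_eq[OF P(2)] by (simp add: space_PiM)

lemma past_algebra_generated: "past_algebra = vimage_algebra UNIV (\<lambda>z. past z t) (\<Pi>\<^sub>M i\<in>UNIV. count_space UNIV)"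
  by (simp add: space_path_measure)

lemma past_algebra_sets:
  "sets past_algebra = {(\<lambda>z. past z t) -` A | A. A \<in> sets (\<Pi>\<^sub>M i\<in>UNIV. count_space UNIV)}"
proof -
  have "(\<lambda>z. past z t) \<in> UNIV \<rightarrow> space (\<Pi>\<^sub>M i\<in>UNIV. count_space UNIV)" by (simp add: space_PiM)
  from sets_vimage_algebra2[OF this] show ?thesis unfolding past_algebra_generated by (simp only: Int_UNIV_right)
qed

lemma finite_measure_subalgebra_past: "finite_measure_subalgebra P past_algebra"
proof -
  interpret prob_space P by (rule P(1))
  have "sets past_algebra \<subseteq> sets P"
    unfolding past_algebra_sets P(2)
    using measurable_sets[OF measurable_past] by (auto simp: space_PiM)
  then show ?thesis
    by unfold_locales (auto simp: subalgebra_def)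
qed

text \<open>Filling in a fixed symbol from \<open>t\<close> on turns \<open>Y\<close> into a
  function of the past sequence, an explicit form of the Doob-Dynkin factorisation.\<close>

lemma tame_past_measurable:
  assumes "tame {..<t} Y"
  shows "Y \<in> borel_measurable past_algebra"
proof -
  let ?fill = "\<lambda>q s. if s < t then q (nat (t - 1 - s)) else (True, True)"
  have fill: "?fill \<in> measurable (\<Pi>\<^sub>M i\<in>UNIV. count_space UNIV) path_space"
  proof (rule measurable_path)
    show "(\<lambda>q. ?fill q s) \<in> measurable (\<Pi>\<^sub>M i\<in>UNIV. count_space UNIV) (count_space UNIV)" for s
      by (cases "s < t") (simp_all add: measurable_component_singleton)
  qed
  have "Y z = Y (?fill (past z t))" for z
    by (rule tameD[OF assms]) (auto simp: past_def)
  then have "Y = (\<lambda>z. (\<lambda>q. Y (?fill q)) (past z t))" by (rule ext)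
  moreover have "(\<lambda>z. (\<lambda>q. Y (?fill q)) (past z t)) \<in> borel_measurable past_algebra"
  proof (rule measurable_compose[where f = "\<lambda>z. past z t" and g = "\<lambda>q. Y (?fill q)"])
    show "(\<lambda>z. past z t) \<in> measurable past_algebra (\<Pi>\<^sub>M i\<in>UNIV. count_space UNIV)"
      by (rule measurable_vimage_algebra1) (simp add: space_PiM)
    show "(\<lambda>q. Y (?fill q)) \<in> borel_measurable (\<Pi>\<^sub>M i\<in>UNIV. count_space UNIV)"
      by (rule measurable_compose[OF fill tame_measurable[OF assms]])
  qed
  ultimately show ?thesis by (simp only:)
qed

lemma tame_past_indicator:
  assumes "A \<in> sets past_algebra"
  shows "tame {..<t} (indicator A)"
proof -
  obtain A' where A': "A = (\<lambda>z. past z t) -` A'" "A' \<in> sets (\<Pi>\<^sub>M i\<in>UNIV. count_space UNIV)"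
    using assms unfolding past_algebra_sets by blast
  have "A \<in> sets path_space"
    unfolding A'(1) using measurable_sets[OF measurable_past A'(2)] by (simp add: space_PiM)
  moreover have "z \<in> A \<longleftrightarrow> z' \<in> A" if "\<forall>s\<in>{..<t}. z s = z' s" for z z'
  proof -
    have "past z t = past z' t" unfolding past_def using that by (intro ext) simp
    then show ?thesis unfolding A'(1) by simp
  qed
  ultimately show ?thesis
    unfolding tame_def by (auto intro!: exI[of _ 1] split: split_indicator)
qed

end

lemma tame_symbol: "s \<in> S \<Longrightarrow> tame S (indicator {z. z s = p})"
proof -
  assume s: "s \<in> S"
  have "{z. z s = p} \<in> sets path_space"
    using measurable_sets[OF measurable_component_singleton[of s UNIV "\<lambda>_. count_space UNIV"], of "{p}"]
    by (simp add: space_PiM vimage_def)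
  moreover have "indicator {z. z s = p} z = (indicator {z. z s = p} z' :: real)"
    if "\<forall>s\<in>S. z s = z' s" for z z' :: config
    using bspec[OF that s] by (simp add: indicator_def)
  ultimately show ?thesis
    unfolding tame_def by (auto intro!: exI[of _ 1])
qed

lemma sum_symbol_indicator:
  "(\<Sum>p\<in>UNIV. indicator {z. z t = p} z * H (z(t := p))) = (H z :: real)" for z :: config
proof -
  have "(\<Sum>p\<in>UNIV. indicator {z. z t = p} z * H (z(t := p))) = (\<Sum>p\<in>UNIV. if p = z t then H z else 0)"
    by (intro sum.cong) (auto simp: indicator_def)
  then show ?thesis by simp
qed

context drift_model
begin

abbreviation g :: "bool \<times> bool \<Rightarrow> (nat \<Rightarrow> bool \<times> bool) \<Rightarrow> real" where
  "g \<equiv> g_fun \<epsilon> ks \<phi> h"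

definition symbol_prob :: "int \<Rightarrow> bool \<times> bool \<Rightarrow> config \<Rightarrow> real" where
  "symbol_prob t p z = (1 + spin (fst p) * config_drift t (z(t := p))) / 4"

text \<open>Up to time 0, \<open>env\<close> is the shifted environment with the new bit in place.
  Left marks are inherited from \<open>z\<close> and right marks come from the squares, so
  \<open>psi\<close> equals the drift, which no longer sees the artificial future.\<close>

lemma g_fun_past:
  assumes z: "left_marked (bits z)"
  shows "g p (past z t) = symbol_prob t p z"
proof -
  let ?z = "z(t := p)"
  let ?w = "env (snd p) (\<lambda>i. snd (past z t i))"
  have w: "?w s = bits ?z (s + t)" if "s \<le> 0" for s
    using that by (auto simp: env_def bits_def past_def add.commute)
  have "?w s = bits z (s + t)" if "s \<le> -1" for s
    using w[of s] that by (simp add: bits_def)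
  then have lm: "left_marked ?w" by (rule left_marked_shift[OF z])
  have "psi \<epsilon> ks \<phi> h ?w 0 (\<lambda>i. spin (fst (past z t i))) = dr ?w 0 (\<lambda>s. spins ?z (s + t))"
  proof (rule psi_eq_drift[OF eps lm])
    show "right_marked ?w" by (rule right_marked_env)
    show "\<phi> 0 = 0" by (rule phi_zero)
    show "spin (fst (past z t (nat (0 - 1 - s)))) = spin (spins ?z (s + t))" if "s < 0" for s
      using that by (simp add: past_def spins_def add.commute)
  qed
  also have "\<dots> = dr (bits ?z) (0 + t) (spins ?z)"
    by (rule drift_shift) (use w in auto)
  finally show ?thesis by (simp add: g_fun_def symbol_prob_def config_drift_def)
qed

lemma tame_symbol_prob: "tame {..<t} (symbol_prob t p)"
proof -
  have "tame {..<t} (\<lambda>z. (1 + spin (fst p) * config_drift t (z(t := p))) * (1 / 4))"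
    by (intro tame_add tame_mult tame_const tame_upd[OF tame_config_drift]) auto
  then show ?thesis by (simp add: symbol_prob_def[abs_def])
qed

lemma site_kernel_symbol_prob: "site_kernel t H z = (\<Sum>p\<in>UNIV. symbol_prob t p z * H (z(t := p)))"
  by (simp add: site_kernel_def symbol_prob_def)

text \<open>The value of \<open>g\<close> is identified with \<open>symbol_prob\<close> in
  \<open>left_marked\<close> environments only, which calls for two passes. Fairness of the bits
  comes first and uses only that the two spin weights of \<open>g\<close> add up to 1/2, whatever
  \<open>psi\<close> is. It makes almost every environment \<open>left_marked\<close>, and then the
  drift can be inserted.\<close>

lemma specified_imp_follows:
  assumes P: "prob_space P" "sets P = sets path_space" and spec: "specified_by g P (\<lambda>t z. z t)"
  shows "follows P"
proof -
  interpret prob_space P by (rule P(1))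
  define r where "r t p = real_cond_exp P (past_algebra P t) (indicator {z. z t = p})" for t p
  have space: "space P = UNIV" using sets_eq_imp_space_eq[OF P(2)] by (simp add: space_PiM)
  have r: "AE z in P. r t p z = g p (past z t)" for t p
  proof -
    have "AE z in P. real_cond_exp P (past_algebra P t) (indicator {z \<in> space P. z t = p}) z = g p (past z t)"
      using spec unfolding specified_by_def by blast
    then show ?thesis unfolding r_def by (simp only: space UNIV_I simp_thms)
  qed
  have tame_int: "integrable P Y" if "tame S Y" for Y S
    by (rule tame_integrable[OF P that])
  have cond: "integrable P (\<lambda>z. Y z * r t p z)"
    "(\<integral>z. indicator {z. z t = p} z * Y z \<partial>P) = (\<integral>z. Y z * r t p z \<partial>P)"
    if Y: "tame {..<t} Y" for Y t p
  proof -
    interpret F: finite_measure_subalgebra P "past_algebra P t"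
      by (rule finite_measure_subalgebra_past[OF P])
    have int: "integrable P (\<lambda>z. Y z * indicator {z. z t = p} z)"
      by (rule tame_int[of "{..t}"], intro tame_mult tame_symbol tame_mono[OF Y]) auto
    have meas: "Y \<in> borel_measurable (past_algebra P t)" by (rule tame_past_measurable[OF P Y])
    have meas2: "indicator {z. z t = p} \<in> borel_measurable P"
      using tame_measurable[OF tame_symbol[of t "{t}" p]] P(2) by (simp cong: measurable_cong_sets)
    show "integrable P (\<lambda>z. Y z * r t p z)"
      unfolding r_def by (rule F.real_cond_exp_intg(1)[OF int meas meas2])
    show "(\<integral>z. indicator {z. z t = p} z * Y z \<partial>P) = (\<integral>z. Y z * r t p z \<partial>P)"
      unfolding r_def F.real_cond_exp_intg(2)[OF int meas meas2] by (simp add: mult.commute)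
  qed
  have total: "(\<integral>z. H z \<partial>P) = (\<integral>z. (\<Sum>p\<in>UNIV. H (z(t := p)) * r t p z) \<partial>P)" if H: "tame {..t} H" for H t
  proof -
    have Y: "tame {..<t} (\<lambda>z. H (z(t := p)))" for p by (rule tame_upd[OF H]) auto
    have int: "integrable P (\<lambda>z. indicator {z. z t = p} z * H (z(t := p)))" for p
      by (rule tame_int[of "{..t}"], intro tame_mult tame_symbol tame_mono[OF Y]) auto
    have "(\<integral>z. H z \<partial>P) = (\<integral>z. (\<Sum>p\<in>UNIV. indicator {z. z t = p} z * H (z(t := p))) \<partial>P)"
      by (simp only: sum_symbol_indicator)
    also have "\<dots> = (\<Sum>p\<in>UNIV. \<integral>z. H (z(t := p)) * r t p z \<partial>P)"
      by (subst Bochner_Integration.integral_sum) (simp_all only: int cond(2)[OF Y])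
    also have "\<dots> = (\<integral>z. (\<Sum>p\<in>UNIV. H (z(t := p)) * r t p z) \<partial>P)"
      by (rule Bochner_Integration.integral_sum[symmetric]) (rule cond(1)[OF Y])
    finally show ?thesis .
  qed
  \<comment> \<open>Measurability of \<open>g\<close> itself is not at hand, so the integrands are
    kept in terms of the conditional probabilities \<open>r\<close>. The constant 1 as test function
    yields their measurability.\<close>
  have r_meas: "r t p \<in> borel_measurable P" for t p
    using integrable_mult_left_iff cond(1)[OF tame_const[of _ 1], of t p] by (auto dest: borel_measurable_integrable)
  have "fair P"
    unfolding fair_def
  proof (intro conjI P allI impI)
    fix t A Y assume Y: "tame {..<t} Y"
    let ?H = "\<lambda>z. indicator A (snd (z t)) * Y z :: real"
    have tame_H: "tame {..t} ?H" by (intro tame_mult tame_bit tame_mono[OF Y]) auto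
    then have "(\<integral>z. ?H z \<partial>P) = (\<integral>z. (\<Sum>p\<in>UNIV. ?H (z(t := p)) * r t p z) \<partial>P)" by (rule total)
    also have "\<dots> = (\<integral>z. card A / 2 * Y z \<partial>P)"
    proof (rule integral_cong_AE)
      have "AE z in P. \<forall>p\<in>UNIV. r t p z = g p (past z t)"
        by (rule AE_finite_allI) (auto intro: r)
      then show "AE z in P. (\<Sum>p\<in>UNIV. ?H (z(t := p)) * r t p z) = card A / 2 * Y z"
      proof eventually_elim
        case (elim z)
        have Yz: "Y (z(t := p)) = Y z" for p by (rule tameD[OF Y]) auto
        have "r t p z = g p (past z t)" for p using elim by blast
        then have "(\<Sum>p\<in>UNIV. ?H (z(t := p)) * r t p z) = (\<Sum>p\<in>UNIV. indicator A (snd p) * Y z * g p (past z t))"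
          by (simp only: Yz fun_upd_same)
        also have "\<dots> = (indicator A True + indicator A False) / 2 * Y z"
          unfolding sum_bool_pair by (simp add: g_fun_def field_simps)
        finally show ?case unfolding card_bool_set .
      qed
      have upd: "(\<lambda>z. ?H (z(t := p))) \<in> borel_measurable P" for p
      proof -
        have "tame {..<t} (\<lambda>z. ?H (z(t := p)))"
          by (rule tame_upd[OF tame_H]) auto
        then show ?thesis by (rule borel_measurable_integrable[OF tame_int])
      qed
      show "(\<lambda>z. \<Sum>p\<in>UNIV. ?H (z(t := p)) * r t p z) \<in> borel_measurable P"
        by (intro borel_measurable_sum borel_measurable_times upd r_meas)
      show "(\<lambda>z. card A / 2 * Y z) \<in> borel_measurable P"
        using tame_int[OF Y] by simp
    qed
    finally show "(\<integral>z. ?H z \<partial>P) = card A / 2 * (\<integral>z. Y z \<partial>P)" by simp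
  qed
  then have lm: "AE z in P. left_marked (bits z)" by (rule fair_AE_left_marked)
  show ?thesis
    unfolding follows_def
  proof (intro conjI P allI impI)
    fix t H assume H: "tame {..t} H"
    have Y: "tame {..<t} (\<lambda>z. H (z(t := p)))" for p by (rule tame_upd[OF H]) auto
    have "AE z in P. \<forall>p\<in>UNIV. r t p z = g p (past z t)"
      by (rule AE_finite_allI) (auto intro: r)
    with lm have ae: "AE z in P. (\<Sum>p\<in>UNIV. H (z(t := p)) * r t p z) = site_kernel t H z"
    proof eventually_elim
      case (elim z)
      then have "r t p z = symbol_prob t p z" for p by (metis UNIV_I g_fun_past)
      then show ?case by (simp add: site_kernel_symbol_prob mult.commute)
    qed
    have "(\<integral>z. (\<Sum>p\<in>UNIV. H (z(t := p)) * r t p z) \<partial>P) = (\<integral>z. site_kernel t H z \<partial>P)"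
    proof (rule integral_cong_AE[OF _ _ ae])
      show "(\<lambda>z. \<Sum>p\<in>UNIV. H (z(t := p)) * r t p z) \<in> borel_measurable P"
        using borel_measurable_integrable[OF tame_int[OF Y]] by (intro borel_measurable_sum borel_measurable_times r_meas)
      show "site_kernel t H \<in> borel_measurable P"
        unfolding site_kernel_symbol_prob[abs_def]
        using borel_measurable_integrable[OF tame_int[OF Y]] borel_measurable_integrable[OF tame_int[OF tame_symbol_prob]]
        by (intro borel_measurable_sum borel_measurable_times)
    qed
    then show "(\<integral>z. H z \<partial>P) = (\<integral>z. site_kernel t H z \<partial>P)" using total[OF H] by simp
  qed
qed

text \<open>\<open>symbol_prob t p\<close> is a function of the past, and the one-site identity for
  a product of two indicators gives it the right integral over every past event.\<close>

lemma follows_imp_specified: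
  assumes "follows P"
  shows "specified_by g P (\<lambda>t z. z t)"
  unfolding specified_by_def
proof (intro conjI allI)
  have P: "prob_space P" "sets P = sets path_space" using assms by (auto simp: follows_def)
  interpret prob_space P by (rule P(1))
  have space: "space P = UNIV" using sets_eq_imp_space_eq[OF P(2)] by (simp add: space_PiM)
  show "(\<lambda>z. z t) \<in> measurable P (count_space UNIV)" for t
    using measurable_component_singleton[of t UNIV "\<lambda>_. count_space UNIV"] P(2)
    by (simp cong: measurable_cong_sets)
  fix t p
  interpret F: finite_measure_subalgebra P "past_algebra P t"
    by (rule finite_measure_subalgebra_past[OF P])
  have "AE z in P. real_cond_exp P (past_algebra P t) (indicator {z. z t = p}) z = symbol_prob t p z"
  proof (rule F.real_cond_exp_charact)
    fix A assume "A \<in> sets (past_algebra P t)"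
    then have A: "tame {..<t} (indicator A)" by (rule tame_past_indicator[OF P])
    let ?H = "\<lambda>z. indicator {z. z t = p} z * indicator A z :: real"
    have "tame {..t} ?H" by (intro tame_mult tame_symbol tame_mono[OF A]) auto
    then have "(\<integral>z. ?H z \<partial>P) = (\<integral>z. site_kernel t ?H z \<partial>P)" using assms by (simp add: follows_def)
    moreover have "site_kernel t ?H z = indicator A z * symbol_prob t p z" for z
    proof -
      have "indicator A (z(t := q)) = (indicator A z :: real)" for q by (rule tameD[OF A]) auto
      then have "site_kernel t ?H z = (\<Sum>q\<in>UNIV. if q = p then indicator A z * symbol_prob t p z else 0)"
        unfolding site_kernel_symbol_prob by (intro sum.cong) (auto simp: indicator_def)
      then show ?thesis by simp
    qed
    ultimately show "(\<integral>z\<in>A. indicator {z. z t = p} z \<partial>P) = (\<integral>z\<in>A. symbol_prob t p z \<partial>P)"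
      by (simp add: set_lebesgue_integral_def mult.commute)
  next
    show "integrable P (indicator {z. z t = p} :: config \<Rightarrow> real)"
      using tame_symbol[of t UNIV p] by (intro tame_integrable[OF P]) auto
    show "integrable P (symbol_prob t p)" by (rule tame_integrable[OF P tame_symbol_prob])
    show "symbol_prob t p \<in> borel_measurable (past_algebra P t)"
      by (rule tame_past_measurable[OF P tame_symbol_prob])
  qed
  moreover have "AE z in P. left_marked (bits z)" by (rule fair_AE_left_marked[OF follows_fair[OF assms]])
  ultimately show "AE z in P. real_cond_exp P (past_algebra P t) (indicator {z \<in> space P. z t = p}) z = g p (past z t)"
    by eventually_elim (simp add: space g_fun_past)
qed

text \<open>Translation invariance of the drift turns the one-site identity at \<open>t\<close> for
  the shifted law into the one at \<open>t + r\<close> for \<open>P\<close>.\<close>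

lemma follows_shift:
  assumes "follows P"
  shows "follows (distr P path_space (\<lambda>z t. z (t + r)))"
  unfolding follows_def
proof (intro conjI allI impI)
  interpret prob_space P using assms by (simp add: follows_def)
  let ?sh = "\<lambda>(z :: config) t. z (t + r)"
  have sets_P: "sets P = sets path_space" using assms by (simp add: follows_def)
  have sh: "?sh \<in> measurable path_space path_space"
    by (rule measurable_path) (rule measurable_component_singleton, simp)
  then have shP: "?sh \<in> measurable P path_space" using sets_P by (simp cong: measurable_cong_sets)
  show "prob_space (distr P path_space ?sh)" by (rule prob_space_distr[OF shP])
  fix t H assume H: "tame {..t} H"
  have H': "tame {..t + r} (\<lambda>z. H (?sh z))"
  proof -
    have "H (?sh z) = H (?sh z')" if "\<forall>s\<in>{..t + r}. z s = z' s" for z z'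
      by (rule tameD[OF H]) (use that in auto)
    moreover have "(\<lambda>z. H (?sh z)) \<in> borel_measurable path_space"
      by (rule measurable_compose[OF sh tame_measurable[OF H]])
    ultimately show ?thesis using H unfolding tame_def by blast
  qed
  have kernel_shift: "site_kernel (t + r) (\<lambda>z. H (?sh z)) z = site_kernel t H (?sh z)" for z
  proof -
    have upd: "?sh (z(t + r := p)) = (?sh z)(t := p)" for p by (auto simp: fun_eq_iff)
    have "config_drift (t + r) z' = config_drift t (?sh z')" for z'
      unfolding config_drift_def by (rule drift_shift[symmetric]) (auto simp: bits_def spins_def)
    then show ?thesis unfolding site_kernel_def by (simp only: upd)
  qed
  have meas_K: "site_kernel t H \<in> borel_measurable path_space"
  proof -
    have "tame {..<t} (\<lambda>z. H (z(t := p)))" for p by (rule tame_upd[OF H]) auto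
    then show ?thesis
      unfolding site_kernel_symbol_prob[abs_def]
      by (intro borel_measurable_sum borel_measurable_times tame_measurable[OF tame_symbol_prob]) (rule tame_measurable)
  qed
  have "(\<integral>z. H z \<partial>distr P path_space ?sh) = (\<integral>z. H (?sh z) \<partial>P)"
    by (rule integral_distr[OF shP tame_measurable[OF H]])
  also have "\<dots> = (\<integral>z. site_kernel (t + r) (\<lambda>z. H (?sh z)) z \<partial>P)"
    using assms H' unfolding follows_def by blast
  also have "\<dots> = (\<integral>z. site_kernel t H z \<partial>distr P path_space ?sh)"
    unfolding kernel_shift by (rule integral_distr[OF shP meas_K, symmetric])
  finally show "(\<integral>z. H z \<partial>distr P path_space ?sh) = (\<integral>z. site_kernel t H z \<partial>distr P path_space ?sh)" .
qed simp

theorem unique_stationary_law: "\<exists>!P. stationary_law_specified_by g P"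
proof
  let ?P = "distr noise_space path_space max_process"
  have P: "follows ?P" by (rule follows_max_process)
  have "stationary ?P (\<lambda>t z. z t)"
    unfolding stationary_def
  proof
    fix r
    have "distr ?P path_space (\<lambda>z t. z (t + r)) = ?P"
      by (rule follows_unique[OF follows_shift[OF P] P])
    moreover have "distr ?P path_space (\<lambda>z t. z t) = ?P"
      by (rule distr_id2) simp
    ultimately show "distr ?P path_space (\<lambda>z t. z (t + r)) = distr ?P path_space (\<lambda>z t. z t)" by (simp only:)
  qed
  then show "stationary_law_specified_by g ?P"
    using P follows_imp_specified[OF P] by (simp add: stationary_law_specified_by_def follows_def)
  show "P' = ?P" if "stationary_law_specified_by g P'" for P'
    using that by (intro follows_unique[OF specified_imp_follows P])
      (auto simp: stationary_law_specified_by_def)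
qed

end

section \<open>The linear bound from the behaviour of \<phi> at 0\<close>

lemma linear_bound_of_Limsup:
  fixes \<phi> :: "real \<Rightarrow> real"
  assumes range: "\<forall>z\<in>{-1..1}. \<phi> z \<in> {-1..1}" and mono: "mono_on {-1..1} \<phi>"
    and odd: "\<forall>z\<in>{-1..1}. \<phi> (- z) = - \<phi> z"
    and lim: "Limsup (at_right 0) (\<lambda>z. ereal (\<phi> z / z)) < \<infinity>"
  shows "\<exists>C. \<forall>z. \<bar>z\<bar> \<le> 1 \<longrightarrow> \<bar>\<phi> z\<bar> \<le> C * \<bar>z\<bar>"
proof -
  obtain n :: nat where "Limsup (at_right 0) (\<lambda>z. ereal (\<phi> z / z)) < ereal n"
    using lim less_PInf_Ex_of_nat[of "Limsup (at_right 0) (\<lambda>z. ereal (\<phi> z / z))"] by auto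
  then have "\<forall>\<^sub>F z in at_right 0. ereal (\<phi> z / z) < ereal n" by (rule Limsup_lessD)
  then obtain b where b: "0 < b" "\<And>z. 0 < z \<Longrightarrow> z < b \<Longrightarrow> \<phi> z / z < n"
    unfolding eventually_at_right_field by auto
  \<comment> \<open>\<open>n\<close> bounds the slope below \<open>b\<close>; from \<open>b\<close>
    on, the bound \<open>\<phi> z \<le> 1\<close> gives a slope of at most
    \<open>1 / b\<close>.\<close>
  define C where "C = max (real n) (1 / b)"
  have zero: "\<phi> 0 = 0" using odd[rule_format, of 0] by simp
  have pos: "\<bar>\<phi> z\<bar> \<le> C * z" if z: "0 < z" "z \<le> 1" for z
  proof -
    have "\<phi> 0 \<le> \<phi> z" using z by (intro mono_onD[OF mono]) auto
    moreover have "\<phi> z \<le> C * z"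
    proof (cases "z < b")
      case True
      then have "\<phi> z < real n * z" using b(2)[of z] z by (simp add: divide_less_eq)
      also have "\<dots> \<le> C * z" using z by (intro mult_right_mono) (auto simp: C_def)
      finally show ?thesis by simp
    next
      case False
      have "\<phi> z \<le> 1" using range z by auto
      also have "1 \<le> 1 / b * z" using False b(1) by (simp add: field_simps)
      also have "\<dots> \<le> C * z" using z by (intro mult_right_mono) (auto simp: C_def)
      finally show ?thesis .
    qed
    ultimately show ?thesis using zero by simp
  qed
  have "\<bar>\<phi> z\<bar> \<le> C * \<bar>z\<bar>" if "\<bar>z\<bar> \<le> 1" for z
  proof (cases z "0 :: real" rule: linorder_cases)
    case less
    then show ?thesis using pos[of "- z"] odd that by simp
  qed (use pos[of z] zero that in auto)
  then show ?thesis by blast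
qed

lemma beta_at_top: "0 < \<epsilon> \<Longrightarrow> filterlim (\<lambda>k. beta \<epsilon> (k - 1)) at_top sequentially"
proof -
  assume "0 < \<epsilon>"
  have "filterlim (\<lambda>n. 2 ^ n :: real) at_top sequentially"
    by (rule filterlim_at_top_mono[OF filterlim_real_sequentially])
      (simp add: less_imp_le[OF of_nat_less_two_power])
  then have "filterlim (\<lambda>k. beta \<epsilon> k) at_top sequentially"
    unfolding beta_def by (rule filterlim_compose[OF _ ell_at_top[OF \<open>0 < \<epsilon>\<close>]])
  then show ?thesis
    by (rule filterlim_compose[OF _ filterlim_minus_const_nat_at_top])
qed

theorem theorem2:
  fixes \<epsilon> :: real
  assumes "0 < \<epsilon>" and "\<epsilon> < 1"
  shows "\<exists>K. \<forall>ks\<ge>K. \<forall>(\<phi> :: real \<Rightarrow> real) \<alpha>.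
    (\<forall>z\<in>{-1..1}. \<phi> z \<in> {-1..1}) \<and>
    mono_on {-1..1} \<phi> \<and>
    (\<forall>z\<in>{-1..1}. \<phi> (- z) = - \<phi> z) \<and>
    0 \<le> Liminf (at_left 0) (\<lambda>z. ereal (\<phi> z / z)) \<and>
    Liminf (at_left 0) (\<lambda>z. ereal (\<phi> z / z)) = Limsup (at_right 0) (\<lambda>z. ereal (\<phi> z / z)) \<and>
    Limsup (at_right 0) (\<lambda>z. ereal (\<phi> z / z)) < \<infinity> \<and>
    0 < \<alpha> \<longrightarrow>
    (\<exists>!P. stationary_law_specified_by
       (g_fun \<epsilon> ks \<phi> (\<lambda>k. beta \<epsilon> (k - 1) powr (- \<alpha>))) P)"
proof (intro exI[of _ 0] allI impI, elim conjE)
  fix ks :: nat and \<phi> :: "real \<Rightarrow> real" and \<alpha> :: real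
  assume asm: "\<forall>z\<in>{-1..1}. \<phi> z \<in> {-1..1}" "mono_on {-1..1} \<phi>"
    "\<forall>z\<in>{-1..1}. \<phi> (- z) = - \<phi> z" "Limsup (at_right 0) (\<lambda>z. ereal (\<phi> z / z)) < \<infinity>" "0 < \<alpha>"
  obtain C where C: "\<And>z. \<bar>z\<bar> \<le> 1 \<Longrightarrow> \<bar>\<phi> z\<bar> \<le> C * \<bar>z\<bar>"
    using linear_bound_of_Limsup[OF asm(1-4)] by blast
  interpret drift_model \<epsilon> ks \<phi> "\<lambda>k. beta \<epsilon> (k - 1) powr (- \<alpha>)" C
  proof
    show "\<bar>\<phi> z\<bar> \<le> 1" if "\<bar>z\<bar> \<le> 1" for z
      using asm(1) that by (auto simp: abs_le_iff)
    show "\<phi> y \<le> \<phi> z" if "-1 \<le> y" "y \<le> z" "z \<le> 1" for y z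
      using asm(2) that by (auto intro: mono_onD)
    show "beta \<epsilon> (k - 1) powr (- \<alpha>) \<le> 1" for k
    proof -
      have "1 \<le> beta \<epsilon> (k - 1)" by (simp add: beta_def)
      then have "beta \<epsilon> (k - 1) powr (- \<alpha>) \<le> beta \<epsilon> (k - 1) powr 0"
        using asm(5) by (intro powr_mono) auto
      then show ?thesis using \<open>1 \<le> beta \<epsilon> (k - 1)\<close> by simp
    qed
    show "(\<lambda>k. beta \<epsilon> (k - 1) powr (- \<alpha>)) \<longlonglongrightarrow> 0"
      using asm(5) by (intro tendsto_neg_powr beta_at_top assms) auto
  qed (use assms C in auto)
  show "\<exists>!P. stationary_law_specified_by (g_fun \<epsilon> ks \<phi> (\<lambda>k. beta \<epsilon> (k - 1) powr (- \<alpha>))) P"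
    by (rule unique_stationary_law)
qed

end
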